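(* Let $\Omega\subset\mathbb R^2$ be a bounded convex domain with $C^2$ boundary. Assume $u(x,t)$ is the unique viscosity solution of $u_t=F[u]$ in $\Omega\times[0,\infty)$ with $u(x,0)=u_0(x)$ and homogeneous Neumann boundary conditions. Assume $K$ and $L$ are picked so that $F^{e,\delta}$ is consistent with $F$. For each $\epsilon=\epsilon(h,d\theta)>0$, let $u^{e,\epsilon}$ (resp. $u^{f,\epsilon}$) be the uniformly bounded solution of the monotone time discretization $u(\cdot,t+dt)=u(\cdot,t)+dt\,F^{e,\delta}[u(\cdot,t)]$ (resp. the filtered time discretization $u(\cdot,t+dt)=u(\cdot,t)+dt\,F^{f,\delta}[u(\cdot,t)]$) with $dt\le1/K^h$, where $K^h=\frac Kh+\frac{2L}{(h\,n_\theta)^2}$ is the Lipschitz constant of $F^{e,\delta}$. Then $u^{e,\epsilon}\to u$ and $u^{f,\epsilon}\to u$ locally uniformly as $dt,\epsilon\to0$.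
   Context: $F[u]=\lvert\nabla u\rvert(k[u])^{1/3}=\left(u_{xx}u_y^2-2u_xu_yu_{xy}+u_{yy}u_x^2\right)^{1/3}$ (real cube root), $k[u]=\operatorname{div}(\nabla u/\lvert\nabla u\rvert)$; viscosity solutions in the Crandall–Ishii–Lions sense, with the Neumann condition imposed in the generalized viscosity sense. Regularization: $A(p,q)=(p^2q)^{1/3}$, $A^\delta(p,q)=\operatorname{sgn}(q)\min(\lvert A(p,q)\rvert,K\lvert p\rvert,L\lvert q\rvert)$ ($\operatorname{sgn}(0)=0$), $A^{\delta,\pm}(p,q)=A^\delta(p^\pm,q^\pm)$, $x^+=\max(x,0)$, $x^-=\min(x,0)$; $K=K(\delta),L=L(\delta)>0$, $K\sqrt L\ge1$. Grid spacing $h$; $\lvert u_x^h\rvert^+=\max\{\frac{u(x,y)-u(x+h,y)}h,\frac{u(x,y)-u(x-h,y)}h,0\}$, $\lvert u_x^h\rvert^-=-\min\{\frac{u(x,y)-u(x+h,y)}h,\frac{u(x,y)-u(x-h,y)}h,0\}$, similarly in $y$, $\lvert\nabla u^h\rvert^\pm=\sqrt{(\lvert u_x^h\rvert^\pm)^2+(\lvert u_y^h\rvert^\pm)^2}$. Median scheme: stencil width $n_\theta$, $n_S$ neighbours $(x_i,y_i)$ of $(x,y)$, $d\theta=2\pi/n_S$, $(x_{i+1},y_{i+1})-(x,y)=h\,n_\theta(\cos(i\,d\theta),\sin(i\,d\theta))+(e_i,f_i)$, $\lvert e_i\rvert,\lvert f_i\rvert\le h$, $\Delta_1^eu=2\frac{\operatorname{median}_iu(x_i,y_i)-u(x,y)}{(h\,n_\theta)^2}$.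 Regularized elliptic scheme: $-F^{e,\delta}[u]=A^{\delta,+}(\lvert\nabla u^h\rvert^+,-\Delta_1^eu)+A^{\delta,-}(-\lvert\nabla u^h\rvert^-,-\Delta_1^eu)$. Standard scheme $F^a[u]=(u_{xx}^h(u_y^h)^2-2u_x^hu_y^hu_{xy}^h+u_{yy}^h(u_x^h)^2)^{1/3}$ with standard centered second-order differences. Filter: for $\epsilon>0$, $A_\epsilon=\{(a,b):\lvert a-b\rvert<\epsilon\}$, $\rho=10\epsilon$, $d=\operatorname{dist}((a,b),A_\epsilon)$, $S^\epsilon(a,b)=a$ on $A_\epsilon$, $\frac{\rho-d}\rho a+\frac d\rho b$ if $d\le\rho$, $b$ otherwise; $F^{f,\delta}[u]=S^\epsilon(F^a[u],F^{e,\delta}[u])$ with $\epsilon=\epsilon(h,d\theta)$. Consistency of $F^{e,\delta}$ with $F$ means $F^{e,\delta}[\phi]\to F[\phi]$ as $h,d\theta\to0$ for smooth $\phi$. *)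

theory Defs
  imports "HOL-Analysis.Analysis"
begin

text \<open>Affine curvature operator F expressed through the spatial gradient p and Hessian X.
  Isabelle's root 3 is the real (sign preserving) cube root.\<close>
definition Fop :: "real^2 \<Rightarrow> real^2^2 \<Rightarrow> real" where
  "Fop p X = root 3 (X$1$1 * (p$2)^2 - 2 * p$1 * p$2 * X$1$2 + X$2$2 * (p$1)^2)"

definition C2_space :: "(real^2 \<Rightarrow> real) \<Rightarrow> (real^2 \<Rightarrow> real^2) \<Rightarrow> (real^2 \<Rightarrow> real^2^2) \<Rightarrow> bool" where
  "C2_space f g Hs \<longleftrightarrow>
     (\<forall>x. (f has_derivative (\<lambda>v. g x \<bullet> v)) (at x)) \<and>
     (\<forall>x. (g has_derivative (\<lambda>v. Hs x *v v)) (at x)) \<and>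
     continuous_on UNIV Hs"

definition test_fn :: "(real^2 \<Rightarrow> real \<Rightarrow> real) \<Rightarrow> (real^2 \<Rightarrow> real \<Rightarrow> real^2) \<Rightarrow>
    (real^2 \<Rightarrow> real \<Rightarrow> real^2^2) \<Rightarrow> (real^2 \<Rightarrow> real \<Rightarrow> real) \<Rightarrow> bool" where
  "test_fn \<phi> G H T \<longleftrightarrow>
     (\<forall>x t. ((\<lambda>y. \<phi> y t) has_derivative (\<lambda>v. G x t \<bullet> v)) (at x)) \<and>
     (\<forall>x t. ((\<lambda>y. G y t) has_derivative (\<lambda>v. H x t *v v)) (at x)) \<and>
     (\<forall>x t. ((\<lambda>s. \<phi> x s) has_real_derivative T x t) (at t)) \<and>
     continuous_on UNIV (\<lambda>(x,t). G x t) \<and>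
     continuous_on UNIV (\<lambda>(x,t). H x t) \<and>
     continuous_on UNIV (\<lambda>(x,t). T x t)"

definition C2_domain :: "(real^2) set \<Rightarrow> (real^2 \<Rightarrow> real) \<Rightarrow> (real^2 \<Rightarrow> real^2) \<Rightarrow> bool" where
  "C2_domain \<Omega> \<rho> D\<rho> \<longleftrightarrow>
     open \<Omega> \<and> connected \<Omega> \<and> \<Omega> \<noteq> {} \<and> bounded \<Omega> \<and> convex \<Omega> \<and>
     (\<exists>H\<rho>. C2_space \<rho> D\<rho> H\<rho>) \<and>
     \<Omega> = {x. \<rho> x < 0} \<and> (\<forall>x. \<rho> x = 0 \<longrightarrow> D\<rho> x \<noteq> 0)"

definition outer_normal :: "(real^2 \<Rightarrow> real^2) \<Rightarrow> real^2 \<Rightarrow> real^2" where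
  "outer_normal D\<rho> x = D\<rho> x /\<^sub>R norm (D\<rho> x)"

definition loc_max_rel :: "(real^2) set \<Rightarrow> (real^2 \<Rightarrow> real \<Rightarrow> real) \<Rightarrow> real^2 \<Rightarrow> real \<Rightarrow> bool" where
  "loc_max_rel \<Omega> w x t \<longleftrightarrow> (\<exists>r>0. \<forall>y s. y \<in> closure \<Omega> \<longrightarrow> s > 0 \<longrightarrow>
      dist (y, s) (x, t) < r \<longrightarrow> w y s \<le> w x t)"

definition loc_min_rel :: "(real^2) set \<Rightarrow> (real^2 \<Rightarrow> real \<Rightarrow> real) \<Rightarrow> real^2 \<Rightarrow> real \<Rightarrow> bool" where
  "loc_min_rel \<Omega> w x t \<longleftrightarrow> (\<exists>r>0. \<forall>y s. y \<in> closure \<Omega> \<longrightarrow> s > 0 \<longrightarrow>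
      dist (y, s) (x, t) < r \<longrightarrow> w y s \<ge> w x t)"

text \<open>Continuous viscosity solution (Crandall-Ishii-Lions) of u_t = F[u] in Omega x (0,inf),
  u(.,0) = u0, with homogeneous Neumann condition in the generalized viscosity sense.\<close>
definition visc_sol :: "(real^2) set \<Rightarrow> (real^2 \<Rightarrow> real^2) \<Rightarrow> (real^2 \<Rightarrow> real) \<Rightarrow>
    (real^2 \<Rightarrow> real \<Rightarrow> real) \<Rightarrow> bool" where
  "visc_sol \<Omega> D\<rho> u0 u \<longleftrightarrow>
     continuous_on (closure \<Omega> \<times> {0..}) (\<lambda>(x,t). u x t) \<and>
     (\<forall>x\<in>closure \<Omega>. u x 0 = u0 x) \<and>
     (\<forall>\<phi> G H T x t. test_fn \<phi> G H T \<longrightarrow> x \<in> closure \<Omega> \<longrightarrow> t > 0 \<longrightarrow>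
        loc_max_rel \<Omega> (\<lambda>y s. u y s - \<phi> y s) x t \<longrightarrow>
        (x \<in> \<Omega> \<longrightarrow> T x t - Fop (G x t) (H x t) \<le> 0) \<and>
        (x \<in> frontier \<Omega> \<longrightarrow>
           min (T x t - Fop (G x t) (H x t)) (G x t \<bullet> outer_normal D\<rho> x) \<le> 0)) \<and>
     (\<forall>\<phi> G H T x t. test_fn \<phi> G H T \<longrightarrow> x \<in> closure \<Omega> \<longrightarrow> t > 0 \<longrightarrow>
        loc_min_rel \<Omega> (\<lambda>y s. u y s - \<phi> y s) x t \<longrightarrow>
        (x \<in> \<Omega> \<longrightarrow> T x t - Fop (G x t) (H x t) \<ge> 0) \<and>
        (x \<in> frontier \<Omega> \<longrightarrow>
           max (T x t - Fop (G x t) (H x t)) (G x t \<bullet> outer_normal D\<rho> x) \<ge> 0))"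

definition cbrtA :: "real \<Rightarrow> real \<Rightarrow> real" where
  "cbrtA p q = root 3 (p^2 * q)"

definition Adelta :: "real \<Rightarrow> real \<Rightarrow> real \<Rightarrow> real \<Rightarrow> real" where
  "Adelta K L p q = sgn q * min (min \<bar>cbrtA p q\<bar> (K * \<bar>p\<bar>)) (L * \<bar>q\<bar>)"

definition pos_part :: "real \<Rightarrow> real" where "pos_part x = max x 0"
definition neg_part :: "real \<Rightarrow> real" where "neg_part x = min x 0"

definition Adelta_plus :: "real \<Rightarrow> real \<Rightarrow> real \<Rightarrow> real \<Rightarrow> real" where
  "Adelta_plus K L p q = Adelta K L (pos_part p) (pos_part q)"
definition Adelta_minus :: "real \<Rightarrow> real \<Rightarrow> real \<Rightarrow> real \<Rightarrow> real" where
  "Adelta_minus K L p q = Adelta K L (neg_part p) (neg_part q)"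

definition gpt :: "real \<Rightarrow> real^2 \<Rightarrow> real \<Rightarrow> real \<Rightarrow> real^2" where
  "gpt h x a b = x + h *\<^sub>R vector [a, b]"

definition median :: "real list \<Rightarrow> real" where
  "median xs = (let s = sort xs; n = length xs in
     if odd n then s ! (n div 2) else (s ! (n div 2 - 1) + s ! (n div 2)) / 2)"

text \<open>Valid stencil: integer offsets (a_i,b_i), i < nS, with
  h*(a_i,b_i) = h n_theta (cos(i dtheta), sin(i dtheta)) + (e_i,f_i), |e_i|,|f_i| <= h.\<close>
definition valid_stencil :: "nat \<Rightarrow> nat \<Rightarrow> (nat \<Rightarrow> int \<times> int) \<Rightarrow> bool" where
  "valid_stencil n\<theta> nS off \<longleftrightarrow> (\<forall>i<nS.
     \<bar>real_of_int (fst (off i)) - real n\<theta> * cos (real i * (2 * pi / real nS))\<bar> \<le> 1 \<and>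
     \<bar>real_of_int (snd (off i)) - real n\<theta> * sin (real i * (2 * pi / real nS))\<bar> \<le> 1)"

definition Delta1 :: "real \<Rightarrow> nat \<Rightarrow> nat \<Rightarrow> (nat \<Rightarrow> int \<times> int) \<Rightarrow> (real^2 \<Rightarrow> real) \<Rightarrow> real^2 \<Rightarrow> real" where
  "Delta1 h n\<theta> nS off w x =
     2 * (median (map (\<lambda>i. w (gpt h x (of_int (fst (off i))) (of_int (snd (off i))))) [0..<nS]) - w x)
       / (h * real n\<theta>)^2"

definition dplus :: "real \<Rightarrow> real \<Rightarrow> real \<Rightarrow> real" where
  "dplus c a b = max (max a b) c"

definition grad_plus :: "real \<Rightarrow> (real^2 \<Rightarrow> real) \<Rightarrow> real^2 \<Rightarrow> real" where
  "grad_plus h w x =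
     (let ax = (w x - w (gpt h x 1 0)) / h; bx = (w x - w (gpt h x (-1) 0)) / h;
          ay = (w x - w (gpt h x 0 1)) / h; by' = (w x - w (gpt h x 0 (-1))) / h
      in sqrt ((max (max ax bx) 0)^2 + (max (max ay by') 0)^2))"

definition grad_minus :: "real \<Rightarrow> (real^2 \<Rightarrow> real) \<Rightarrow> real^2 \<Rightarrow> real" where
  "grad_minus h w x =
     (let ax = (w x - w (gpt h x 1 0)) / h; bx = (w x - w (gpt h x (-1) 0)) / h;
          ay = (w x - w (gpt h x 0 1)) / h; by' = (w x - w (gpt h x 0 (-1))) / h
      in sqrt ((- min (min ax bx) 0)^2 + (- min (min ay by') 0)^2))"

definition Fe :: "real \<Rightarrow> nat \<Rightarrow> nat \<Rightarrow> (nat \<Rightarrow> int \<times> int) \<Rightarrow> real \<Rightarrow> real \<Rightarrow>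
    (real^2 \<Rightarrow> real) \<Rightarrow> real^2 \<Rightarrow> real" where
  "Fe h n\<theta> nS off K L w x =
     - (Adelta_plus K L (grad_plus h w x) (- Delta1 h n\<theta> nS off w x) +
        Adelta_minus K L (- grad_minus h w x) (- Delta1 h n\<theta> nS off w x))"

definition Fa :: "real \<Rightarrow> (real^2 \<Rightarrow> real) \<Rightarrow> real^2 \<Rightarrow> real" where
  "Fa h w x =
     (let ux = (w (gpt h x 1 0) - w (gpt h x (-1) 0)) / (2*h);
          uy = (w (gpt h x 0 1) - w (gpt h x 0 (-1))) / (2*h);
          uxx = (w (gpt h x 1 0) - 2 * w x + w (gpt h x (-1) 0)) / h^2;
          uyy = (w (gpt h x 0 1) - 2 * w x + w (gpt h x 0 (-1))) / h^2;
          uxy = (w (gpt h x 1 1) - w (gpt h x 1 (-1)) - w (gpt h x (-1) 1) + w (gpt h x (-1) (-1))) / (4*h^2)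
      in root 3 (uxx * uy^2 - 2 * ux * uy * uxy + uyy * ux^2))"

definition Sfilter :: "real \<Rightarrow> real \<Rightarrow> real \<Rightarrow> real" where
  "Sfilter \<epsilon> a b =
     (let A = {(p, q). \<bar>p - q\<bar> < \<epsilon>}; \<rho> = 10 * \<epsilon>; d = infdist (a, b) A in
      if (a, b) \<in> A then a
      else if d \<le> \<rho> then ((\<rho> - d) / \<rho>) * a + (d / \<rho>) * b
      else b)"

definition Ff :: "real \<Rightarrow> nat \<Rightarrow> nat \<Rightarrow> (nat \<Rightarrow> int \<times> int) \<Rightarrow> real \<Rightarrow> real \<Rightarrow> real \<Rightarrow>
    (real^2 \<Rightarrow> real) \<Rightarrow> real^2 \<Rightarrow> real" where
  "Ff h n\<theta> nS off K L \<epsilon> w x = Sfilter \<epsilon> (Fa h w x) (Fe h n\<theta> nS off K L w x)"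

text \<open>Explicit time stepping u(.,t+dt) = u(.,t) + dt Op[u(.,t)] on closure Omega;
  stencil values outside closure Omega are taken at the closest point of the convex set
  closure Omega (discrete homogeneous Neumann condition).\<close>
primrec time_iter :: "(real^2 \<Rightarrow> real) \<Rightarrow> ((real^2 \<Rightarrow> real) \<Rightarrow> real^2 \<Rightarrow> real) \<Rightarrow> real \<Rightarrow>
    (real^2) set \<Rightarrow> nat \<Rightarrow> real^2 \<Rightarrow> real" where
  "time_iter u0 Op dt S 0 = u0"
| "time_iter u0 Op dt S (Suc k) =
     (\<lambda>x. time_iter u0 Op dt S k x + dt * Op (\<lambda>z. time_iter u0 Op dt S k (closest_point S z)) x)"

definition disc_sol :: "(real^2 \<Rightarrow> real) \<Rightarrow> ((real^2 \<Rightarrow> real) \<Rightarrow> real^2 \<Rightarrow> real) \<Rightarrow> real \<Rightarrow>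
    (real^2) set \<Rightarrow> real^2 \<Rightarrow> real \<Rightarrow> real" where
  "disc_sol u0 Op dt S x t = time_iter u0 Op dt S (nat \<lfloor>t / dt\<rfloor>) x"

definition consistent_seq :: "(nat \<Rightarrow> (real^2 \<Rightarrow> real) \<Rightarrow> real^2 \<Rightarrow> real) \<Rightarrow> bool" where
  "consistent_seq Op \<longleftrightarrow> (\<forall>\<phi> g Hs x y. C2_space \<phi> g Hs \<longrightarrow> y \<longlonglongrightarrow> x \<longrightarrow>
      (\<lambda>j. Op j \<phi> (y j)) \<longlonglongrightarrow> Fop (g x) (Hs x))"

definition loc_unif_conv :: "(real^2) set \<Rightarrow> (nat \<Rightarrow> real^2 \<Rightarrow> real \<Rightarrow> real) \<Rightarrow>
    (real^2 \<Rightarrow> real \<Rightarrow> real) \<Rightarrow> bool" where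
  "loc_unif_conv \<Omega> U u \<longleftrightarrow> (\<forall>C. compact C \<longrightarrow> C \<subseteq> closure \<Omega> \<times> {0..} \<longrightarrow>
     (\<forall>e>0. \<forall>\<^sub>F j in sequentially. \<forall>(x,t)\<in>C. \<bar>U j x t - u x t\<bar> < e))"

end

theory Submission
  imports Defs "HOL-Complex_Analysis.Great_Picard"
begin

text \<open>
  The stated time step bound misses a factor sqrt 2 in the gradient term, since |grad u|^{+-} moves
  at rate sqrt 2 / h with the central value; so one step of the scheme with constant K need not be
  monotone. One step of the reduced scheme, with K / sqrt 2 in place of K, is monotone.

  The reduced scheme. It commutes with translations and the projection onto the convex set
  closure Omega is nonexpansive, so every spatial modulus of continuity of u0 is preserved;
  quadratic barriers give a modulus in time. By compactness subsequences converge to continuous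
  functions. These are viscosity solutions, so uniqueness identifies the limit and no comparison
  principle is needed. At the boundary, a test function with outward increasing values is not
  increased by the projection, which yields the Neumann condition.

  The original and the filtered scheme. Monotonicity fails by at most (2 / K^2) times the discrete
  curvature of the larger function. Comparing with the inf-convolution of the reduced iterates, a
  semiconcave supersolution, keeps this curvature bounded uniformly in the grid, and consistency
  forces K to infinity. The filter perturbs the operator by O(epsilon) only.
\<close>

section \<open>Order statistics and the truncated cube root\<close>

text \<open>Two estimates carry the comparison. First, \<open>trunc_cbrt\<close> changes by at most
  the maximum, not the sum, of \<open>K\<close> times the slope change and \<open>L\<close> times
  the curvature change. So the two time step restrictions only have to hold separately; as the
  assumed bound controls their sum, the factor sqrt 2 does harm only if the gradient term dominates.
  Second, passing from K to K' = K / sqrt 2 matters only where the slope is below q / K'^3, q being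
  the discrete curvature; there the value is at most q / K'^2 = 2 * q / K^2, which is the defect
  named above. Consistency also has to supply the bounds on the parameters, by tests on explicit
  functions: a paraboloid near its vertex forces \<open>K\<close> to infinity, paraboloids at slope
  2 keep \<open>L\<close> away from 0 and bound the discrete curvature, and a linear function plus
  |z|^4 forces the stencil width to 0. The obstacle is that the stencil median of a linear function
  need not be its central value, so this error has to be bounded by consistency too.\<close>

lemma sort_map_mono:
  fixes f :: "real \<Rightarrow> real"
  assumes "mono f"
  shows "sort (map f xs) = map f (sort xs)"
proof (rule properties_for_sort)
  show "sorted (map f (sort xs))"
    unfolding sorted_wrt_map using assms
    by (intro sorted_wrt_mono_rel[OF _ sorted_sort]) (auto dest: monoD)
qed simp

lemma sort_map_uminus: "sort (map uminus xs) = rev (map uminus (sort (xs::real list)))"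
proof (rule properties_for_sort)
  show "sorted (rev (map uminus (sort xs)))"
    unfolding sorted_wrt_rev sorted_wrt_map
    by (rule sorted_wrt_mono_rel[OF _ sorted_sort]) simp
qed simp

text \<open>By counting: with c the k-th value for \<open>g\<close>, at least k + 1 indices satisfy
  g i \<le> c, hence f i \<le> c; a k-th value for \<open>f\<close> above c would leave room for at
  most k such indices.\<close>

lemma sort_nth_mono:
  fixes f g :: "'a \<Rightarrow> real"
  assumes le: "\<And>i. i \<in> set is \<Longrightarrow> f i \<le> g i" and k: "k < length is"
  shows "sort (map f is) ! k \<le> sort (map g is) ! k"
proof (rule ccontr)
  assume "\<not> ?thesis"
  define c where "c = sort (map g is) ! k"
  with \<open>\<not> ?thesis\<close> have gt: "c < sort (map f is) ! k" by simp
  have cnt: "length (filter (\<lambda>x. x \<le> c) (sort (map q is))) = length (filter (\<lambda>i. q i \<le> c) is)" for q :: "'a \<Rightarrow> real"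
    by (simp add: filter_sort filter_map o_def)
  have "{j. j < length is \<and> sort (map f is) ! j \<le> c} \<subseteq> {..<k}"
  proof
    fix j assume "j \<in> {j. j < length is \<and> sort (map f is) ! j \<le> c}"
    then have j: "j < length is" "sort (map f is) ! j \<le> c" by auto
    show "j \<in> {..<k}"
    proof (rule ccontr)
      assume "j \<notin> {..<k}"
      then have "sort (map f is) ! k \<le> sort (map f is) ! j"
        using j by (intro sorted_nth_mono) auto
      with j gt show False by simp
    qed
  qed
  then have "length (filter (\<lambda>i. f i \<le> c) is) \<le> k"
    using card_mono[of "{..<k}" "{j. j < length is \<and> sort (map f is) ! j \<le> c}"] cnt[of f]
    by (simp add: length_filter_conv_card)
  moreover have "{..k} \<subseteq> {j. j < length is \<and> sort (map g is) ! j \<le> c}"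
    using k by (auto simp: c_def intro!: sorted_nth_mono)
  then have "Suc k \<le> length (filter (\<lambda>i. g i \<le> c) is)"
    using card_mono[of "{j. j < length is \<and> sort (map g is) ! j \<le> c}" "{..k}"] cnt[of g]
    by (simp add: length_filter_conv_card)
  moreover have "length (filter (\<lambda>i. g i \<le> c) is) \<le> length (filter (\<lambda>i. f i \<le> c) is)"
    using le by (induction "is") (auto simp: le_SucI, force)
  ultimately show False by linarith
qed

lemma median_mono:
  fixes f g :: "'a \<Rightarrow> real"
  assumes "is \<noteq> []" "\<And>i. i \<in> set is \<Longrightarrow> f i \<le> g i"
  shows "median (map f is) \<le> median (map g is)"
proof -
  have l: "length is > 0" using assms by simp
  have s: "k < length is \<Longrightarrow> sort (map f is) ! k \<le> sort (map g is) ! k" for k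
    using sort_nth_mono assms by blast
  have 1: "length is div 2 < length is" "length is div 2 - 1 < length is" using l by linarith+
  show ?thesis using s[OF 1(1)] s[OF 1(2)] by (auto simp: median_def Let_def)
qed

lemma median_scale_shift:
  fixes f :: "'a \<Rightarrow> real"
  assumes "is \<noteq> []" "c \<ge> 0"
  shows "median (map (\<lambda>i. c * f i + d) is) = c * median (map f is) + d"
proof -
  have l: "length is > 0" using assms by simp
  have 1: "length is div 2 < length is" "length is div 2 - Suc 0 < length is" using l by linarith+
  have m: "sort (map (\<lambda>i. c * f i + d) is) = map (\<lambda>x. c * x + d) (sort (map f is))"
    using sort_map_mono[of "\<lambda>x. c * x + d" "map f is"] assms
    by (auto simp: mono_def mult_left_mono o_def)
  show ?thesis using 1 unfolding median_def m by (auto simp: Let_def field_simps)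
qed

text \<open>Negation reverses the sorted list, and both the middle entry and the average of the two
  middle entries are symmetric under reversal. This makes the scheme odd, so lower bounds follow
  from upper ones.\<close>

lemma median_uminus:
  fixes f :: "'a \<Rightarrow> real"
  assumes "is \<noteq> []"
  shows "median (map (\<lambda>i. - f i) is) = - median (map f is)"
proof -
  have l: "length is > 0" using assms by simp
  have m: "sort (map (\<lambda>i. - f i) is) = rev (map uminus (sort (map f is)))"
    using sort_map_uminus[of "map f is"] by (simp add: o_def)
  have o: "length is - Suc (length is div 2) = length is div 2" if "odd (length is)"
    using that by presburger
  have e: "length is - Suc (length is div 2) = length is div 2 - Suc 0"
    "length is - Suc (length is div 2 - Suc 0) = length is div 2" "length is div 2 - Suc 0 < length is"
    if "even (length is)" using that l by presburger+
  show ?thesis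
  proof (cases "even (length is)")
    case True
    then show ?thesis using l e unfolding median_def m by (simp add: Let_def rev_nth field_simps)
  next
    case False
    then show ?thesis using l o unfolding median_def m by (simp add: Let_def rev_nth)
  qed
qed

section \<open>The truncated cube root: \<open>Adelta\<close> on nonnegative arguments\<close>

definition trunc_cbrt :: "real \<Rightarrow> real \<Rightarrow> real \<Rightarrow> real \<Rightarrow> real" where
  "trunc_cbrt K L p q = min (min (root 3 (p\<^sup>2 * q)) (K * p)) (L * q)"

lemma cbrt_amgm:
  fixes x y :: real
  assumes "x \<ge> 0" "y \<ge> 0"
  shows "root 3 (x\<^sup>2 * y) \<le> (2 * x + y) / 3"
proof -
  have "((2 * x + y) / 3) ^ 3 - x\<^sup>2 * y = (x - y)\<^sup>2 * (8 * x + y) / 27"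
    by (simp add: field_simps power2_eq_square power3_eq_cube)
  also have "\<dots> \<ge> 0" using assms by simp
  finally have "x\<^sup>2 * y \<le> ((2 * x + y) / 3) ^ 3" by simp
  then have "root 3 (x\<^sup>2 * y) \<le> root 3 (((2 * x + y) / 3) ^ 3)" by simp
  then show ?thesis by (simp add: odd_real_root_power_cancel)
qed

text \<open>If a cap is active at (p2, q2), the same cap bounds the value at (p1, q1). Otherwise
  concavity gives the tangent bound with partial derivatives 2 * A / (3 * p2) \<le> 2 * K / 3 and A
  / (3 * q2) \<le> L / 3, so the increment is at most a convex combination of the two terms, hence
  at most their maximum.\<close>

lemma trunc_cbrt_diff_le:
  assumes K: "K > 0" and L: "L > 0" and p: "0 \<le> p2" "p2 \<le> p1" and q: "0 \<le> q2" "q2 \<le> q1"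
  shows "trunc_cbrt K L p1 q1 - trunc_cbrt K L p2 q2 \<le> max (K * (p1 - p2)) (L * (q1 - q2))"
proof -
  define A where "A = root 3 (p2\<^sup>2 * q2)"
  consider "trunc_cbrt K L p2 q2 = K * p2" | "trunc_cbrt K L p2 q2 = L * q2"
    | "trunc_cbrt K L p2 q2 = A" "A \<le> K * p2" "A \<le> L * q2" "p2 \<noteq> 0" "q2 \<noteq> 0"
  proof -
    have "trunc_cbrt K L p2 q2 = A \<or> trunc_cbrt K L p2 q2 = K * p2 \<or> trunc_cbrt K L p2 q2 = L * q2"
      "trunc_cbrt K L p2 q2 \<le> K * p2" "trunc_cbrt K L p2 q2 \<le> L * q2"
      by (auto simp: trunc_cbrt_def A_def min_def)
    moreover have "trunc_cbrt K L p2 q2 = K * p2" if "p2 = 0" using that L q by (simp add: trunc_cbrt_def)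
    moreover have "trunc_cbrt K L p2 q2 = L * q2" if "q2 = 0" using that K p by (simp add: trunc_cbrt_def)
    ultimately show ?thesis using that by metis
  qed
  then show ?thesis
  proof cases
    case 1
    have "trunc_cbrt K L p1 q1 \<le> K * p1" by (simp add: trunc_cbrt_def)
    with 1 show ?thesis by (simp add: algebra_simps)
  next
    case 2
    have "trunc_cbrt K L p1 q1 \<le> L * q1" by (simp add: trunc_cbrt_def)
    with 2 show ?thesis by (simp add: algebra_simps)
  next
    case 3
    \<comment> \<open>The cube root of p^2 q lies below its tangent at (p2, q2); this is AM-GM for p1/p2, p1/p2, q1/q2.\<close>
    then have pq: "p2 > 0" "q2 > 0" using p q by auto
    have A0: "A \<ge> 0" using pq by (simp add: A_def)
    have "trunc_cbrt K L p1 q1 \<le> root 3 (p1\<^sup>2 * q1)" by (simp add: trunc_cbrt_def)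
    also have "p1\<^sup>2 * q1 = (p2\<^sup>2 * q2) * ((p1 / p2)\<^sup>2 * (q1 / q2))"
      using pq by (simp add: field_simps)
    also have "root 3 \<dots> = A * root 3 ((p1 / p2)\<^sup>2 * (q1 / q2))"
      by (simp only: real_root_mult A_def)
    also have "\<dots> \<le> A * ((2 * (p1 / p2) + q1 / q2) / 3)"
      using pq p q A0 by (intro mult_left_mono cbrt_amgm) auto
    also have "\<dots> = A + 2 / 3 * ((A / p2) * (p1 - p2)) + 1 / 3 * ((A / q2) * (q1 - q2))"
      using pq by (simp add: field_simps)
    also have "\<dots> \<le> A + 2 / 3 * (K * (p1 - p2)) + 1 / 3 * (L * (q1 - q2))"
      using 3 pq p q by (intro add_mono mult_left_mono mult_right_mono) (auto simp: field_simps)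
    also have "\<dots> \<le> A + max (K * (p1 - p2)) (L * (q1 - q2))" by (auto simp: max_def)
    finally show ?thesis using 3 by simp
  qed
qed

lemma trunc_cbrt_mono:
  assumes "K > 0" "L > 0" "0 \<le> p2" "p2 \<le> p1" "0 \<le> q2" "q2 \<le> q1"
  shows "trunc_cbrt K L p2 q2 \<le> trunc_cbrt K L p1 q1"
proof -
  have "p2\<^sup>2 * q2 \<le> p1\<^sup>2 * q1" using assms by (intro mult_mono power_mono) auto
  then show ?thesis unfolding trunc_cbrt_def using assms by (intro min.mono) auto
qed

lemma trunc_cbrt_mono_K: "K' \<le> K \<Longrightarrow> p \<ge> 0 \<Longrightarrow> trunc_cbrt K' L p q \<le> trunc_cbrt K L p q"
  using mult_right_mono[of K' K p] unfolding trunc_cbrt_def by (intro min.mono) auto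

lemma trunc_cbrt_nonneg: "K > 0 \<Longrightarrow> L > 0 \<Longrightarrow> p \<ge> 0 \<Longrightarrow> q \<ge> 0 \<Longrightarrow> trunc_cbrt K L p q \<ge> 0"
  by (simp add: trunc_cbrt_def)

lemma trunc_cbrt_zero [simp]: "K > 0 \<Longrightarrow> p \<ge> 0 \<Longrightarrow> trunc_cbrt K L p 0 = 0"
  by (simp add: trunc_cbrt_def)

text \<open>If the cap K' * p is below the cube root, cubing gives p < q / K'^3, and inserting this
  bound for p into the cube root gives q / K'^2. Lowering the gradient cap is thus harmless up to a
  small multiple of the curvature.\<close>

lemma trunc_cbrt_le_cap:
  assumes "K' > 0" "L > 0" "p \<ge> 0" "q \<ge> 0"
  shows "trunc_cbrt K L p q \<le> max (trunc_cbrt K' L p q) (q / K'\<^sup>2)"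
proof (cases "root 3 (p\<^sup>2 * q) \<le> K' * p")
  case True
  then show ?thesis by (auto simp: trunc_cbrt_def)
next
  case False
  have p0: "p > 0" using False assms by (cases "p = 0") auto
  have "K' * p < root 3 (p\<^sup>2 * q)" using False by simp
  then have "(K' * p) ^ 3 < root 3 (p\<^sup>2 * q) ^ 3"
    using assms by (intro power_strict_mono) auto
  then have "(K' * p) ^ 3 < p\<^sup>2 * q" by (simp add: odd_real_root_pow)
  then have "K' ^ 3 * p * p\<^sup>2 < q * p\<^sup>2"
    by (simp add: power_mult_distrib power2_eq_square power3_eq_cube mult_ac)
  then have "K' ^ 3 * p < q" using p0 by simp
  then have "p < q / K' ^ 3" using assms by (simp add: field_simps)
  then have "p\<^sup>2 * q \<le> (q / K' ^ 3)\<^sup>2 * q" using assms by (intro mult_right_mono power_mono) auto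
  also have "\<dots> = (q / K'\<^sup>2) ^ 3"
    by (simp add: power_divide power2_eq_square power3_eq_cube mult_ac)
  finally have "root 3 (p\<^sup>2 * q) \<le> root 3 ((q / K'\<^sup>2) ^ 3)" by simp
  then have "root 3 (p\<^sup>2 * q) \<le> q / K'\<^sup>2" by (simp add: odd_real_root_power_cancel)
  then show ?thesis by (auto simp: trunc_cbrt_def)
qed

section \<open>One step at a single point, as a function of the centre value and the neighbour
  data\<close>

definition up_slope :: "real \<Rightarrow> real \<Rightarrow> real \<Rightarrow> real \<Rightarrow> real" where
  "up_slope h a m1 m2 = sqrt ((max ((m1 - a) / h) 0)\<^sup>2 + (max ((m2 - a) / h) 0)\<^sup>2)"

lemma up_slope_nonneg [simp]: "up_slope h a m1 m2 \<ge> 0"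
  by (simp add: up_slope_def)

lemma up_slope_mono:
  assumes "h > 0" "b \<le> a" "m1 \<le> m1'" "m2 \<le> m2'"
  shows "up_slope h a m1 m2 \<le> up_slope h b m1' m2'"
  unfolding up_slope_def using assms
  by (intro real_sqrt_le_mono add_mono power_mono max.mono divide_right_mono) auto

text \<open>Both components of the slope vector grow by at most t = (b - a) / h when the centre
  value drops, and the norm of (t, t) is sqrt 2 * t. This is the factor that the stated time step
  bound misses.\<close>

lemma up_slope_diff_le:
  assumes h: "h > 0" and ab: "a \<le> b"
  shows "up_slope h a m1 m2 - up_slope h b m1 m2 \<le> sqrt 2 * (b - a) / h"
proof -
  define t where "t = (b - a) / h"
  have t: "t \<ge> 0" using assms by (simp add: t_def)
  have le: "max ((m - a) / h) 0 \<le> max ((m - b) / h) 0 + t" for m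
    using assms by (auto simp: t_def max_def field_simps)
  have "up_slope h a m1 m2 \<le> sqrt ((max ((m1 - b) / h) 0 + t)\<^sup>2 + (max ((m2 - b) / h) 0 + t)\<^sup>2)"
    unfolding up_slope_def using le by (intro real_sqrt_le_mono add_mono power_mono) auto
  also have "\<dots> \<le> up_slope h b m1 m2 + sqrt (t\<^sup>2 + t\<^sup>2)"
    unfolding up_slope_def by (rule real_sqrt_sum_squares_triangle_ineq)
  also have "sqrt (t\<^sup>2 + t\<^sup>2) = sqrt 2 * t"
    using t by (simp add: real_sqrt_mult flip: mult_2)
  finally show ?thesis by (simp add: t_def)
qed

text \<open>Here \<open>a\<close> is the centre value, \<open>m1\<close>, \<open>m2\<close> the
  larger and \<open>n1\<close>, \<open>n2\<close> the smaller values of opposite neighbours along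
  the two axes, \<open>c\<close> the stencil median and \<open>r\<close> the squared stencil width.
  According to the sign of c - a, at most one of the two terms is nonzero, for K > 0.\<close>

definition Fval :: "real \<Rightarrow> real \<Rightarrow> real \<Rightarrow> real \<Rightarrow> real \<Rightarrow> real \<Rightarrow> real \<Rightarrow> real \<Rightarrow> real \<Rightarrow> real \<Rightarrow> real" where
  "Fval K L h r a m1 m2 n1 n2 c =
     trunc_cbrt K L (up_slope h a m1 m2) (max (2 * (c - a) / r) 0)
   - trunc_cbrt K L (up_slope h (- a) (- n1) (- n2)) (max (2 * (a - c) / r) 0)"

lemma Fval_mono:
  assumes "K > 0" "L > 0" "h > 0" "r > 0" "m1 \<le> m1'" "m2 \<le> m2'" "n1 \<le> n1'" "n2 \<le> n2'" "c \<le> c'"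
  shows "Fval K L h r a m1 m2 n1 n2 c \<le> Fval K L h r a m1' m2' n1' n2' c'"
  unfolding Fval_def using assms
  by (intro diff_mono trunc_cbrt_mono up_slope_mono max.mono) (auto simp: divide_right_mono)

text \<open>While the centre value rises from a to b, the first term changes only below c and the
  second only above c. The two portions of [a, b] have total length b - a, so the constant of one
  term serves for the difference.\<close>

lemma Fval_diff_le:
  assumes K: "K > 0" and L: "L > 0" and h: "h > 0" and r: "r > 0" and ab: "a \<le> b"
  shows "Fval K L h r a m1 m2 n1 n2 c - Fval K L h r b m1 m2 n1 n2 c
    \<le> (b - a) * max (sqrt 2 * K / h) (2 * L / r)"
proof -
  define G where "G = max (sqrt 2 * K / h) (2 * L / r)"
  have half: "trunc_cbrt K L (up_slope h a m1 m2) (max (2 * (c - a) / r) 0) - trunc_cbrt K L (up_slope h b m1 m2) (max (2 * (c - b) / r) 0)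
    \<le> (min b (max a c) - a) * G" if ab: "a \<le> b" for a b c m1 m2 
  proof (cases "c \<le> a")
    case True
    then show ?thesis using ab K h r L
      by (auto simp: max_absorb2 divide_nonpos_pos min_def)
  next
    case False
    \<comment> \<open>Beyond c the first term is zero, so its change stops at
      \<open>d\<close>.\<close>
    define d where "d = min b c"
    have d: "a \<le> d" "d \<le> c" "d \<le> b" "max (2 * (c - b) / r) 0 = 2 * (c - d) / r"
      using False ab r by (auto simp: d_def min_def max_def field_simps)
    have "trunc_cbrt K L (up_slope h b m1 m2) (2 * (c - d) / r) \<ge> 0"
      using d r by (intro trunc_cbrt_nonneg K L) auto
    have "trunc_cbrt K L (up_slope h b m1 m2) (max (2 * (c - b) / r) 0) \<ge> trunc_cbrt K L (up_slope h d m1 m2) (2 * (c - d) / r)"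
    proof (cases "b \<le> c")
      case True then show ?thesis using d by (simp add: d_def)
    next
      case False then show ?thesis using d K by (simp add: d_def)
    qed
    moreover have "trunc_cbrt K L (up_slope h a m1 m2) (2 * (c - a) / r) - trunc_cbrt K L (up_slope h d m1 m2) (2 * (c - d) / r)
      \<le> max (K * (up_slope h a m1 m2 - up_slope h d m1 m2)) (L * (2 * (c - a) / r - 2 * (c - d) / r))"
      using d r h by (intro trunc_cbrt_diff_le K L up_slope_mono) (auto simp: divide_right_mono)
    moreover have "\<dots> \<le> (d - a) * G"
    proof (rule max.boundedI)
      have "K * (up_slope h a m1 m2 - up_slope h d m1 m2) \<le> K * (sqrt 2 * (d - a) / h)"
        using K d h by (intro mult_left_mono up_slope_diff_le) auto
      also have "\<dots> = (d - a) * (sqrt 2 * K / h)" by (simp add: field_simps)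
      also have "\<dots> \<le> (d - a) * G" using d by (intro mult_left_mono) (auto simp: G_def)
      finally show "K * (up_slope h a m1 m2 - up_slope h d m1 m2) \<le> (d - a) * G" .
      have "L * (2 * (c - a) / r - 2 * (c - d) / r) = (d - a) * (2 * L / r)" using r by (simp add: field_simps)
      also have "\<dots> \<le> (d - a) * G" using d by (intro mult_left_mono) (auto simp: G_def)
      finally show "L * (2 * (c - a) / r - 2 * (c - d) / r) \<le> (d - a) * G" .
    qed
    moreover have "max (2 * (c - a) / r) 0 = 2 * (c - a) / r" using False r by simp
    ultimately show ?thesis using False by (simp add: d_def max_def)
  qed
  have "Fval K L h r a m1 m2 n1 n2 c - Fval K L h r b m1 m2 n1 n2 c
    \<le> (min b (max a c) - a) * G + (min (- a) (max (- b) (- c)) + b) * G"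
    using half[of a b m1 m2 c] half[of "- b" "- a" "- n1" "- n2" "- c"] ab
    by (simp add: Fval_def add.commute)
  also have "\<dots> = (b - a) * G" using ab by (simp add: min_def max_def algebra_simps)
  finally show ?thesis by (simp add: G_def)
qed

lemma Fval_step_mono:
  assumes "K > 0" "L > 0" "h > 0" "r > 0" "a \<le> b" "dt \<ge> 0" "dt * (sqrt 2 * K / h) \<le> 1" "dt * (2 * L / r) \<le> 1"
  shows "a + dt * Fval K L h r a m1 m2 n1 n2 c \<le> b + dt * Fval K L h r b m1 m2 n1 n2 c"
proof -
  have "dt * (Fval K L h r a m1 m2 n1 n2 c - Fval K L h r b m1 m2 n1 n2 c)
      \<le> dt * ((b - a) * max (sqrt 2 * K / h) (2 * L / r))"
    using assms by (intro mult_left_mono Fval_diff_le) auto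
  also have "\<dots> = (b - a) * (dt * max (sqrt 2 * K / h) (2 * L / r))" by simp
  also have "\<dots> \<le> (b - a) * 1"
    using assms by (intro mult_left_mono) (auto simp: max_def)
  finally show ?thesis by (simp add: algebra_simps)
qed

text \<open>Below the median only the first term is present and \<open>trunc_cbrt_le_cap\<close>
  applies; above it only the subtracted term is, and there a larger K lowers the value.\<close>

lemma Fval_cap:
  assumes "K' > 0" "K' \<le> K" "L > 0" "h > 0" "r > 0"
  shows "Fval K L h r a m1 m2 n1 n2 c \<le> max (Fval K' L h r a m1 m2 n1 n2 c) (max (2 * (c - a) / r) 0 / K'\<^sup>2)" 
proof (cases "a \<le> c")
  case True
  then have z: "max (2 * (a - c) / r) 0 = 0" using assms by (simp add: max_absorb2 divide_nonpos_pos)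
  show ?thesis using trunc_cbrt_le_cap[of K' L "up_slope h a m1 m2" "max (2 * (c - a) / r) 0" K] assms
    unfolding Fval_def z by simp
next
  case False
  then have z: "max (2 * (c - a) / r) 0 = 0" using assms by (simp add: max_absorb2 divide_nonpos_pos)
  show ?thesis using trunc_cbrt_mono_K[of K' K "up_slope h (- a) (- n1) (- n2)" L "max (2 * (a - c) / r) 0"] assms
    unfolding Fval_def z by simp
qed

text \<open>Substitute for the missing monotonicity of the step with K: moving the centre from a to
  b and lowering K to K / sqrt 2 costs only the curvature term seen from b. Which of the two changes
  comes first depends on whether the step with K is itself monotone.\<close>

lemma Fval_defect:
  assumes K: "K > 0" and L: "L > 0" and KL: "K * sqrt L \<ge> 1" and h: "h > 0" and r: "r > 0" and ab: "a \<le> b"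
    and dt: "dt > 0" "dt * (K / h + 2 * L / r) \<le> 1"
  shows "a + dt * Fval K L h r a m1 m2 n1 n2 c
    \<le> b + dt * Fval (K / sqrt 2) L h r b m1 m2 n1 n2 c + dt * (2 / K\<^sup>2 * max (2 * (c - b) / r) 0)"
proof -
  define K' where "K' = K / sqrt 2"
  define S where "S k a = a + dt * Fval k L h r a m1 m2 n1 n2 c" for k a
  define q where "q a = 2 / K\<^sup>2 * max (2 * (c - a) / r) 0" for a
  have s: "sqrt 2 > 0" "sqrt 2 > (1::real)" by auto
  have K': "K' > 0" "K' \<le> K" "K = sqrt 2 * K'" using K s by (auto simp: K'_def field_simps)
  have K'2: "K'\<^sup>2 = K\<^sup>2 / 2" by (simp add: K'_def power_divide)
  have pos: "dt * (K / h) > 0" "dt * (2 * L / r) > 0" using K L h r dt by auto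
  have cfl: "dt * (K / h) + dt * (2 * L / r) \<le> 1" using dt by (simp add: distrib_left)
  have monoK': "S K' a \<le> S K' b" if "a \<le> b" for a b
    unfolding S_def
  proof (rule Fval_step_mono)
    show "dt * (sqrt 2 * K' / h) \<le> 1" "dt * (2 * L / r) \<le> 1" using pos cfl unfolding K'(3) by linarith+
  qed (use K' L h r dt(1) that in auto)
  have cap: "S K a \<le> max (S K' a) (a + dt * q a)" for a
  proof -
    have "Fval K L h r a m1 m2 n1 n2 c \<le> max (Fval K' L h r a m1 m2 n1 n2 c) (q a)"
      using Fval_cap[of K' K L h r a m1 m2 n1 n2 c] K' L h r by (simp add: q_def K'2 mult.commute)
    then have "dt * Fval K L h r a m1 m2 n1 n2 c \<le> dt * max (Fval K' L h r a m1 m2 n1 n2 c) (q a)"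
      using dt by simp
    then show ?thesis unfolding S_def using dt by (auto simp: max_def split: if_splits)
  qed
  have above: "a \<le> S K' a" if "a \<le> c" for a
  proof -
    have "max (2 * (a - c) / r) 0 = 0" using that r by (simp add: max_absorb2 divide_nonpos_pos)
    then show ?thesis using K' L dt by (simp add: S_def Fval_def trunc_cbrt_nonneg)
  qed
  have below: "S K a \<le> S K' a" if "c \<le> a" for a
  proof -
    have z: "max (2 * (c - a) / r) 0 = 0" using that r by (simp add: max_absorb2 divide_nonpos_pos)
    have "Fval K L h r a m1 m2 n1 n2 c \<le> Fval K' L h r a m1 m2 n1 n2 c"
      using trunc_cbrt_mono_K[of K' K "up_slope h (- a) (- n1) (- n2)" L "max (2 * (a - c) / r) 0"] K'(1,2) K
      unfolding Fval_def z by simp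
    then show ?thesis using dt by (simp add: S_def)
  qed
  have q0: "q a \<ge> 0" for a by (simp add: q_def)
  have "S K a \<le> S K' b + dt * q b"
  proof (cases "sqrt 2 * K / h \<le> K / h + 2 * L / r")
    \<comment> \<open>The time step bound then gives monotonicity with K itself: first move from a
      to b, then lower K at b. Below the median a reduced step does not decrease the value, so the
      alternative b + dt * q b of \<open>cap\<close> is absorbed.\<close>
    case True
    then have "dt * (sqrt 2 * K / h) \<le> 1"
      using dt mult_left_mono[OF True, of dt] by linarith
    then have "S K a \<le> S K b"
      unfolding S_def
    proof (intro Fval_step_mono)
      show "dt * (2 * L / r) \<le> 1" using pos cfl by linarith
    qed (use K L h r dt(1) ab in auto)
    also have "S K b \<le> S K' b + dt * q b"
    proof (cases "b \<le> c")
      case True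
      have "dt * q b \<ge> 0" using q0 dt by simp
      then have "max (S K' b) (b + dt * q b) \<le> S K' b + dt * q b" using above[OF True] by simp
      with cap[of b] show ?thesis by (rule order_trans)
    next
      case False
      then show ?thesis using below[of b] q0[of b] dt(1) by (simp add: add_increasing2)
    qed
    finally show ?thesis .
  next
    \<comment> \<open>Here the gradient term dominates. The order is reversed: first lower K at a,
      then move to b. For this x + dt * q x must be increasing in x.\<close>
    case False
    have KL2: "1 \<le> K\<^sup>2 * L"
      using power_mono[OF KL, of 2] L by (simp add: power_mult_distrib)
    have "(sqrt 2 - 1) * (K / h) > 2 * L / r" using False by (simp add: algebra_simps)
    moreover have "(sqrt 2 - 1) * (K / h) \<le> 1 / 2 * (K / h)"
    proof (rule mult_right_mono)
      have "sqrt 2 \<le> 3 / 2" by (rule real_le_lsqrt) (auto simp: power2_eq_square)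
      then show "sqrt 2 - 1 \<le> 1 / 2" by simp
    qed (use K h in auto)
    ultimately have "2 * (2 * L / r) < K / h" by linarith
    then have "2 * (dt * (2 * L / r)) \<le> dt * (K / h)"
      using dt mult_left_mono[of "2 * (2 * L / r)" "K / h" dt] by (simp add: mult.left_commute)
    then have three: "2 * (dt * (2 * L / r)) \<le> 1"
    proof -
      have "2 * t \<le> 1" if "2 * t \<le> s" "s + t \<le> 1" "0 < t" for s t :: real using that by linarith
      then show ?thesis using \<open>2 * (dt * (2 * L / r)) \<le> dt * (K / h)\<close> cfl pos(2) by blast
    qed
    \<comment> \<open>K * sqrt L \<ge> 1 enters here: it gives 1 / K^2 \<le> L, so the slope of dt *
      q is at most twice the curvature part of the time step bound, which is at most 1/3 in this
      case.\<close>
    have slope: "dt * (2 / K\<^sup>2 * (2 / r)) \<le> 1"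
    proof -
      have "1 / K\<^sup>2 \<le> L" using KL2 K by (simp add: field_simps)
      then have "dt * (4 / r) * (1 / K\<^sup>2) \<le> dt * (4 / r) * L" using dt r by (intro mult_left_mono) auto
      also have "\<dots> = 2 * (dt * (2 * L / r))" by simp
      finally show ?thesis using three by (simp add: mult.commute)
    qed
    have qm: "x + dt * q x \<le> y + dt * q y" if "x \<le> y" for x y
    proof -
      have "max (2 * (c - x) / r) 0 - max (2 * (c - y) / r) 0 \<le> (y - x) * (2 / r)"
        using that r by (auto simp: max_def field_simps)
      then have "dt * (2 / K\<^sup>2) * (max (2 * (c - x) / r) 0 - max (2 * (c - y) / r) 0) \<le> dt * (2 / K\<^sup>2) * ((y - x) * (2 / r))"
        using dt by (intro mult_left_mono) auto
      also have "\<dots> = (y - x) * (dt * (2 / K\<^sup>2 * (2 / r)))" by simp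
      also have "\<dots> \<le> (y - x) * 1" using slope that by (intro mult_left_mono) auto
      finally show ?thesis by (simp add: q_def algebra_simps)
    qed
    have "dt * q b \<ge> 0" using q0 dt by simp
    show ?thesis
    proof (cases "a \<le> c")
      case True
      \<comment> \<open>Stopping at the median loses nothing: q vanishes beyond c, and up to c a
        reduced step does not decrease the value.\<close>
      define d where "d = min b c"
      have d: "a \<le> d" "d \<le> b" "d \<le> c" using ab True by (auto simp: d_def)
      have "q d = q b"
        using r by (auto simp: d_def q_def min_def max_def divide_nonpos_pos field_simps)
      then have "a + dt * q a \<le> d + dt * q b" using qm[OF d(1)] by simp
      also have "\<dots> \<le> S K' b + dt * q b"
        using order_trans[OF above[OF d(3)] monoK'[OF d(2)]] by simp
      finally have "a + dt * q a \<le> S K' b + dt * q b" .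
      moreover have "S K' a \<le> S K' b + dt * q b"
        using monoK'[OF ab] \<open>dt * q b \<ge> 0\<close> by (rule add_increasing2[rotated])
      ultimately have "max (S K' a) (a + dt * q a) \<le> S K' b + dt * q b" by simp
      with cap[of a] show ?thesis by (rule order_trans)
    next
      case False
      then have "S K a \<le> S K' b" using order_trans[OF below[of a] monoK'[OF ab]] by simp
      then show ?thesis using \<open>dt * q b \<ge> 0\<close> by (rule add_increasing2[rotated])
    qed
  qed
  then show ?thesis by (simp add: S_def q_def K'_def)
qed

section \<open>The elliptic scheme\<close>

lemma norm_vector_2: "norm (vector [a, b] :: real^2) = sqrt (a\<^sup>2 + b\<^sup>2)"
  by (simp add: norm_vec_def L2_set_def sum_2)

lemma Adelta_eq_trunc_cbrt:
  assumes "K > 0" "p \<ge> 0" "q \<ge> 0"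
  shows "Adelta K L p q = trunc_cbrt K L p q" "Adelta K L (- p) (- q) = - trunc_cbrt K L p q"
proof -
  have "\<bar>cbrtA p q\<bar> = root 3 (p\<^sup>2 * q)" "\<bar>cbrtA (- p) (- q)\<bar> = root 3 (p\<^sup>2 * q)"
    using assms by (auto simp: cbrtA_def real_root_minus abs_of_nonneg)
  then show "Adelta K L p q = trunc_cbrt K L p q" "Adelta K L (- p) (- q) = - trunc_cbrt K L p q"
    using assms by (cases "q = 0"; simp add: Adelta_def trunc_cbrt_def sgn_if)+
qed

lemma grad_nonneg [simp]: "grad_plus h w x \<ge> 0" "grad_minus h w x \<ge> 0"
  by (simp_all add: grad_plus_def grad_minus_def Let_def)

lemma Fe_eq_trunc_cbrt:
  assumes "K > 0"
  shows "Fe h n nS off K L w x = trunc_cbrt K L (grad_minus h w x) (max (Delta1 h n nS off w x) 0)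
    - trunc_cbrt K L (grad_plus h w x) (max (- Delta1 h n nS off w x) 0)"
proof -
  define D where "D = Delta1 h n nS off w x"
  have 1: "pos_part (grad_plus h w x) = grad_plus h w x" "pos_part (- D) = max (- D) 0"
    by (simp_all add: pos_part_def)
  have 2: "neg_part (- grad_minus h w x) = - grad_minus h w x" "neg_part (- D) = - max D 0"
    using grad_nonneg(2)[of h w x] by (auto simp: neg_part_def min_def max_def)
  show ?thesis
    unfolding Fe_def Adelta_plus_def Adelta_minus_def D_def[symmetric] 1 2
    using assms by (simp add: Adelta_eq_trunc_cbrt)
qed

definition nbr_max :: "real \<Rightarrow> (real^2 \<Rightarrow> real) \<Rightarrow> real^2 \<Rightarrow> real \<Rightarrow> real \<Rightarrow> real" where
  "nbr_max h w x a b = max (w (gpt h x a b)) (w (gpt h x (- a) (- b)))"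
definition nbr_min :: "real \<Rightarrow> (real^2 \<Rightarrow> real) \<Rightarrow> real^2 \<Rightarrow> real \<Rightarrow> real \<Rightarrow> real" where
  "nbr_min h w x a b = min (w (gpt h x a b)) (w (gpt h x (- a) (- b)))"

text \<open>\<open>grad_minus\<close> measures the ascent to the larger of two opposite neighbours,
  \<open>grad_plus\<close> the descent to the smaller one, which is the ascent of -w.\<close>

lemma grad_eq_up_slope:
  assumes "h > 0"
  shows "grad_minus h w x = up_slope h (w x) (nbr_max h w x 1 0) (nbr_max h w x 0 1)"
    "grad_plus h w x = up_slope h (- w x) (- nbr_min h w x 1 0) (- nbr_min h w x 0 1)"
proof -
  have 1: "- min (min ((a - r) / h) ((a - l) / h)) 0 = max ((max r l - a) / h) 0" for a r l
    using assms by (auto simp: min_def max_def field_simps)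
  have 2: "max (max ((a - r) / h) ((a - l) / h)) 0 = max ((- min r l - (- a)) / h) 0" for a r l
    using assms by (auto simp: min_def max_def field_simps)
  show "grad_minus h w x = up_slope h (w x) (nbr_max h w x 1 0) (nbr_max h w x 0 1)"
    unfolding grad_minus_def up_slope_def Let_def 1 nbr_max_def by simp
  show "grad_plus h w x = up_slope h (- w x) (- nbr_min h w x 1 0) (- nbr_min h w x 0 1)"
    unfolding grad_plus_def up_slope_def Let_def 2 nbr_min_def by simp
qed

definition stencil_median :: "real \<Rightarrow> nat \<Rightarrow> (nat \<Rightarrow> int \<times> int) \<Rightarrow> (real^2 \<Rightarrow> real) \<Rightarrow> real^2 \<Rightarrow> real" where
  "stencil_median h nS off w x =
     median (map (\<lambda>i. w (gpt h x (of_int (fst (off i))) (of_int (snd (off i))))) [0..<nS])"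

lemma Delta1_eq: "Delta1 h n nS off w x = 2 * (stencil_median h nS off w x - w x) / (h * real n)\<^sup>2"
  by (simp add: Delta1_def stencil_median_def)

lemma Fe_eq_Fval:
  assumes "K > 0" "h > 0"
  shows "Fe h n nS off K L w x = Fval K L h ((h * real n)\<^sup>2) (w x) (nbr_max h w x 1 0) (nbr_max h w x 0 1)
    (nbr_min h w x 1 0) (nbr_min h w x 0 1) (stencil_median h nS off w x)"
proof -
  have "- (2 * (c - a) / r) = 2 * (a - c) / r" for a c r :: real
    by (simp add: minus_divide_left)
  then show ?thesis
    using assms unfolding Fe_eq_trunc_cbrt[OF assms(1)] Fval_def grad_eq_up_slope[OF assms(2)] Delta1_eq by simp
qed

text \<open>Each coordinate is at most n + 1 \<le> 2 * n in absolute value, and sqrt 8 \<le>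
  3.\<close>

lemma stencil_norm_le:
  assumes "valid_stencil n nS off" "n \<ge> 1" "i < nS"
  shows "norm (vector [of_int (fst (off i)), of_int (snd (off i))] :: real^2) \<le> 3 * real n"
proof -
  define a b :: real where "a = of_int (fst (off i))" and "b = of_int (snd (off i))"
  define \<theta> where "\<theta> = real i * (2 * pi / real nS)"
  have ab: "\<bar>a - real n * cos \<theta>\<bar> \<le> 1" "\<bar>b - real n * sin \<theta>\<bar> \<le> 1"
    using assms by (auto simp: valid_stencil_def a_def b_def \<theta>_def)
  have "\<bar>real n * cos \<theta>\<bar> \<le> real n" "\<bar>real n * sin \<theta>\<bar> \<le> real n"
    by (auto simp: abs_mult mult_left_le)
  then have "\<bar>a\<bar> \<le> 2 * real n" "\<bar>b\<bar> \<le> 2 * real n" using ab assms(2) by linarith+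
  then have "\<bar>a\<bar>\<^sup>2 \<le> (2 * real n)\<^sup>2" "\<bar>b\<bar>\<^sup>2 \<le> (2 * real n)\<^sup>2" by (meson abs_ge_zero power_mono)+
  then have "a\<^sup>2 + b\<^sup>2 \<le> 8 * (real n)\<^sup>2" by (simp add: power_mult_distrib)
  also have "\<dots> \<le> (3 * real n)\<^sup>2" by (simp add: power_mult_distrib)
  finally have "a\<^sup>2 + b\<^sup>2 \<le> (3 * real n)\<^sup>2" .
  then show ?thesis unfolding norm_vector_2 a_def b_def by (intro real_le_lsqrt) auto
qed

text \<open>Rounding to the grid moves a point of the circle by at most 2, and n - 2 \<ge> n /
  2.\<close>

lemma stencil_norm_ge:
  assumes "valid_stencil n nS off" "n \<ge> 4" "i < nS"
  shows "norm (vector [of_int (fst (off i)), of_int (snd (off i))] :: real^2) \<ge> real n / 2"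
proof -
  define a b :: real where "a = of_int (fst (off i))" and "b = of_int (snd (off i))"
  define \<theta> where "\<theta> = real i * (2 * pi / real nS)"
  define e :: "real^2" where "e = real n *\<^sub>R vector [cos \<theta>, sin \<theta>]"
  have ab: "\<bar>a - real n * cos \<theta>\<bar> \<le> 1" "\<bar>b - real n * sin \<theta>\<bar> \<le> 1"
    using assms by (auto simp: valid_stencil_def a_def b_def \<theta>_def)
  have "norm (vector [a, b] - e) \<le> \<bar>a - real n * cos \<theta>\<bar> + \<bar>b - real n * sin \<theta>\<bar>"
    using norm_le_l1_cart[of "vector [a, b] - e"] by (simp add: sum_2 e_def)
  moreover have "norm e = real n" by (simp add: e_def norm_vector_2)
  moreover have "norm e \<le> norm (vector [a, b] :: real^2) + norm (vector [a, b] - e)"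
    by (metis norm_minus_commute norm_triangle_sub)
  ultimately show ?thesis using ab assms(2) unfolding a_def b_def by linarith
qed

lemma gpt_add: "gpt h (x + s) a b = gpt h x a b + s"
  by (simp add: gpt_def)

lemma dist_gpt: "h > 0 \<Longrightarrow> dist (gpt h x a b) x = h * norm (vector [a, b] :: real^2)"
  by (simp add: gpt_def dist_norm)

locale stencil =
  fixes h :: real and n nS :: nat and off :: "nat \<Rightarrow> int \<times> int"
  assumes h_pos: "h > 0" and n_ge: "n \<ge> 1" and nS_ge: "nS \<ge> 1" and valid: "valid_stencil n nS off"
begin

abbreviation "width \<equiv> h * real n"
abbreviation "D1 \<equiv> Delta1 h n nS off"
abbreviation "FKL \<equiv> Fe h n nS off"
abbreviation "med \<equiv> stencil_median h nS off"

lemma width_pos: "width > 0" "width\<^sup>2 > 0"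
  using h_pos n_ge by auto

lemma dist_stencil:
  assumes "i < nS"
  shows "dist (gpt h x (of_int (fst (off i))) (of_int (snd (off i)))) x \<le> 3 * width"
proof -
  have "h * norm (vector [of_int (fst (off i)), of_int (snd (off i))] :: real^2) \<le> h * (3 * real n)"
    using stencil_norm_le[OF valid n_ge assms] h_pos by (intro mult_left_mono) auto
  then show ?thesis using h_pos by (simp add: dist_gpt)
qed

lemma dist_nbr:
  assumes "\<bar>a\<bar> + \<bar>b\<bar> \<le> 1"
  shows "dist (gpt h x a b) x \<le> 3 * width"
proof -
  have "norm (vector [a, b] :: real^2) \<le> \<bar>a\<bar> + \<bar>b\<bar>"
    using norm_le_l1_cart[of "vector [a, b] :: real^2"] by (simp add: sum_2)
  then have "h * norm (vector [a, b] :: real^2) \<le> h * (3 * real n)"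
    using assms n_ge h_pos by (intro mult_left_mono) auto
  then show ?thesis using h_pos by (simp add: dist_gpt)
qed

lemma med_mono:
  assumes "\<And>z. dist z x \<le> 3 * width \<Longrightarrow> w z \<le> v z"
  shows "med w x \<le> med v x"
  unfolding stencil_median_def using nS_ge by (intro median_mono assms dist_stencil) auto

lemma med_scale_shift: "c \<ge> 0 \<Longrightarrow> med (\<lambda>z. c * w z + d) x = c * med w x + d"
  unfolding stencil_median_def using nS_ge by (intro median_scale_shift) auto

lemma med_uminus: "med (\<lambda>z. - w z) x = - med w x"
  unfolding stencil_median_def using nS_ge by (intro median_uminus) auto

lemma nbr_mono:
  assumes "\<And>z. dist z x \<le> 3 * width \<Longrightarrow> w z \<le> v z" "\<bar>a\<bar> + \<bar>b\<bar> \<le> 1"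
  shows "nbr_max h w x a b \<le> nbr_max h v x a b" "nbr_min h w x a b \<le> nbr_min h v x a b"
proof -
  have "w (gpt h x a b) \<le> v (gpt h x a b)" "w (gpt h x (- a) (- b)) \<le> v (gpt h x (- a) (- b))"
    using assms(2) by (auto intro!: assms(1) dist_nbr)
  then show "nbr_max h w x a b \<le> nbr_max h v x a b" "nbr_min h w x a b \<le> nbr_min h v x a b"
    unfolding nbr_max_def nbr_min_def by (auto simp: max_def min_def)
qed

text \<open>Dividing K by sqrt 2 cancels the factor from \<open>up_slope_diff_le\<close>. The order
  hypothesis is local because all values read lie within \<open>3 * width\<close> of x; this admits
  test functions that dominate only near a contact point.\<close>

lemma step_mono:
  assumes "K > 0" "L > 0" "dt > 0" "dt * (K / h + 2 * L / width\<^sup>2) \<le> 1"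
    and le: "\<And>z. dist z x \<le> 3 * width \<Longrightarrow> w z \<le> v z"
  shows "w x + dt * FKL (K / sqrt 2) L w x \<le> v x + dt * FKL (K / sqrt 2) L v x"
proof -
  have K': "K / sqrt 2 > 0" using assms by simp
  have pos: "dt * (K / h) > 0" "dt * (2 * L / width\<^sup>2) > 0" using assms h_pos width_pos by auto
  have cfl: "dt * (K / h) + dt * (2 * L / width\<^sup>2) \<le> 1" using assms by (simp only: distrib_left)
  have 1: "w x + dt * FKL (K / sqrt 2) L w x \<le> w x + dt * Fval (K / sqrt 2) L h (width\<^sup>2) (w x)
    (nbr_max h v x 1 0) (nbr_max h v x 0 1) (nbr_min h v x 1 0) (nbr_min h v x 0 1) (med v x)"
    unfolding Fe_eq_Fval[OF K' h_pos] using assms K' h_pos width_pos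
    by (intro add_left_mono mult_left_mono Fval_mono nbr_mono med_mono) auto
  have 2: "\<dots> \<le> v x + dt * Fval (K / sqrt 2) L h (width\<^sup>2) (v x)
    (nbr_max h v x 1 0) (nbr_max h v x 0 1) (nbr_min h v x 1 0) (nbr_min h v x 0 1) (med v x)"
  proof (rule Fval_step_mono)
    show "w x \<le> v x" using le[of x] width_pos by simp
    have "sqrt 2 * (K / sqrt 2) = K" by simp
    then show "dt * (sqrt 2 * (K / sqrt 2) / h) \<le> 1" using pos cfl by simp
    show "dt * (2 * L / width\<^sup>2) \<le> 1" using pos cfl by linarith
  qed (use K' assms h_pos width_pos in auto)
  from 1 2 show ?thesis unfolding Fe_eq_Fval[OF K' h_pos] by (rule order_trans)
qed

text \<open>The curvature in the error is that of the upper function \<open>v\<close> alone, so it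
  can be kept bounded by choosing \<open>v\<close> semiconcave, whatever \<open>w\<close>
  does.\<close>

lemma step_defect:
  assumes "K > 0" "L > 0" "K * sqrt L \<ge> 1" "dt > 0" "dt * (K / h + 2 * L / width\<^sup>2) \<le> 1"
    and le: "\<And>z. dist z x \<le> 3 * width \<Longrightarrow> w z \<le> v z"
  shows "w x + dt * FKL K L w x \<le> v x + dt * FKL (K / sqrt 2) L v x + dt * (2 / K\<^sup>2 * max (D1 v x) 0)"
proof -
  have K': "K / sqrt 2 > 0" using assms by simp
  have 1: "w x + dt * FKL K L w x \<le> w x + dt * Fval K L h (width\<^sup>2) (w x)
    (nbr_max h v x 1 0) (nbr_max h v x 0 1) (nbr_min h v x 1 0) (nbr_min h v x 0 1) (med v x)"
    unfolding Fe_eq_Fval[OF assms(1) h_pos] using assms h_pos width_pos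
    by (intro add_left_mono mult_left_mono Fval_mono nbr_mono med_mono) auto
  have 2: "w x \<le> v x" using le[of x] width_pos by simp
  show ?thesis
    using order_trans[OF 1 Fval_defect[OF assms(1-3) h_pos width_pos(2) 2 assms(4,5)]]
    unfolding Fe_eq_Fval[OF K' h_pos] Delta1_eq .
qed

lemma FKL_shift: "K > 0 \<Longrightarrow> FKL K L (\<lambda>z. w z + c) x = FKL K L w x"
proof -
  have "med (\<lambda>z. w z + c) x = med w x + c" using med_scale_shift[of 1 w c x] by simp
  then show "K > 0 \<Longrightarrow> FKL K L (\<lambda>z. w z + c) x = FKL K L w x"
    by (simp add: Fe_eq_trunc_cbrt Delta1_eq grad_plus_def grad_minus_def)
qed

lemma D1_shift: "D1 (\<lambda>z. w z + c) x = D1 w x"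
  using med_scale_shift[of 1 w c x] by (simp add: Delta1_eq)

lemma FKL_translate: "FKL K L (\<lambda>z. w (z + s)) x = FKL K L w (x + s)"
  by (simp add: Fe_def Delta1_def grad_plus_def grad_minus_def gpt_add)

lemma D1_uminus: "D1 (\<lambda>z. - w z) x = - D1 w x"
  by (simp add: Delta1_eq med_uminus minus_divide_left)

lemma FKL_uminus: "K > 0 \<Longrightarrow> FKL K L (\<lambda>z. - w z) x = - FKL K L w x"
proof -
  have "grad_plus h (\<lambda>z. - w z) x = grad_minus h w x" "grad_minus h (\<lambda>z. - w z) x = grad_plus h w x"
    by (simp_all add: grad_eq_up_slope h_pos nbr_max_def nbr_min_def minus_min_eq_max minus_max_eq_min)
  then show "K > 0 \<Longrightarrow> FKL K L (\<lambda>z. - w z) x = - FKL K L w x"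
    by (simp add: Fe_eq_trunc_cbrt D1_uminus)
qed

lemma D1_translate: "D1 (\<lambda>z. w (z + s)) x = D1 w (x + s)"
  by (simp add: Delta1_def gpt_add)

lemma D1_scale_shift: "c \<ge> 0 \<Longrightarrow> D1 (\<lambda>z. c * w z + d) x = c * D1 w x"
  unfolding Delta1_eq med_scale_shift by (simp add: algebra_simps diff_divide_distrib)

lemma D1_mono:
  assumes "\<And>z. w z \<le> v z" "w x = v x"
  shows "D1 w x \<le> D1 v x"
proof -
  have "med w x \<le> med v x" using assms(1) by (intro med_mono)
  then show ?thesis unfolding Delta1_eq using assms(2) by (intro divide_right_mono) auto
qed

lemma abs_FKL_mono:
  assumes "0 < K'" "K' \<le> K" "L > 0"
  shows "\<bar>FKL K' L w x\<bar> \<le> \<bar>FKL K L w x\<bar>"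
proof -
  have *: "\<bar>trunc_cbrt K' L p q\<bar> \<le> \<bar>trunc_cbrt K L p q\<bar>" if "p \<ge> 0" "q \<ge> 0" for p q
    using assms that trunc_cbrt_mono_K[of K' K p L q] trunc_cbrt_nonneg[of K' L p q] by simp
  show ?thesis
    using assms *[of "grad_minus h w x" "D1 w x"] *[of "grad_plus h w x" "- D1 w x"]
    by (cases "D1 w x \<ge> 0") (auto simp: Fe_eq_trunc_cbrt max_def)
qed

text \<open>The active truncated value is below K' * c and hence below both caps K' * p and K * p,
  so it is the minimum of the remaining two terms for either constant.\<close>

lemma FKL_eq_if_small:
  assumes "0 < K'" "K' \<le> K" "L > 0" "\<bar>FKL K L w x\<bar> < K' * c" "c \<le> grad_plus h w x" "c \<le> grad_minus h w x"
  shows "FKL K' L w x = FKL K L w x"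
proof -
  have *: "trunc_cbrt K' L p q = trunc_cbrt K L p q" if "p \<ge> 0" "q \<ge> 0" "c \<le> p" "trunc_cbrt K L p q < K' * c" for p q
  proof -
    have "trunc_cbrt K L p q < K' * p" using that assms mult_left_mono[of c p K'] by linarith
    moreover have "K' * p \<le> K * p" using assms that by (intro mult_right_mono) auto
    ultimately show ?thesis by (auto simp: trunc_cbrt_def min_def split: if_splits)
  qed
  have nn: "trunc_cbrt K L p q \<ge> 0" if "p \<ge> 0" "q \<ge> 0" for p q
    using assms that by (auto intro: trunc_cbrt_nonneg)
  show ?thesis
  proof (cases "D1 w x \<ge> 0")
    case True
    then show ?thesis using assms nn[of "grad_minus h w x" "D1 w x"] *[of "grad_minus h w x" "D1 w x"]
      by (simp add: Fe_eq_trunc_cbrt max_def split: if_splits)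
  next
    case False
    then show ?thesis using assms nn[of "grad_plus h w x" "- D1 w x"] *[of "grad_plus h w x" "- D1 w x"]
      by (simp add: Fe_eq_trunc_cbrt max_def split: if_splits)
  qed
qed

end

text \<open>Each coordinate differs from that of a point of the strip by at most their distance,
  hence |a - b| \<le> \<epsilon> + 2 * d. The filter departs from b only while d \<le> 10 *
  \<epsilon>, which gives 21.\<close>

lemma Sfilter_close:
  assumes "\<epsilon> > 0"
  shows "\<bar>Sfilter \<epsilon> a b - b\<bar> \<le> 21 * \<epsilon>"
proof -
  define A where "A = {(p, q). \<bar>p - q\<bar> < (\<epsilon>::real)}"
  define d where "d = infdist (a, b) A"
  have "(0, 0) \<in> A" using assms by (simp add: A_def)
  then have ne: "A \<noteq> {}" by blast
  have "(\<bar>a - b\<bar> - \<epsilon>) / 2 \<le> d"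
    unfolding d_def infdist_notempty[OF ne]
  proof (rule cINF_greatest[OF ne])
    fix z assume "z \<in> A"
    then obtain p q where z: "z = (p, q)" "\<bar>p - q\<bar> < \<epsilon>" by (auto simp: A_def)
    have "\<bar>a - p\<bar> \<le> dist (a, b) z" "\<bar>b - q\<bar> \<le> dist (a, b) z"
      using dist_fst_le[of "(a, b)" z] dist_snd_le[of "(a, b)" z] by (simp_all add: z dist_real_def)
    moreover have "\<bar>a - b\<bar> \<le> \<bar>a - p\<bar> + \<bar>p - q\<bar> + \<bar>b - q\<bar>" by arith
    ultimately show "(\<bar>a - b\<bar> - \<epsilon>) / 2 \<le> dist (a, b) z"
      using z(2) by simp
  qed
  then have ab: "\<bar>a - b\<bar> \<le> \<epsilon> + 2 * d" by simp
  have d0: "d \<ge> 0" by (simp add: d_def infdist_nonneg)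
  consider "(a, b) \<in> A" | "(a, b) \<notin> A" "d \<le> 10 * \<epsilon>" | "(a, b) \<notin> A" "d > 10 * \<epsilon>" by linarith
  then show ?thesis
  proof cases
    case 1
    then have "Sfilter \<epsilon> a b = a" by (simp add: Sfilter_def A_def)
    then show ?thesis using 1 assms by (simp add: A_def)
  next
    case 2
    then have "Sfilter \<epsilon> a b = ((10 * \<epsilon> - d) / (10 * \<epsilon>)) * a + (d / (10 * \<epsilon>)) * b"
      unfolding Sfilter_def Let_def A_def[symmetric] d_def[symmetric] by simp
    moreover have "b = ((10 * \<epsilon> - d) / (10 * \<epsilon>)) * b + (d / (10 * \<epsilon>)) * b"
      using assms by (simp add: diff_divide_distrib left_diff_distrib)
    ultimately have "Sfilter \<epsilon> a b - b = ((10 * \<epsilon> - d) / (10 * \<epsilon>)) * (a - b)"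
      by (simp add: right_diff_distrib)
    then have "\<bar>Sfilter \<epsilon> a b - b\<bar> = ((10 * \<epsilon> - d) / (10 * \<epsilon>)) * \<bar>a - b\<bar>"
      using 2 assms by (simp add: abs_mult)
    also have "\<dots> \<le> 1 * \<bar>a - b\<bar>" using d0 assms by (intro mult_right_mono) (auto simp: field_simps)
    also have "\<dots> \<le> \<epsilon> + 2 * d" using ab by simp
    also have "\<dots> \<le> 21 * \<epsilon>" using 2(2) by simp
    finally show ?thesis .
  next
    case 3
    then have "Sfilter \<epsilon> a b = b" by (simp add: Sfilter_def A_def d_def Let_def)
    then show ?thesis using assms by simp
  qed
qed

section \<open>Test functions and uniform consistency\<close>

lemma C2_space_linear: "C2_space (\<lambda>z. w \<bullet> z) (\<lambda>_. w) (\<lambda>_. 0)"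
  unfolding C2_space_def by (auto intro!: derivative_eq_intros)

lemma C2_space_add_quadratic:
  assumes "C2_space \<phi> g Hs"
  shows "C2_space (\<lambda>z. \<phi> z + c * ((z - a) \<bullet> (z - a))) (\<lambda>z. g z + (2 * c) *\<^sub>R (z - a))
    (\<lambda>z. Hs z + (2 * c) *\<^sub>R mat 1)"
proof -
  have 1: "(\<phi> has_derivative (\<lambda>v. g x \<bullet> v)) (at x)" and 2: "(g has_derivative (\<lambda>v. Hs x *v v)) (at x)"
    and 3: "continuous_on UNIV Hs" for x
    using assms by (auto simp: C2_space_def)
  have 4: "((\<lambda>z. \<phi> z + c * ((z - a) \<bullet> (z - a))) has_derivative (\<lambda>v. (g x + (2 * c) *\<^sub>R (x - a)) \<bullet> v)) (at x)" for x
    by (rule derivative_eq_intros 1 refl)+ (auto simp: inner_simps inner_commute algebra_simps)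
  have 5: "((\<lambda>z. g z + (2 * c) *\<^sub>R (z - a)) has_derivative (\<lambda>v. (Hs x + (2 * c) *\<^sub>R mat 1) *v v)) (at x)" for x
    by (rule derivative_eq_intros 2 refl)+
      (auto simp: matrix_vector_mult_add_rdistrib simp flip: scaleR_matrix_vector_assoc)
  show ?thesis unfolding C2_space_def using 3 4 5 by (auto intro!: continuous_intros)
qed

text \<open>At the origin the Hessian vanishes, so F is 0 there, yet the function exceeds its linear
  part by |z|^4 on the stencil. This discrepancy detects stencils that are too wide.\<close>

lemma C2_space_quartic:
  "C2_space (\<lambda>z. w \<bullet> z + (z \<bullet> z)\<^sup>2) (\<lambda>z. w + (4 * (z \<bullet> z)) *\<^sub>R z)
    (\<lambda>z. \<chi> i j. (if i = j then 4 * (z \<bullet> z) else 0) + 8 * (z $ i * z $ j))"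
proof -
  have 1: "((\<lambda>z. w \<bullet> z + (z \<bullet> z)\<^sup>2) has_derivative (\<lambda>v. (w + (4 * (x \<bullet> x)) *\<^sub>R x) \<bullet> v)) (at x)" for x
    by (rule derivative_eq_intros refl)+ (auto simp: inner_simps inner_commute algebra_simps)
  have eq: "((\<chi> i j. (if i = j then 4 * (x \<bullet> x) else 0) + 8 * (x $ i * x $ j)) :: real^2^2) *v v
      = (4 * (x \<bullet> x)) *\<^sub>R v + (8 * (x \<bullet> v)) *\<^sub>R x" for x v :: "real^2"
    by (simp add: vec_eq_iff matrix_vector_mult_def sum_2 forall_2 inner_vec_def algebra_simps)
  have 2: "((\<lambda>z. w + (4 * (z \<bullet> z)) *\<^sub>R z) has_derivative (\<lambda>v. (4 * (x \<bullet> x)) *\<^sub>R v + (8 * (x \<bullet> v)) *\<^sub>R x)) (at x)"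
    for x :: "real^2"
    by (rule derivative_eq_intros refl)+ (auto simp: inner_commute algebra_simps)
  have 3: "continuous_on UNIV (\<lambda>z::real^2. (\<chi> i j. (if i = j then 4 * (z \<bullet> z) else 0) + 8 * (z $ i * z $ j)) :: real^2^2)"
  proof (intro continuous_on_vec_lambda)
    fix i j :: 2
    show "continuous_on UNIV (\<lambda>z::real^2. (if i = j then 4 * (z \<bullet> z) else 0) + 8 * (z $ i * z $ j))"
      by (cases "i = j") (auto intro!: continuous_intros)
  qed
  show ?thesis unfolding C2_space_def eq using 1 2 3 by blast
qed

lemma C2_space_continuous:
  assumes "C2_space \<phi> g Hs"
  shows "continuous_on UNIV \<phi>" "continuous_on UNIV g" "continuous_on UNIV Hs"
  using assms by (auto simp: C2_space_def intro!: has_derivative_continuous_on)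

lemma tendsto_Fop:
  assumes "(f \<longlongrightarrow> p) F" "(X \<longlongrightarrow> Y) F"
  shows "((\<lambda>z. Fop (f z) (X z)) \<longlongrightarrow> Fop p Y) F"
  unfolding Fop_def by (intro tendsto_intros assms)

text \<open>Consistency is stated along convergent sequences of points; points violating a uniform
  bound for infinitely many j would accumulate in the compact set and contradict it at the
  limit.\<close>

lemma uniform_consistency:
  assumes cons: "consistent_seq Op" and C2: "C2_space \<phi> g Hs" and C: "compact C" and e: "e > 0"
  shows "\<forall>\<^sub>F j in sequentially. \<forall>y\<in>C. \<bar>Op j \<phi> y - Fop (g y) (Hs y)\<bar> < e"
proof (rule ccontr)
  define B where "B = {j. \<exists>y\<in>C. \<not> \<bar>Op j \<phi> y - Fop (g y) (Hs y)\<bar> < e}"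
  assume "\<not> ?thesis"
  then have "infinite B"
    unfolding infinite_nat_iff_unbounded_le B_def eventually_sequentially by blast
  define r where "r = enumerate B"
  have r: "strict_mono r" "\<And>n. r n \<in> B"
    using \<open>infinite B\<close> by (auto simp: r_def strict_mono_enumerate enumerate_in_set)
  obtain y where y: "\<And>j. j \<in> B \<Longrightarrow> y j \<in> C \<and> \<not> \<bar>Op j \<phi> (y j) - Fop (g (y j)) (Hs (y j))\<bar> < e"
  proof -
    have "\<forall>j. \<exists>y. j \<in> B \<longrightarrow> y \<in> C \<and> \<not> \<bar>Op j \<phi> y - Fop (g y) (Hs y)\<bar> < e"
      unfolding B_def by blast
    from choice[OF this] obtain y where "\<forall>j. j \<in> B \<longrightarrow> y j \<in> C \<and> \<not> \<bar>Op j \<phi> (y j) - Fop (g (y j)) (Hs (y j))\<bar> < e" ..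
    then show ?thesis by (intro that[of y]) simp
  qed
  obtain x s where s: "strict_mono (s :: nat \<Rightarrow> nat)" and lim: "((\<lambda>n. y (r n)) \<circ> s) \<longlonglongrightarrow> x"
    using C y r unfolding compact_def by (metis (no_types, lifting))
  define t where "t = r \<circ> s"
  have t: "strict_mono t" "\<And>n. t n \<in> B" and limt: "(\<lambda>n. y (t n)) \<longlonglongrightarrow> x"
    using r s lim strict_mono_o[OF r(1) s] by (auto simp: t_def o_def)
  \<comment> \<open>\<open>consistent_seq\<close> wants one point for every index, so the indices
    outside the subsequence receive the limit.\<close>
  define y' where "y' j = (if j \<in> range t then y j else x)" for j
  have "y' \<longlonglongrightarrow> x"
    unfolding lim_sequentially
  proof (intro allI impI)
    fix d :: real assume "d > 0"
    then obtain N where N: "\<And>n. n \<ge> N \<Longrightarrow> dist (y (t n)) x < d"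
      using limt unfolding lim_sequentially by blast
    have "dist (y' j) x < d" if "j \<ge> t N" for j
    proof (cases "j \<in> range t")
      case True
      then obtain n where "j = t n" by blast
      then show ?thesis using that N[of n] t(1) by (simp add: y'_def strict_mono_less_eq)
    next
      case False
      then show ?thesis using \<open>d > 0\<close> by (simp add: y'_def)
    qed
    then show "\<exists>N. \<forall>n\<ge>N. dist (y' n) x < d" by blast
  qed
  then have "(\<lambda>j. Op j \<phi> (y' j)) \<longlonglongrightarrow> Fop (g x) (Hs x)"
    using cons C2 unfolding consistent_seq_def by blast
  from LIMSEQ_subseq_LIMSEQ[OF this t(1)]
  have 1: "(\<lambda>n. Op (t n) \<phi> (y (t n))) \<longlonglongrightarrow> Fop (g x) (Hs x)"
    by (simp add: o_def y'_def)
  have "isCont g x" "isCont Hs x" using C2_space_continuous[OF C2] by (auto simp: continuous_on_eq_continuous_at)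
  then have 2: "(\<lambda>n. Fop (g (y (t n))) (Hs (y (t n)))) \<longlonglongrightarrow> Fop (g x) (Hs x)"
    by (intro tendsto_Fop isCont_tendsto_compose[OF _ limt])
  have "(\<lambda>n. \<bar>Op (t n) \<phi> (y (t n)) - Fop (g (y (t n))) (Hs (y (t n)))\<bar>) \<longlonglongrightarrow> 0"
    using tendsto_rabs[OF tendsto_diff[OF 1 2]] by simp
  from order_tendstoD(2)[OF this e] obtain n where "\<bar>Op (t n) \<phi> (y (t n)) - Fop (g (y (t n))) (Hs (y (t n)))\<bar> < e"
    by (auto simp: eventually_sequentially)
  then show False using y[OF t(2)[of n]] by blast
qed

text \<open>K * p \<ge> 24 exceeds \<delta>, so the gradient cap is not the minimum. The cube root
  yields 4 * q \<le> \<delta>^3 \<le> 144 * \<delta>, the other cap q \<le> 36 * \<delta>; the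
  numerical hypotheses are matched to a common constant 36.\<close>

lemma trunc_cbrt_small:
  assumes "trunc_cbrt K L p q < \<delta>" "0 < \<delta>" "\<delta> \<le> 12" "K \<ge> 12" "p \<ge> 2" "L \<ge> 1/36" "q \<ge> 0"
  shows "q \<le> 36 * \<delta>"
proof -
  have "12 * 2 \<le> K * p" using assms by (intro mult_mono) auto
  then consider "root 3 (p\<^sup>2 * q) < \<delta>" | "L * q < \<delta>"
    using assms by (auto simp: trunc_cbrt_def min_def split: if_splits)
  then show ?thesis
  proof cases
    case 1
    then have "root 3 (p\<^sup>2 * q) ^ 3 \<le> \<delta> ^ 3" using assms by (intro power_mono) auto
    then have "p\<^sup>2 * q \<le> \<delta> ^ 3" by (simp add: odd_real_root_pow)
    moreover have "2\<^sup>2 * q \<le> p\<^sup>2 * q" using assms by (intro mult_right_mono power_mono) auto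
    moreover have "\<delta> ^ 3 \<le> 144 * \<delta>"
    proof -
      have "\<delta>\<^sup>2 \<le> 12\<^sup>2" using assms by (intro power_mono) auto
      then have "\<delta>\<^sup>2 * \<delta> \<le> 144 * \<delta>" using assms by (intro mult_right_mono) auto
      then show ?thesis by (simp add: power2_eq_square power3_eq_cube)
    qed
    ultimately show ?thesis by simp
  next
    case 2
    have "1/36 * q \<le> L * q" using assms by (intro mult_right_mono) auto
    then show ?thesis using 2 by simp
  qed
qed

lemma grad_ge_quotient:
  assumes "h > 0" "(a, b) \<in> {(1, 0), (-1, 0), (0, 1), (0, -1)}"
  shows "(w (gpt h x a b) - w x) / h \<le> grad_minus h w x" "(w x - w (gpt h x a b)) / h \<le> grad_plus h w x"
proof -
  have s: "t \<le> sqrt ((max c 0)\<^sup>2 + (max d 0)\<^sup>2)" if "t \<le> c \<or> t \<le> d" for t c d :: real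
  proof -
    have "t \<le> \<bar>max c 0\<bar> \<or> t \<le> \<bar>max d 0\<bar>" using that by linarith
    then show ?thesis using real_sqrt_ge_abs1[of "max c 0" "max d 0"] real_sqrt_ge_abs2[of "max d 0" "max c 0"] order_trans by blast
  qed
  show "(w (gpt h x a b) - w x) / h \<le> grad_minus h w x"
    unfolding grad_eq_up_slope[OF assms(1)] up_slope_def
    by (rule s) (use assms in \<open>auto simp: nbr_max_def intro!: divide_right_mono\<close>)
  show "(w x - w (gpt h x a b)) / h \<le> grad_plus h w x"
    unfolding grad_eq_up_slope[OF assms(1)] up_slope_def
    by (rule s) (use assms in \<open>auto simp: nbr_min_def intro!: divide_right_mono\<close>)
qed

text \<open>Base point and increment vary together, so differentiability at x alone is not enough;
  the mean value theorem reduces the claim to continuity of g.\<close>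

lemma tendsto_difference_quotient:
  assumes C2: "C2_space \<phi> g Hs" and y: "y \<longlonglongrightarrow> x" and h: "h \<longlonglongrightarrow> 0" "\<And>j::nat. h j > 0"
  shows "(\<lambda>j. (\<phi> (y j + h j *\<^sub>R e) - \<phi> (y j)) / h j) \<longlonglongrightarrow> g x \<bullet> e"
proof -
  have "\<exists>\<xi>. 0 < \<xi> \<and> \<xi> < h j \<and> \<phi> (y j + h j *\<^sub>R e) - \<phi> (y j) = h j * (g (y j + \<xi> *\<^sub>R e) \<bullet> e)" for j
  proof -
    have "((\<lambda>t. \<phi> (y j + t *\<^sub>R e)) has_real_derivative g (y j + t *\<^sub>R e) \<bullet> e) (at t)" for t
    proof -
      have "(\<phi> has_derivative (\<lambda>v. g (y j + t *\<^sub>R e) \<bullet> v)) (at (y j + t *\<^sub>R e))"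
        using C2 by (auto simp: C2_space_def)
      then have "((\<lambda>t. \<phi> (y j + t *\<^sub>R e)) has_derivative (\<lambda>s. g (y j + t *\<^sub>R e) \<bullet> (s *\<^sub>R e))) (at t)"
        by (rule has_derivative_compose[rotated]) (auto intro!: derivative_eq_intros)
      then show ?thesis unfolding has_field_derivative_def by (simp add: mult_commute_abs)
    qed
    from MVT2[OF h(2)[of j], of "\<lambda>t. \<phi> (y j + t *\<^sub>R e)", OF this] show ?thesis by auto
  qed
  then obtain \<xi> where \<xi>: "\<And>j. 0 < \<xi> j \<and> \<xi> j < h j \<and> \<phi> (y j + h j *\<^sub>R e) - \<phi> (y j) = h j * (g (y j + \<xi> j *\<^sub>R e) \<bullet> e)"
    by metis
  have "\<xi> \<longlonglongrightarrow> 0"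
    by (rule tendsto_sandwich[OF _ _ tendsto_const h(1)]) (use \<xi> in \<open>auto intro!: always_eventually less_imp_le\<close>)
  then have "(\<lambda>j. y j + \<xi> j *\<^sub>R e) \<longlonglongrightarrow> x + 0 *\<^sub>R e" by (intro tendsto_intros y)
  then have "(\<lambda>j. y j + \<xi> j *\<^sub>R e) \<longlonglongrightarrow> x" by simp
  moreover have "isCont g x" using C2_space_continuous[OF C2] by (simp add: continuous_on_eq_continuous_at)
  ultimately have "(\<lambda>j. g (y j + \<xi> j *\<^sub>R e) \<bullet> e) \<longlonglongrightarrow> g x \<bullet> e"
    by (intro tendsto_inner tendsto_const isCont_tendsto_compose[of x g])
  moreover have "(\<phi> (y j + h j *\<^sub>R e) - \<phi> (y j)) / h j = g (y j + \<xi> j *\<^sub>R e) \<bullet> e" for j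
    using \<xi>[of j] h(2)[of j] by simp
  ultimately show ?thesis by simp
qed

section \<open>What consistency says about the parameters\<close>

lemma cbrt_cube: "root 3 (x ^ 3) = x" and cube_cbrt: "root 3 x ^ 3 = x"
  by (simp_all add: odd_real_root_power_cancel odd_real_root_pow)

locale consistent_scheme =
  fixes h :: "nat \<Rightarrow> real" and n nS :: "nat \<Rightarrow> nat" and off :: "nat \<Rightarrow> nat \<Rightarrow> int \<times> int"
    and K L :: "nat \<Rightarrow> real"
  assumes st: "\<And>j. stencil (h j) (n j) (nS j) (off j)"
    and KL_pos: "\<And>j. K j > 0" "\<And>j. L j > 0"
    and h_lim: "h \<longlonglongrightarrow> 0"
    and cons: "consistent_seq (\<lambda>j. Fe (h j) (n j) (nS j) (off j) (K j) (L j))"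
begin

abbreviation "FS j k \<equiv> Fe (h j) (n j) (nS j) (off j) k (L j)"
abbreviation "DS j \<equiv> Delta1 (h j) (n j) (nS j) (off j)"
abbreviation "R j \<equiv> h j * real (n j)"
abbreviation "quad \<equiv> \<lambda>z::real^2. z \<bullet> z"
abbreviation "e1 \<equiv> vector [1, 0] :: real^2"

lemma hs_pos: "h j > 0" and ns_ge: "n j \<ge> 1"
  using st[of j] by (auto simp: stencil_def)

lemma C2_quad: "C2_space (\<lambda>z. c * quad z) (\<lambda>z. (2 * c) *\<^sub>R z) (\<lambda>z. (2 * c) *\<^sub>R mat 1)"
  using C2_space_add_quadratic[OF C2_space_linear[of 0], of c 0] by simp

lemma Fop_quad: "Fop (2 *\<^sub>R w) (2 *\<^sub>R mat 1) = root 3 (8 * (w \<bullet> w))"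
  by (simp add: Fop_def mat_def inner_vec_def sum_2 power2_eq_square algebra_simps)

lemma quad_gpt: "quad (gpt h' w a b) = quad w + 2 * h' * (a * w $ 1 + b * w $ 2) + h'\<^sup>2 * (a\<^sup>2 + b\<^sup>2)"
  by (simp add: gpt_def inner_vec_def sum_2 power2_eq_square algebra_simps)

lemma grad_minus_quad: "grad_minus (h j) quad w = sqrt ((2 * \<bar>w $ 1\<bar> + h j)\<^sup>2 + (2 * \<bar>w $ 2\<bar> + h j)\<^sup>2)"
proof -
  have "max ((max (quad w + 2 * h j * c + (h j)\<^sup>2) (quad w - 2 * h j * c + (h j)\<^sup>2) - quad w) / h j) 0
    = 2 * \<bar>c\<bar> + h j" for c
  proof -
    have "max (quad w + 2 * h j * c + (h j)\<^sup>2) (quad w - 2 * h j * c + (h j)\<^sup>2) = quad w + 2 * h j * \<bar>c\<bar> + (h j)\<^sup>2"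
    proof (cases "c \<ge> 0")
      case True
      then have "h j * c \<ge> 0" using hs_pos[of j] by simp
      then have "quad w - 2 * h j * c + (h j)\<^sup>2 \<le> quad w + 2 * h j * c + (h j)\<^sup>2" by (simp add: mult.commute)
      then show ?thesis unfolding max_absorb1[OF \<open>quad w - 2 * h j * c + (h j)\<^sup>2 \<le> _\<close>] using True by simp
    next
      case False
      then have "h j * c \<le> 0" using hs_pos[of j] by (simp add: mult_nonneg_nonpos)
      then have "quad w + 2 * h j * c + (h j)\<^sup>2 \<le> quad w - 2 * h j * c + (h j)\<^sup>2" by (simp add: mult.commute)
      then show ?thesis unfolding max_absorb2[OF \<open>quad w + 2 * h j * c + (h j)\<^sup>2 \<le> _\<close>] using False by simp
    qed
    then show ?thesis using hs_pos[of j] by (simp add: add_divide_distrib power2_eq_square)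
  qed
  moreover have "nbr_max (h j) quad w 1 0 = max (quad w + 2 * h j * w $ 1 + (h j)\<^sup>2) (quad w - 2 * h j * w $ 1 + (h j)\<^sup>2)"
    "nbr_max (h j) quad w 0 1 = max (quad w + 2 * h j * w $ 2 + (h j)\<^sup>2) (quad w - 2 * h j * w $ 2 + (h j)\<^sup>2)"
    unfolding nbr_max_def quad_gpt by simp_all
  ultimately show ?thesis
    unfolding grad_eq_up_slope[OF hs_pos] up_slope_def by (simp only:)
qed

lemma grad_minus_quad_ge: "2 * norm w \<le> grad_minus (h j) quad w"
proof -
  have "(2 * norm w)\<^sup>2 = (2 * \<bar>w $ 1\<bar>)\<^sup>2 + (2 * \<bar>w $ 2\<bar>)\<^sup>2"
    unfolding power_mult_distrib power2_norm_eq_inner by (simp add: inner_vec_def sum_2 power2_eq_square)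
  also have "\<dots> \<le> (2 * \<bar>w $ 1\<bar> + h j)\<^sup>2 + (2 * \<bar>w $ 2\<bar> + h j)\<^sup>2"
    using hs_pos[of j] by (intro add_mono power_mono) auto
  finally show ?thesis unfolding grad_minus_quad by (rule real_le_rsqrt)
qed

lemma FS_le:
  assumes "k > 0"
  shows "FS j k w x \<le> trunc_cbrt k (L j) (grad_minus (h j) w x) (max (DS j w x) 0)"
    "FS j k w x \<le> k * grad_minus (h j) w x" "FS j k w x \<le> L j * max (DS j w x) 0"
proof -
  have "trunc_cbrt k (L j) (grad_plus (h j) w x) (max (- DS j w x) 0) \<ge> 0"
    using assms KL_pos by (intro trunc_cbrt_nonneg) auto
  then show 1: "FS j k w x \<le> trunc_cbrt k (L j) (grad_minus (h j) w x) (max (DS j w x) 0)"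
    by (simp add: Fe_eq_trunc_cbrt assms)
  then show "FS j k w x \<le> k * grad_minus (h j) w x" "FS j k w x \<le> L j * max (DS j w x) 0"
    by (auto intro: order_trans simp: trunc_cbrt_def)
qed

text \<open>Close to the vertex of the paraboloid F decays more slowly than the slope: at distance
  s^3 it equals 2 * s^2, while the gradient cap is at most 4 * K * s^3 once h < s^3. Consistency up
  to s^2 then leaves 1 \<le> 4 * s * K.\<close>

lemma K_at_top: "filterlim K at_top sequentially"
  unfolding filterlim_at_top_gt[where c = 0]
proof (intro allI impI)
  fix M :: real assume M: "M > 0"
  define s where "s = 1 / (4 * M)"
  have s: "s > 0" using M by (simp add: s_def)
  define w where "w = s ^ 3 *\<^sub>R e1"
  have "8 * (w \<bullet> w) = (2 * s\<^sup>2) ^ 3"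
    by (simp add: w_def inner_vec_def sum_2 power2_eq_square power3_eq_cube)
  then have F: "Fop (2 *\<^sub>R w) (2 *\<^sub>R mat 1) = 2 * s\<^sup>2"
    unfolding Fop_quad by (simp only: cbrt_cube)
  have "\<forall>\<^sub>F j in sequentially. \<forall>y\<in>{w}. \<bar>FS j (K j) quad y - Fop (2 *\<^sub>R y) (2 *\<^sub>R mat 1)\<bar> < s\<^sup>2"
    using uniform_consistency[OF cons C2_quad[of 1], of "{w}" "s\<^sup>2"] s by simp
  moreover have "\<forall>\<^sub>F j in sequentially. h j < s ^ 3"
    using order_tendstoD(2)[OF h_lim, of "s ^ 3"] s by simp
  ultimately show "\<forall>\<^sub>F j in sequentially. M \<le> K j"
  proof eventually_elim
    case (elim j)
    have "s\<^sup>2 \<le> FS j (K j) quad w" using elim(1) F by (simp add: abs_less_iff)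
    also have "\<dots> \<le> K j * grad_minus (h j) quad w" by (rule FS_le) (rule KL_pos)
    also have "\<dots> \<le> K j * (4 * s ^ 3)"
    proof (rule mult_left_mono)
      have "grad_minus (h j) quad w \<le> \<bar>2 * \<bar>w $ 1\<bar> + h j\<bar> + \<bar>2 * \<bar>w $ 2\<bar> + h j\<bar>"
        unfolding grad_minus_quad by (rule sqrt_sum_squares_le_sum_abs)
      then show "grad_minus (h j) quad w \<le> 4 * s ^ 3"
        using hs_pos[of j] s elim(2) by (simp add: w_def)
    qed (use KL_pos[of j] in simp)
    finally have "s\<^sup>2 * 1 \<le> s\<^sup>2 * (4 * s * K j)" by (simp add: power2_eq_square power3_eq_cube mult_ac)
    then have "1 \<le> 4 * s * K j" using s by (simp only: mult_le_cancel_left_pos zero_less_power)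
    then show ?case using M by (simp add: s_def field_simps)
  qed
qed

definition lin1 :: "real^2 \<Rightarrow> real" where "lin1 z = (2 *\<^sub>R e1) \<bullet> z"

lemma lin1_eq: "lin1 z = 2 * z $ 1"
  by (simp add: lin1_def inner_vec_def sum_2)

lemma stencil_sq_le:
  assumes "dist z x \<le> 3 * R j"
  shows "(z - x) \<bullet> (z - x) \<le> 9 * (R j)\<^sup>2"
proof -
  have "(dist z x)\<^sup>2 \<le> (3 * R j)\<^sup>2" using assms by (intro power_mono) auto
  then show ?thesis by (simp add: dist_norm power2_norm_eq_inner power_mult_distrib)
qed

text \<open>Expand |z|^2 around w: the remainder |z - w|^2 is at most 9 * (R j)^2 on the stencil,
  and the factor 2 / (R j)^2 turns this into 18. The base point x is free because translation
  changes a linear function only by a constant.\<close>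

lemma DS_quad_le_linear:
  "DS j quad w \<le> DS j (\<lambda>z. 2 * (w \<bullet> z)) x + 18"
proof -
  interpret stencil "h j" "n j" "nS j" "off j" by (rule st)
  define lw where "lw = (\<lambda>z::real^2. 2 * (w \<bullet> z))"
  have "med quad w \<le> med (\<lambda>z. 1 * lw z + (- (w \<bullet> w) + 9 * width\<^sup>2)) w"
  proof (rule med_mono)
    fix z assume "dist z w \<le> 3 * width"
    from stencil_sq_le[OF this] show "quad z \<le> 1 * lw z + (- (w \<bullet> w) + 9 * width\<^sup>2)"
      by (simp add: lw_def inner_simps inner_commute)
  qed
  also have "\<dots> = med lw w - w \<bullet> w + 9 * width\<^sup>2" by (simp only: med_scale_shift[of 1] zero_le_one)
  finally have "2 * (med quad w - w \<bullet> w) / width\<^sup>2 \<le> (2 * (med lw w - lw w) + 18 * width\<^sup>2) / width\<^sup>2"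
    using width_pos by (intro divide_right_mono) (auto simp: lw_def)
  then have "DS j quad w \<le> DS j lw w + 18"
    unfolding Delta1_eq add_divide_distrib using width_pos by simp
  also have "DS j lw w = DS j lw x"
  proof -
    have "med (\<lambda>z. lw (z + (w - x))) x = med lw w"
      by (simp add: stencil_median_def flip: gpt_add)
    moreover have "(\<lambda>z. lw (z + (w - x))) = (\<lambda>z. 1 * lw z + (lw w - lw x))"
      by (auto simp: lw_def inner_simps)
    ultimately have "med lw w = med lw x + (lw w - lw x)"
      using med_scale_shift[of 1 lw "lw w - lw x" x] by simp
    then show ?thesis by (simp add: Delta1_eq)
  qed
  finally show ?thesis by (simp add: lw_def)
qed

lemma abs_FS_lin1: "\<bar>FS j (K j) lin1 0\<bar> = trunc_cbrt (K j) (L j) 2 \<bar>DS j lin1 0\<bar>"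
proof -
  have "grad_minus (h j) lin1 0 = 2" "grad_plus (h j) lin1 0 = 2"
    using hs_pos[of j] by (simp_all add: grad_minus_def grad_plus_def lin1_eq gpt_def)
  moreover have "trunc_cbrt (K j) (L j) 2 \<bar>DS j lin1 0\<bar> \<ge> 0"
    using KL_pos[of j] by (intro trunc_cbrt_nonneg) auto
  ultimately show ?thesis using KL_pos[of j]
    by (cases "DS j lin1 0 \<ge> 0") (auto simp: Fe_eq_trunc_cbrt max_def)
qed

lemma K_ge: "\<forall>\<^sub>F j in sequentially. K j \<ge> c"
  using K_at_top by (auto simp: filterlim_at_top)

lemma lin1_small: "\<delta> > 0 \<Longrightarrow> \<forall>\<^sub>F j in sequentially. trunc_cbrt (K j) (L j) 2 \<bar>DS j lin1 0\<bar> < \<delta>"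
  using uniform_consistency[OF cons C2_space_linear[of "2 *\<^sub>R e1"], of "{0}" \<delta>]
  unfolding lin1_def[symmetric] by (simp add: Fop_def abs_FS_lin1)

text \<open>At \<open>e1\<close> F is 2, so the scheme is eventually at least 1 and 1 \<le> L * (D +
  18), where D is the median error of the linear part. Either L * D < 1/2 and 18 * L \<ge> 1/2, or
  consistency on the linear function forces D \<le> 1 and 19 * L \<ge> 1.\<close>

lemma L_lower: "\<forall>\<^sub>F j in sequentially. L j \<ge> 1 / 36"
proof -
  have F: "Fop (2 *\<^sub>R e1) (2 *\<^sub>R mat 1) = 2"
    using odd_real_root_power_cancel[of 3 2] unfolding Fop_quad by (simp add: inner_vec_def sum_2)
  have "\<forall>\<^sub>F j in sequentially. \<forall>y\<in>{e1}. \<bar>FS j (K j) quad y - Fop (2 *\<^sub>R y) (2 *\<^sub>R mat 1)\<bar> < 1"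
    using uniform_consistency[OF cons C2_quad[of 1], of "{e1}" 1] by simp
  moreover have "\<forall>\<^sub>F j in sequentially. trunc_cbrt (K j) (L j) 2 \<bar>DS j lin1 0\<bar> < 1 / 2"
    by (rule lin1_small) simp
  ultimately show ?thesis using K_ge[of 1]
  proof eventually_elim
    case (elim j)
    define D where "D = \<bar>DS j lin1 0\<bar>"
    have "1 \<le> FS j (K j) quad e1" using elim(1) F by (simp add: abs_less_iff)
    also have "\<dots> \<le> L j * max (DS j quad e1) 0" by (rule FS_le) (rule KL_pos)
    also have "\<dots> \<le> L j * (D + 18)"
    proof (rule mult_left_mono)
      have "(\<lambda>z. 2 * (e1 \<bullet> z)) = lin1" by (auto simp: lin1_def)
      then show "max (DS j quad e1) 0 \<le> D + 18"
        using DS_quad_le_linear[of j e1 0] by (auto simp: D_def)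
    qed (use KL_pos[of j] in simp)
    finally have 1: "1 \<le> L j * D + 18 * L j" by (simp add: algebra_simps)
    show ?case
    proof (cases "L j * D < 1 / 2")
      case True
      with 1 show ?thesis by simp
    next
      case False
      then have "root 3 (2\<^sup>2 * D) < 1 / 2"
        using elim(2,3) by (auto simp: trunc_cbrt_def min_def D_def split: if_splits)
      then have "root 3 (2\<^sup>2 * D) ^ 3 \<le> (1 / 2) ^ 3" by (intro power_mono) (auto simp: D_def)
      then have "2\<^sup>2 * D \<le> (1 / 2) ^ 3" by (simp only: cube_cbrt)
      then have "D \<le> 1" by (simp add: power3_eq_cube)
      then have "L j * D \<le> L j * 1" using KL_pos[of j] by (intro mult_left_mono) auto
      with 1 show ?thesis by simp
    qed
  qed
qed

text \<open>On the unit sphere F is 2, so the scheme is below 3 and \<open>trunc_cbrt_small\<close>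
  gives 36 * 3 = 108. The tangent plane lies below the paraboloid and inherits this bound; by
  homogeneity of linear functions it extends to all w, and \<open>DS_quad_le_linear\<close> adds
  18.\<close>

lemma DS_quad_bound: "\<forall>\<^sub>F j in sequentially. \<forall>w. DS j quad w \<le> 108 * norm w + 18"
proof -
  have "\<forall>\<^sub>F j in sequentially. \<forall>y\<in>sphere 0 1. \<bar>FS j (K j) quad y - Fop (2 *\<^sub>R y) (2 *\<^sub>R mat 1)\<bar> < 1"
    using uniform_consistency[OF cons C2_quad[of 1], of "sphere 0 1" 1] by simp
  then show ?thesis using K_ge[of 12] L_lower
  proof eventually_elim
    case (elim j)
    interpret stencil "h j" "n j" "nS j" "off j" by (rule st)
    have unit: "DS j quad w \<le> 108" if w: "norm w = 1" for w
    proof (cases "DS j quad w \<le> 0")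
      case False
      have "w \<bullet> w = 1" using w by (simp add: power2_norm_eq_inner[symmetric])
      then have "Fop (2 *\<^sub>R w) (2 *\<^sub>R mat 1) = 2"
        using odd_real_root_power_cancel[of 3 2] unfolding Fop_quad by simp
      then have "FS j (K j) quad w < 3" using elim(1) w by force
      moreover have "FS j (K j) quad w = trunc_cbrt (K j) (L j) (grad_minus (h j) quad w) (DS j quad w)"
        using False KL_pos[of j] by (simp add: Fe_eq_trunc_cbrt max_def)
      ultimately have "DS j quad w \<le> 36 * 3"
        using elim False grad_minus_quad_ge[of w j] w
        by (intro trunc_cbrt_small[of "K j" "L j" "grad_minus (h j) quad w" "DS j quad w" 3]) auto
      then show ?thesis by simp
    qed simp
    show ?case
    proof
      fix w :: "real^2"
      \<comment> \<open>Any unit vector serves for w = 0, since only w = norm w * v is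
        needed.\<close>
      define v where "v = (if w = 0 then e1 else sgn w)"
      have v: "norm v = 1" "w = norm w *\<^sub>R v"
        by (auto simp: v_def norm_sgn norm_vector_2 sgn_div_norm)
      define lw where "lw = (\<lambda>z::real^2. 2 * (v \<bullet> z))"
      have "med (\<lambda>z. 1 * lw z + (- 1)) v \<le> med quad v"
      proof (rule med_mono)
        fix z :: "real^2"
        have "0 \<le> (z - v) \<bullet> (z - v)" by simp
        moreover have "v \<bullet> v = 1" using v by (simp add: power2_norm_eq_inner[symmetric])
        ultimately show "1 * lw z + (- 1) \<le> quad z" by (simp add: lw_def inner_simps inner_commute)
      qed
      then have "med lw v - 1 \<le> med quad v" unfolding med_scale_shift[of 1, OF zero_le_one] by simp
      moreover have "v \<bullet> v = 1" using v by (simp add: power2_norm_eq_inner[symmetric])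
      ultimately have "DS j lw v \<le> DS j quad v"
        unfolding Delta1_eq by (intro divide_right_mono) (auto simp: lw_def)
      then have le: "DS j lw v \<le> 108" using unit[OF v(1)] by simp
      have "(\<lambda>z. 2 * (w \<bullet> z)) = (\<lambda>z. norm w * lw z + 0)"
        using v(2) by (auto simp: lw_def) (metis inner_scaleR_left mult.left_commute)
      then have "DS j (\<lambda>z. 2 * (w \<bullet> z)) v = DS j (\<lambda>z. norm w * lw z + 0) v" by simp
      also have "\<dots> = norm w * DS j lw v"
        unfolding Delta1_eq med_scale_shift[OF norm_ge_zero] by (simp add: algebra_simps diff_divide_distrib)
      also have "\<dots> \<le> norm w * 108" using le by (intro mult_left_mono) auto
      finally show "DS j quad w \<le> 108 * norm w + 18"
        using DS_quad_le_linear[of j w v] by simp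
    qed
  qed
qed


text \<open>For n < 4 the width is at most 4 * h. Otherwise all stencil points have norm at least
  half the width, so the quartic raises the median by (width / 2)^4 and the discrete curvature by
  width^2 / 8. Consistency makes the curvature of both functions small.\<close>

lemma width_lim: "(\<lambda>j. R j) \<longlonglongrightarrow> 0"
proof -
  define qf where "qf = (\<lambda>z::real^2. (2 *\<^sub>R e1) \<bullet> z + (z \<bullet> z)\<^sup>2)"
  have small: "\<forall>\<^sub>F j in sequentially. R j < c" if c: "c > 0" for c
  proof -
    \<comment> \<open>Both curvatures contribute 36 * \<delta> in the end, so width^2 \<le> 8 * 72 *
      \<delta> = 576 * \<delta>, which this choice keeps at or below c^2 / 2.\<close>
    define \<delta> where "\<delta> = min 1 (c\<^sup>2 / 1152)"
    have \<delta>: "\<delta> > 0" "\<delta> \<le> 12" "576 * \<delta> < c\<^sup>2" using c by (auto simp: \<delta>_def min_def)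
    have "\<forall>\<^sub>F j in sequentially. \<bar>FS j (K j) qf 0\<bar> < \<delta>"
      using uniform_consistency[OF cons C2_space_quartic[of "2 *\<^sub>R e1"], of "{0}" \<delta>] \<delta>
      unfolding qf_def[symmetric] by (simp add: Fop_def)
    moreover have "\<forall>\<^sub>F j in sequentially. h j < c / 4"
      using order_tendstoD(2)[OF h_lim, of "c / 4"] c by simp
    ultimately show ?thesis using lin1_small[OF \<delta>(1)] K_ge[of 12] L_lower
    proof eventually_elim
      case (elim j)
      interpret stencil "h j" "n j" "nS j" "off j" by (rule st)
      show ?case
      proof (cases "n j \<ge> 4")
        case False
        then have "h j * real (n j) \<le> h j * 4" using hs_pos[of j] by (intro mult_left_mono) auto
        then show ?thesis using elim(2) by simp
      next
        case True
        have lin: "\<bar>DS j lin1 0\<bar> \<le> 36 * \<delta>"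
          using elim \<delta> by (intro trunc_cbrt_small[of "K j" "L j" 2 _ \<delta>]) auto
        have qf0: "qf 0 = 0" "lin1 0 = 0" by (simp_all add: qf_def lin1_def)
        have "(width / 2) ^ 4 + med lin1 0 = med (\<lambda>z. 1 * lin1 z + (width / 2) ^ 4) 0"
          unfolding med_scale_shift[OF zero_le_one] by simp
        also have "\<dots> \<le> med qf 0"
          unfolding stencil_median_def
        proof (rule median_mono)
          fix i assume "i \<in> set [0..<nS j]"
          then have i: "i < nS j" by simp
          define z where "z = gpt (h j) 0 (of_int (fst (off j i))) (of_int (snd (off j i)))"
          have "h j * (real (n j) / 2) \<le> norm z"
            using stencil_norm_ge[OF valid True i] hs_pos[of j]
            by (simp add: z_def gpt_def)
          then have "(width / 2) ^ 4 \<le> norm z ^ 4" using width_pos by (intro power_mono) auto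
          also have "\<dots> = (z \<bullet> z)\<^sup>2" by (simp add: dot_square_norm flip: power_mult)
          finally show "1 * lin1 z + (width / 2) ^ 4 \<le> qf z" by (simp add: qf_def lin1_def)
        qed (use nS_ge in simp)
        finally have "(2 * (width / 2) ^ 4 + 2 * med lin1 0) / width\<^sup>2 \<le> 2 * med qf 0 / width\<^sup>2"
          using width_pos by (intro divide_right_mono) auto
        moreover have "2 * (width / 2) ^ 4 / width\<^sup>2 = width\<^sup>2 / 8"
          using width_pos by (simp add: power_divide power4_eq_xxxx power2_eq_square)
        ultimately have ge: "width\<^sup>2 / 8 + DS j lin1 0 \<le> DS j qf 0"
          unfolding Delta1_eq qf0 add_divide_distrib by simp
        have "DS j qf 0 \<le> 36 * \<delta>"
        proof (cases "DS j qf 0 \<le> 0")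
          case False
          then have "FS j (K j) qf 0 = trunc_cbrt (K j) (L j) (grad_minus (h j) qf 0) (DS j qf 0)"
            using KL_pos[of j] by (simp add: Fe_eq_trunc_cbrt max_def)
          moreover have "2 \<le> (qf (gpt (h j) 0 1 0) - qf 0) / h j"
            using hs_pos[of j] by (simp add: qf_def gpt_def inner_vec_def sum_2 field_simps)
          then have "2 \<le> grad_minus (h j) qf 0"
            using grad_ge_quotient(1)[OF hs_pos[of j], of 1 0 qf 0] by simp
          ultimately show ?thesis using elim False \<delta>
            by (intro trunc_cbrt_small[of "K j" "L j" "grad_minus (h j) qf 0" _ \<delta>]) auto
        qed (use \<delta> in simp)
        then have "width\<^sup>2 < c\<^sup>2" using ge lin \<delta> by linarith
        then show ?thesis using c by (rule power2_less_imp_less[OF _ less_imp_le])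
      qed
    qed
  qed
  show ?thesis
  proof (rule order_tendstoI)
    fix a :: real assume "a < 0"
    then show "\<forall>\<^sub>F j in sequentially. a < R j"
      using stencil.width_pos(1)[OF st] by (intro always_eventually allI) (rule less_trans)
  qed (use small in auto)
qed

text \<open>If the limit is 0, the reduced scheme is dominated in absolute value by the original
  one. If not, the gradient is nonzero, both one-sided slopes stay above a positive constant, and
  since K tends to infinity the gradient cap is eventually inactive for both constants.\<close>

lemma consistent_reduced: "consistent_seq (\<lambda>j. Fe (h j) (n j) (nS j) (off j) (K j / sqrt 2) (L j))"
  unfolding consistent_seq_def
proof (intro allI impI)
  fix \<phi> g Hs x y assume C2: "C2_space \<phi> g Hs" and y: "(y :: nat \<Rightarrow> real^2) \<longlonglongrightarrow> x"
  define F where "F = Fop (g x) (Hs x)"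
  have lim: "(\<lambda>j. FS j (K j) \<phi> (y j)) \<longlonglongrightarrow> F"
    using cons C2 y unfolding consistent_seq_def F_def by blast
  have K': "0 < K j / sqrt 2" "K j / sqrt 2 \<le> K j" for j
    using KL_pos[of j] by (auto simp: divide_le_eq)
  show "(\<lambda>j. FS j (K j / sqrt 2) \<phi> (y j)) \<longlonglongrightarrow> Fop (g x) (Hs x)"
  proof (cases "F = 0")
    case True
    then have "(\<lambda>j. \<bar>FS j (K j) \<phi> (y j)\<bar>) \<longlonglongrightarrow> 0" using tendsto_rabs[OF lim] by simp
    then have "(\<lambda>j. FS j (K j / sqrt 2) \<phi> (y j)) \<longlonglongrightarrow> 0"
      by (rule Lim_null_comparison[rotated])
        (auto intro!: always_eventually stencil.abs_FKL_mono[OF st] K' KL_pos)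
    then show ?thesis using True by (simp add: F_def)
  next
    case False
    then have "g x $ 1 \<noteq> 0 \<or> g x $ 2 \<noteq> 0" by (auto simp: F_def Fop_def)
    then obtain a b where ab: "(a, b) \<in> {(1, 0), (0, 1)}" "g x \<bullet> vector [a, b] \<noteq> 0"
    proof
      assume "g x $ 1 \<noteq> 0" then show ?thesis by (intro that[of 1 0]) (simp_all add: inner_vec_def sum_2)
    next
      assume "g x $ 2 \<noteq> 0" then show ?thesis by (intro that[of 0 1]) (simp_all add: inner_vec_def sum_2)
    qed
    define d where "d = g x \<bullet> vector [a, b]"
    have q: "(\<lambda>j. (\<phi> (gpt (h j) (y j) a b) - \<phi> (y j)) / h j) \<longlonglongrightarrow> d"
      unfolding gpt_def d_def by (rule tendsto_difference_quotient[OF C2 y h_lim hs_pos])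
    have "(\<lambda>j. (\<phi> (gpt (h j) (y j) (- a) (- b)) - \<phi> (y j)) / h j) \<longlonglongrightarrow> g x \<bullet> vector [- a, - b]"
      unfolding gpt_def by (rule tendsto_difference_quotient[OF C2 y h_lim hs_pos])
    then have q': "(\<lambda>j. (\<phi> (gpt (h j) (y j) (- a) (- b)) - \<phi> (y j)) / h j) \<longlonglongrightarrow> - d"
      by (simp add: d_def inner_vec_def sum_2)
    have d0: "d \<noteq> 0" using ab(2) by (simp add: d_def)
    have "\<forall>\<^sub>F j in sequentially. \<bar>(\<phi> (gpt (h j) (y j) a b) - \<phi> (y j)) / h j - d\<bar> < \<bar>d\<bar> / 2"
      using tendstoD[OF q, of "\<bar>d\<bar> / 2"] d0 by (simp add: dist_real_def)
    moreover have "\<forall>\<^sub>F j in sequentially. \<bar>(\<phi> (gpt (h j) (y j) (- a) (- b)) - \<phi> (y j)) / h j + d\<bar> < \<bar>d\<bar> / 2"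
      using tendstoD[OF q', of "\<bar>d\<bar> / 2"] d0 by (simp add: dist_real_def)
    moreover have "\<forall>\<^sub>F j in sequentially. \<bar>FS j (K j) \<phi> (y j)\<bar> < \<bar>F\<bar> + 1"
      by (rule order_tendstoD(2)[OF tendsto_rabs[OF lim]]) simp
    ultimately have "\<forall>\<^sub>F j in sequentially. FS j (K j) \<phi> (y j) = FS j (K j / sqrt 2) \<phi> (y j)"
      using K_ge[of "sqrt 2 * ((\<bar>F\<bar> + 1) / (\<bar>d\<bar> / 2))"]
    proof eventually_elim
      case (elim j)
      define D where "D s = (\<phi> (gpt (h j) (y j) (s * a) (s * b)) - \<phi> (y j)) / h j" for s :: real
      have s: "D s \<le> grad_minus (h j) \<phi> (y j)" "- D s \<le> grad_plus (h j) \<phi> (y j)" if "s = 1 \<or> s = -1" for s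
        using grad_ge_quotient[OF hs_pos[of j], of "s * a" "s * b" \<phi> "y j"] ab(1) that
        by (auto simp: D_def minus_divide_left)
      have D: "\<bar>D 1 - d\<bar> < \<bar>d\<bar> / 2" "\<bar>D (-1) + d\<bar> < \<bar>d\<bar> / 2" using elim by (simp_all add: D_def)
      have c: "\<bar>d\<bar> / 2 \<le> grad_minus (h j) \<phi> (y j)" "\<bar>d\<bar> / 2 \<le> grad_plus (h j) \<phi> (y j)"
        using D s(1)[of 1] s(1)[of "-1"] s(2)[of 1] s(2)[of "-1"] by (simp_all add: abs_if split: if_splits)
      have "(\<bar>F\<bar> + 1) / (\<bar>d\<bar> / 2) \<le> K j / sqrt 2"
        using elim(4) by (simp add: pos_le_divide_eq mult.commute del: divide_divide_eq_right times_divide_eq_right times_divide_eq_left)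
      then have "\<bar>F\<bar> + 1 \<le> K j / sqrt 2 * (\<bar>d\<bar> / 2)" using d0 by (simp add: pos_divide_le_eq del: times_divide_eq_right)
      then show ?case
        using elim(3) c by (intro stencil.FKL_eq_if_small[OF st K' KL_pos(2), where c = "\<bar>d\<bar> / 2", symmetric]) auto
    qed
    from Lim_transform_eventually[OF lim this] show ?thesis by (simp add: F_def)
  qed
qed

end

section \<open>Compactness and monotone iterations\<close>

text \<open>The approximations are step functions in time, hence discontinuous, and equicontinuous
  only in the limit of large j; the domain is unbounded in time. Convergence on a countable dense
  set still spreads to all points and to compact sets.\<close>

lemma asymptotic_Arzela_Ascoli:
  fixes U :: "nat \<Rightarrow> 'a::euclidean_space \<Rightarrow> real"
  assumes bdd: "\<And>j x. x \<in> D \<Longrightarrow> \<bar>U j x\<bar> \<le> M"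
    and equi: "\<And>e. e > 0 \<Longrightarrow> \<exists>d>0. \<forall>\<^sub>F j in sequentially. \<forall>x\<in>D. \<forall>y\<in>D. dist x y < d \<longrightarrow> \<bar>U j x - U j y\<bar> < e"
  obtains r v where "strict_mono (r :: nat \<Rightarrow> nat)" "continuous_on D v"
    "\<And>C e. compact C \<Longrightarrow> C \<subseteq> D \<Longrightarrow> e > 0 \<Longrightarrow> \<forall>\<^sub>F j in sequentially. \<forall>x\<in>C. \<bar>U (r j) x - v x\<bar> < e"
proof -
  obtain T where T: "countable T" "T \<subseteq> D" "D \<subseteq> closure T" by (rule separable)
  have "\<And>n x. x \<in> T \<Longrightarrow> norm (U n x) \<le> M" using bdd T by auto
  from function_convergent_subsequence[where f = U, OF T(1) this]
  obtain r where r: "strict_mono (r :: nat \<Rightarrow> nat)" and conv: "\<And>x. x \<in> T \<Longrightarrow> \<exists>l. (\<lambda>n. U (r n) x) \<longlonglongrightarrow> l"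
    by blast
  have equi': "\<exists>d>0. \<exists>N. \<forall>j\<ge>N. \<forall>x\<in>D. \<forall>y\<in>D. dist x y < d \<longrightarrow> \<bar>U (r j) x - U (r j) y\<bar> < e" if "e > 0" for e
  proof -
    obtain d where d: "d > 0" "\<forall>\<^sub>F j in sequentially. \<forall>x\<in>D. \<forall>y\<in>D. dist x y < d \<longrightarrow> \<bar>U j x - U j y\<bar> < e"
      using equi[OF \<open>e > 0\<close>] by blast
    from eventually_subseq[OF r d(2)] show ?thesis
      using d(1) unfolding eventually_sequentially by blast
  qed
  have "Cauchy (\<lambda>n. U (r n) x)" if x: "x \<in> D" for x
  proof (rule CauchyI)
    fix e :: real assume "e > 0"
    then obtain d N where d: "d > 0"
      and N: "\<And>j x y. j \<ge> N \<Longrightarrow> x \<in> D \<Longrightarrow> y \<in> D \<Longrightarrow> dist x y < d \<Longrightarrow> \<bar>U (r j) x - U (r j) y\<bar> < e / 3"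
      using equi'[of "e / 3"] by (metis divide_pos_pos zero_less_numeral)
    obtain t where t: "t \<in> T" "dist t x < d" using T(3) x d closure_approachable[of x T] by blast
    have "Cauchy (\<lambda>n. U (r n) t)" using conv[OF t(1)] LIMSEQ_imp_Cauchy by blast
    from CauchyD[OF this, of "e / 3"] \<open>e > 0\<close> obtain N' where
      N': "\<And>m n. m \<ge> N' \<Longrightarrow> n \<ge> N' \<Longrightarrow> \<bar>U (r m) t - U (r n) t\<bar> < e / 3" by auto
    have "\<bar>U (r m) x - U (r n) x\<bar> < e" if "m \<ge> max N N'" "n \<ge> max N N'" for m n
    proof -
      have "\<bar>U (r m) t - U (r m) x\<bar> < e / 3" "\<bar>U (r n) t - U (r n) x\<bar> < e / 3" "\<bar>U (r m) t - U (r n) t\<bar> < e / 3"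
        using N[of m t x] N[of n t x] N'[of m n] that t x T(2) by auto
      then show ?thesis by arith
    qed
    then show "\<exists>M. \<forall>m\<ge>M. \<forall>n\<ge>M. norm (U (r m) x - U (r n) x) < e"
      by (intro exI[of _ "max N N'"]) simp
  qed
  then have "\<forall>x. \<exists>l. x \<in> D \<longrightarrow> (\<lambda>n. U (r n) x) \<longlonglongrightarrow> l"
    by (auto simp: Cauchy_convergent_iff convergent_def)
  from choice[OF this] obtain v where v: "\<And>x. x \<in> D \<Longrightarrow> (\<lambda>n. U (r n) x) \<longlonglongrightarrow> v x" by auto
  have vmod: "\<exists>d>0. (\<forall>x\<in>D. \<forall>y\<in>D. dist x y < d \<longrightarrow> \<bar>v x - v y\<bar> \<le> e) \<and>
      (\<exists>N. \<forall>j\<ge>N. \<forall>x\<in>D. \<forall>y\<in>D. dist x y < d \<longrightarrow> \<bar>U (r j) x - U (r j) y\<bar> < e)" if e: "e > 0" for e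
  proof -
    obtain d N where d: "d > 0" and N: "\<forall>j\<ge>N. \<forall>x\<in>D. \<forall>y\<in>D. dist x y < d \<longrightarrow> \<bar>U (r j) x - U (r j) y\<bar> < e"
      using equi'[OF e] by blast
    have "\<bar>v x - v y\<bar> \<le> e" if "x \<in> D" "y \<in> D" "dist x y < d" for x y
    proof (rule LIMSEQ_le_const2)
      show "(\<lambda>n. \<bar>U (r n) x - U (r n) y\<bar>) \<longlonglongrightarrow> \<bar>v x - v y\<bar>" using v that by (intro tendsto_intros) auto
      show "\<exists>N. \<forall>n\<ge>N. \<bar>U (r n) x - U (r n) y\<bar> \<le> e" using N that less_imp_le by blast
    qed
    with d N show ?thesis by blast
  qed
  show thesis
  proof (rule that[OF r])
    show "continuous_on D v"
      unfolding continuous_on_iff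
    proof (intro ballI allI impI)
      fix x e assume x: "x \<in> D" and "(e::real) > 0"
      then obtain d where "d > 0" "\<forall>x\<in>D. \<forall>y\<in>D. dist x y < d \<longrightarrow> \<bar>v x - v y\<bar> \<le> e / 2"
        using vmod[of "e / 2"] by auto
      then show "\<exists>d>0. \<forall>x'\<in>D. dist x' x < d \<longrightarrow> dist (v x') (v x) < e"
        using x \<open>e > 0\<close> by (intro exI[of _ d]) (force simp: dist_real_def)
    qed
    fix C e assume C: "compact C" "C \<subseteq> D" and "(e::real) > 0"
    then have "e / 3 > 0" by simp
    from vmod[OF this] obtain d N where d: "d > 0" and dv: "\<And>x y. x \<in> D \<Longrightarrow> y \<in> D \<Longrightarrow> dist x y < d \<Longrightarrow> \<bar>v x - v y\<bar> \<le> e / 3"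
      and N: "\<And>j x y. j \<ge> N \<Longrightarrow> x \<in> D \<Longrightarrow> y \<in> D \<Longrightarrow> dist x y < d \<Longrightarrow> \<bar>U (r j) x - U (r j) y\<bar> < e / 3"
      by blast
    obtain Q where Q: "Q \<subseteq> C" "finite Q" "C \<subseteq> (\<Union>c\<in>Q. ball c d)"
      using compactE_image[OF C(1), of C "\<lambda>c. ball c d"] d by force
    have "\<forall>\<^sub>F j in sequentially. \<forall>c\<in>Q. \<bar>U (r j) c - v c\<bar> < e / 3"
    proof (rule eventually_ball_finite[OF Q(2)], rule ballI)
      fix c assume "c \<in> Q"
      then have "c \<in> D" using Q C by blast
      from tendstoD[OF v[OF this], of "e / 3"] \<open>e > 0\<close>
      show "\<forall>\<^sub>F j in sequentially. \<bar>U (r j) c - v c\<bar> < e / 3" by (simp add: dist_real_def)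
    qed
    then show "\<forall>\<^sub>F j in sequentially. \<forall>x\<in>C. \<bar>U (r j) x - v x\<bar> < e"
      using eventually_ge_at_top[of N]
    proof eventually_elim
      case (elim j)
      show ?case
      proof
        fix x assume x: "x \<in> C"
        then obtain c where c: "c \<in> Q" "dist c x < d" using Q(3) by auto
        then have D: "c \<in> D" "x \<in> D" using Q C x by auto
        have "\<bar>U (r j) c - U (r j) x\<bar> < e / 3" "\<bar>v c - v x\<bar> \<le> e / 3" "\<bar>U (r j) c - v c\<bar> < e / 3"
          using N[OF elim(2) D c(2)] dv[OF D c(2)] elim(1) c(1) by auto
        then show "\<bar>U (r j) x - v x\<bar> < e" by arith
      qed
    qed
  qed
qed

section \<open>Iteration of a monotone step combined with projection onto a convex set\<close>

lemma time_iter_add: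
  "time_iter u0 Op dt S (k + m) = time_iter (time_iter u0 Op dt S m) Op dt S k"
  by (induction k) auto

text \<open>These properties are all that the stability estimates use: \<open>shift\<close> and
  \<open>mono\<close> give nonexpansion in the supremum norm, \<open>translate\<close> turns spatial
  differences into a comparison of two iterates, and \<open>odd\<close> yields lower bounds from
  upper ones.\<close>

locale monotone_step =
  fixes Op :: "(real^2 \<Rightarrow> real) \<Rightarrow> real^2 \<Rightarrow> real" and dt :: real and S :: "(real^2) set"
  assumes S: "convex S" "compact S" "S \<noteq> {}" and dt_pos: "dt > 0"
    and mono: "\<And>w v x. (\<And>z. w z \<le> v z) \<Longrightarrow> w x + dt * Op w x \<le> v x + dt * Op v x"
    and shift: "\<And>w c x. Op (\<lambda>z. w z + c) x = Op w x"
    and translate: "\<And>w s x. Op (\<lambda>z. w (z + s)) x = Op w (x + s)"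
    and odd: "\<And>w x. Op (\<lambda>z. - w z) x = - Op w x"
begin

abbreviation "pr \<equiv> closest_point S"
abbreviation "iter u0 \<equiv> time_iter u0 Op dt S"

lemma closed_S: "closed S" using S compact_imp_closed by blast

lemma pr_in: "pr z \<in> S" using closest_point_in_set[OF closed_S S(3)] .

lemma pr_self: "x \<in> S \<Longrightarrow> pr x = x" by (rule closest_point_self)

lemma pr_lipschitz: "dist (pr x) (pr y) \<le> dist x y"
  by (rule closest_point_lipschitz[OF S(1) closed_S S(3)])

lemma pr_dist_le: "x \<in> S \<Longrightarrow> dist (pr z) x \<le> dist z x"
  using pr_lipschitz[of z x] by (simp add: pr_self)

lemma step_le:
  assumes "x \<in> S" "\<And>z. iter a k (pr z) \<le> v z" 
  shows "iter a (Suc k) x \<le> v x + dt * Op v x"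
  using mono[of "\<lambda>z. iter a k (pr z)" v x] assms by (simp add: pr_self)

lemma iter_uminus: "iter (\<lambda>x. - a x) k = (\<lambda>x. - iter a k x)"
  by (induction k) (auto simp: odd)

lemma iter_compare:
  assumes "\<And>x. x \<in> S \<Longrightarrow> a x \<le> b x + c" "x \<in> S"
  shows "iter a k x \<le> iter b k x + c"
  using assms(2)
proof (induction k arbitrary: x)
  case (Suc k)
  have "iter a (Suc k) x \<le> (iter b k (pr x) + c) + dt * Op (\<lambda>z. iter b k (pr z) + c) x"
    using Suc pr_in by (intro step_le) auto
  then show ?case using Suc by (simp add: shift pr_self)
qed (use assms in simp)

text \<open>The iterate is compared with its own translate by s = y - x. Projection is nonexpansive,
  so \<open>pr z\<close> and \<open>pr (z + s)\<close> are no further apart than x and y, and the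
  modulus passes to the next step even near the boundary.\<close>

lemma iter_modulus:
  assumes "\<And>x y. x \<in> S \<Longrightarrow> y \<in> S \<Longrightarrow> dist x y \<le> \<delta> \<Longrightarrow> a x \<le> a y + \<eta>"
    and "x \<in> S" "y \<in> S" "dist x y \<le> \<delta>"
  shows "iter a k x \<le> iter a k y + \<eta>"
  using assms(2-)
proof (induction k arbitrary: x y)
  case (Suc k)
  define s where "s = y - x"
  have "iter a (Suc k) x \<le> (iter a k (pr (x + s)) + \<eta>) + dt * Op (\<lambda>z. iter a k (pr (z + s)) + \<eta>) x"
  proof (rule step_le[OF Suc.prems(1)])
    fix z
    have "dist (pr z) (pr (z + s)) \<le> dist z (z + s)" by (rule pr_lipschitz)
    also have "\<dots> = dist x y" by (simp add: dist_norm s_def norm_minus_commute)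
    finally show "iter a k (pr z) \<le> iter a k (pr (z + s)) + \<eta>"
      using Suc.prems by (intro Suc.IH pr_in) auto
  qed
  then show ?case
    using translate[of "\<lambda>z. iter a k (pr z)" s x] Suc.prems by (simp add: shift s_def pr_self)
qed (use assms in simp)

lemma iter_const: "iter (\<lambda>_. c) k = (\<lambda>_. c)"
proof (induction k)
  case (Suc k)
  have "Op (\<lambda>_. 0) x = 0" for x using odd[of "\<lambda>_. 0" x] by simp
  then have "Op (\<lambda>_. c) x = 0" for x using shift[of "\<lambda>_. 0" c x] by simp
  then show ?case using Suc by auto
qed simp

lemma iter_bound:
  assumes "\<And>x. x \<in> S \<Longrightarrow> \<bar>a x\<bar> \<le> M" "x \<in> S"
  shows "\<bar>iter a k x\<bar> \<le> M"
proof -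
  have "iter a k x \<le> iter (\<lambda>_. 0) k x + M" "iter (\<lambda>_. 0) k x \<le> iter a k x + M"
    using assms by (force intro!: iter_compare simp: abs_le_iff)+
  then show ?thesis by (simp add: iter_const abs_le_iff)
qed

text \<open>Projection does not increase the distance to a point x of S, so a paraboloid centred at
  x remains an upper barrier after projection; each step then raises it by at most dt * B.\<close>

lemma iter_barrier:
  assumes x: "x \<in> S" and C: "C \<ge> 0" and a: "\<And>y. y \<in> S \<Longrightarrow> a y \<le> A + C * ((y - x) \<bullet> (y - x))"
    and B: "\<And>y. y \<in> S \<Longrightarrow> Op (\<lambda>z. C * (z \<bullet> z)) (y - x) \<le> B" and y: "y \<in> S"
  shows "iter a k y \<le> A + C * ((y - x) \<bullet> (y - x)) + real k * dt * B"
  using y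
proof (induction k arbitrary: y)
  case (Suc k)
  define v where "v = (\<lambda>z. C * ((z + (- x)) \<bullet> (z + (- x))) + (A + real k * dt * B))"
  have "iter a (Suc k) y \<le> v y + dt * Op v y"
  proof (rule step_le[OF Suc.prems])
    fix z
    have "(dist (pr z) x)\<^sup>2 \<le> (dist z x)\<^sup>2" using pr_dist_le[OF x] by (intro power_mono) auto
    then have "C * ((pr z - x) \<bullet> (pr z - x)) \<le> C * ((z - x) \<bullet> (z - x))"
      using C by (intro mult_left_mono) (auto simp: dist_norm power2_norm_eq_inner)
    then show "iter a k (pr z) \<le> v z" using Suc.IH[OF pr_in, of z] by (simp add: v_def)
  qed
  also have "Op v y = Op (\<lambda>z. C * (z \<bullet> z)) (y - x)"
    using translate[of "\<lambda>z. C * (z \<bullet> z)" "- x" y] unfolding v_def shift by simp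
  also have "v y + dt * \<dots> \<le> v y + dt * B" using B[OF Suc.prems] dt_pos by simp
  finally show ?case by (simp add: v_def algebra_simps)
qed (use a in simp)

text \<open>The barriers control the first k steps for the initial data and its negative;
  nonexpansion then carries the estimate through m further steps.\<close>

lemma iter_time:
  assumes C: "C \<ge> 0" and a: "\<And>x y. x \<in> S \<Longrightarrow> y \<in> S \<Longrightarrow> \<bar>a y - a x\<bar> \<le> \<eta> + C * ((y - x) \<bullet> (y - x))"
    and B: "\<And>x y. x \<in> S \<Longrightarrow> y \<in> S \<Longrightarrow> Op (\<lambda>z. C * (z \<bullet> z)) (y - x) \<le> B"
    and x: "x \<in> S"
  shows "\<bar>iter a (k + m) x - iter a m x\<bar> \<le> \<eta> + real k * dt * B"
proof -
  have 1: "\<bar>iter a k x - a x\<bar> \<le> \<eta> + real k * dt * B" if x: "x \<in> S" for x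
  proof -
    have "iter a k x \<le> (a x + \<eta>) + C * ((x - x) \<bullet> (x - x)) + real k * dt * B"
      by (rule iter_barrier[OF x C _ B[OF x] x]) (use a[OF x] in \<open>force simp: abs_le_iff\<close>)
    moreover have "iter (\<lambda>x. - a x) k x \<le> (- a x + \<eta>) + C * ((x - x) \<bullet> (x - x)) + real k * dt * B"
      by (rule iter_barrier[OF x C _ B[OF x] x]) (use a[OF x] in \<open>force simp: abs_le_iff\<close>)
    ultimately show ?thesis by (simp add: iter_uminus abs_le_iff)
  qed
  have 2: "iter a (k + m) x = iter (iter a k) m x" by (metis add.commute time_iter_add)
  have "iter (iter a k) m x \<le> iter a m x + (\<eta> + real k * dt * B)"
    "iter a m x \<le> iter (iter a k) m x + (\<eta> + real k * dt * B)"
    using 1 x by (force intro!: iter_compare simp: abs_le_iff)+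
  then show ?thesis unfolding 2 by (simp add: abs_le_iff)
qed

end

section \<open>Test functions near the boundary\<close>

lemma Fop_uminus: "Fop (- p) (- X) = - Fop p X"
proof -
  have "(- X) $ 1 $ 1 * ((- p) $ 2)\<^sup>2 - 2 * (- p) $ 1 * (- p) $ 2 * (- X) $ 1 $ 2 + (- X) $ 2 $ 2 * ((- p) $ 1)\<^sup>2
    = - (X $ 1 $ 1 * (p $ 2)\<^sup>2 - 2 * p $ 1 * p $ 2 * X $ 1 $ 2 + X $ 2 $ 2 * (p $ 1)\<^sup>2)" by simp
  then show ?thesis unfolding Fop_def by (simp only: real_root_minus)
qed

lemma test_fn_uminus:
  assumes "test_fn \<phi> G H T"
  shows "test_fn (\<lambda>x t. - \<phi> x t) (\<lambda>x t. - G x t) (\<lambda>x t. - H x t) (\<lambda>x t. - T x t)"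
proof -
  have m: "(- A) *v v = - (A *v v)" for A :: "real^2^2" and v
    by (simp add: vec_eq_iff matrix_vector_mult_def sum_negf)
  have c: "continuous_on UNIV (\<lambda>(x, t). - f x t)" if "continuous_on UNIV (\<lambda>(x, t). f x t)"
    for f :: "real^2 \<Rightarrow> real \<Rightarrow> 'b::topological_group_add"
    using continuous_on_minus[OF that] by (simp add: case_prod_beta)
  show ?thesis
    using assms unfolding test_fn_def m by (auto intro!: derivative_eq_intros c)
qed

lemma test_fn_C2_space:
  assumes "test_fn \<phi> G H T"
  shows "C2_space (\<lambda>y. \<phi> y t) (\<lambda>y. G y t) (\<lambda>y. H y t)"
proof -
  have "continuous_on UNIV (\<lambda>(x, t). H x t)" using assms by (simp add: test_fn_def)
  moreover have "continuous_on UNIV (\<lambda>y. (y, t))" by (intro continuous_intros)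
  ultimately have "continuous_on UNIV (\<lambda>y. (\<lambda>(x, t). H x t) (y, t))"
    by (rule continuous_on_compose2) simp
  then show ?thesis using assms by (auto simp: C2_space_def test_fn_def)
qed

text \<open>Joint continuity of the time derivative makes the first order expansion in time uniform
  for y near x.\<close>

lemma test_fn_time_bound:
  assumes tf: "test_fn \<phi> G H T" and e: "e > 0"
  shows "\<exists>d>0. \<forall>y s. norm (y - x) < d \<longrightarrow> \<bar>s - t\<bar> < d \<longrightarrow> \<phi> y s \<le> \<phi> y t + T x t * (s - t) + e * \<bar>s - t\<bar>"
proof -
  have "continuous_on UNIV (\<lambda>(x, t). T x t)" using tf by (simp add: test_fn_def)
  then obtain d where d: "d > 0" "\<And>y s. dist (y, s) (x, t) < d \<Longrightarrow> \<bar>T y s - T x t\<bar> < e"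
    using e unfolding continuous_on_iff dist_real_def by (metis (no_types, lifting) UNIV_I case_prod_conv)
  have "\<phi> y s \<le> \<phi> y t + T x t * (s - t) + e * \<bar>s - t\<bar>" if "norm (y - x) < d / 2" "\<bar>s - t\<bar> < d / 2" for y s
  proof -
    have der: "((\<lambda>s. \<phi> y s) has_real_derivative T y s) (at s)" for s using tf by (auto simp: test_fn_def)
    obtain \<xi> where \<xi>: "\<bar>\<xi> - t\<bar> \<le> \<bar>s - t\<bar>" "\<phi> y s - \<phi> y t = (s - t) * T y \<xi>"
    proof (cases s t rule: linorder_cases)
      case less
      from MVT2[OF less, of "\<phi> y" "T y"] der obtain z where "s < z" "z < t" "\<phi> y t - \<phi> y s = (t - s) * T y z" by auto
      then show ?thesis by (intro that[of z]) (auto simp: algebra_simps)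
    next
      case equal
      then show ?thesis by (intro that[of t]) auto
    next
      case greater
      from MVT2[OF greater, of "\<phi> y" "T y"] der obtain z where "t < z" "z < s" "\<phi> y s - \<phi> y t = (s - t) * T y z" by auto
      then show ?thesis by (intro that[of z]) auto
    qed
    have "dist (y, \<xi>) (x, t) \<le> norm (y - x) + \<bar>\<xi> - t\<bar>"
      using sqrt_sum_squares_le_sum[of "norm (y - x)" "\<bar>\<xi> - t\<bar>"]
      by (simp add: dist_norm norm_Pair)
    then have "\<bar>T y \<xi> - T x t\<bar> < e" using that \<xi>(1) by (intro d(2)) linarith
    then have "\<bar>(s - t) * (T y \<xi> - T x t)\<bar> \<le> \<bar>s - t\<bar> * e"
      unfolding abs_mult by (intro mult_left_mono) auto
    then have "(s - t) * (T y \<xi> - T x t) \<le> \<bar>s - t\<bar> * e" by linarith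
    then show ?thesis using \<xi>(2) by (simp add: algebra_simps)
  qed
  then show ?thesis using d(1) by (intro exI[of _ "d / 2"]) auto
qed

lemma C2_domain_closure:
  assumes "C2_domain \<Omega> \<rho> D\<rho>"
  shows "closure \<Omega> \<subseteq> {x. \<rho> x \<le> 0}" "convex (closure \<Omega>)" "compact (closure \<Omega>)" "closure \<Omega> \<noteq> {}"
proof -
  obtain H\<rho> where C2: "C2_space \<rho> D\<rho> H\<rho>" and \<Omega>: "\<Omega> = {x. \<rho> x < 0}"
    using assms by (auto simp: C2_domain_def)
  have "closed {x. \<rho> x \<le> 0}"
    using C2_space_continuous(1)[OF C2] by (intro closed_Collect_le continuous_on_const)
  then show "closure \<Omega> \<subseteq> {x. \<rho> x \<le> 0}" by (rule closure_minimal[rotated]) (auto simp: \<Omega>)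
  show "convex (closure \<Omega>)" "compact (closure \<Omega>)" "closure \<Omega> \<noteq> {}"
    using assms by (auto simp: C2_domain_def intro: convex_closure)
qed

lemma projection_decreases:
  assumes dom: "C2_domain \<Omega> \<rho> D\<rho>" and C2: "C2_space q g Hs" and x: "x \<in> closure \<Omega>"
    and out: "x \<in> \<Omega> \<or> g x \<bullet> D\<rho> x > 0"
  shows "\<exists>d>0. \<forall>z. dist z x \<le> d \<longrightarrow> q (closest_point (closure \<Omega>) z) \<le> q z"
proof -
  define S where "S = closure \<Omega>"
  note S = C2_domain_closure[OF dom, folded S_def]
  have closed: "closed S" by (simp add: S_def)
  show ?thesis
  proof (cases "x \<in> \<Omega>")
    case True
    then obtain d where d: "d > 0" "cball x d \<subseteq> \<Omega>"
      using dom open_contains_cball[of \<Omega>] unfolding C2_domain_def by blast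
    then have "closest_point S z = z" if "dist z x \<le> d" for z
      using that closure_subset[of \<Omega>] by (intro closest_point_self) (auto simp: S_def dist_commute)
    then show ?thesis using d by (auto simp: S_def)
  next
    case False
    obtain H\<rho> where C\<rho>: "C2_space \<rho> D\<rho> H\<rho>" and \<Omega>: "\<Omega> = {x. \<rho> x < 0}"
      using dom by (auto simp: C2_domain_def)
    define c where "c = g x \<bullet> D\<rho> x"
    have c: "c > 0" using out False by (simp add: c_def)
    have cont: "continuous_on UNIV (\<lambda>p. g (fst p) \<bullet> D\<rho> (snd p))"
      by (intro continuous_intros continuous_on_compose2[OF C2_space_continuous(2)[OF C2]]
          continuous_on_compose2[OF C2_space_continuous(2)[OF C\<rho>]]) auto
    then obtain d where d: "d > 0" and near: "\<And>\<xi> p. dist (\<xi>, p) (x, x) < d \<Longrightarrow> \<bar>g \<xi> \<bullet> D\<rho> p - c\<bar> < c"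
      using c unfolding continuous_on_iff dist_real_def c_def by (metis UNIV_I fst_conv snd_conv)
    \<comment> \<open>The intermediate point \<open>\<xi>\<close> and the projection
      \<open>p\<close> both stay within d / 3 of x, so the pair is within d of (x, x) and the inner
      product of \<open>g \<xi>\<close> and \<open>D\<rho> p\<close> stays positive although the two
      are evaluated at different points.\<close>
    have "q (closest_point S z) \<le> q z" if z: "dist z x \<le> d / 3" for z
    proof -
      define p where "p = closest_point S z"
      have pS: "p \<in> S" unfolding p_def by (rule closest_point_in_set[OF closed S(4)])
      have px: "dist p x \<le> dist z x"
        using closest_point_lipschitz[OF S(2) closed S(4), of z x] x closest_point_self[of x S]
        by (simp add: p_def S_def)
      define f where "f t = q (p + t *\<^sub>R (z - p))" for t
      have der: "(f has_real_derivative g (p + t *\<^sub>R (z - p)) \<bullet> (z - p)) (at t)" for t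
      proof -
        have "(q has_derivative (\<lambda>v. g (p + t *\<^sub>R (z - p)) \<bullet> v)) (at (p + t *\<^sub>R (z - p)))"
          using C2 by (auto simp: C2_space_def)
        then have "(f has_derivative (\<lambda>s. g (p + t *\<^sub>R (z - p)) \<bullet> (s *\<^sub>R (z - p)))) (at t)"
          unfolding f_def by (rule has_derivative_compose[rotated]) (auto intro!: derivative_eq_intros)
        then show ?thesis unfolding has_field_derivative_def by (simp add: mult_commute_abs)
      qed
      obtain t where t: "0 < t" "t < 1" "f 1 - f 0 = (1 - 0) * (g (p + t *\<^sub>R (z - p)) \<bullet> (z - p))"
        using MVT2[of 0 1 f "\<lambda>t. g (p + t *\<^sub>R (z - p)) \<bullet> (z - p)"] der by auto
      define \<xi> where "\<xi> = p + t *\<^sub>R (z - p)"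
      have "\<xi> = (1 - t) *\<^sub>R p + t *\<^sub>R z" by (simp add: \<xi>_def algebra_simps)
      moreover have "p \<in> cball x (d / 3)" "z \<in> cball x (d / 3)" using z px by (auto simp: dist_commute)
      ultimately have "\<xi> \<in> cball x (d / 3)" using t convexD[OF convex_cball, of p x "d / 3" z "1 - t" t] by simp
      then have "dist \<xi> x \<le> d / 3" by (simp add: dist_commute)
      moreover have "dist (\<xi>, p) (x, x) \<le> dist \<xi> x + dist p x"
        unfolding dist_Pair_Pair by (rule sqrt_sum_squares_le_sum) auto
      ultimately have "dist (\<xi>, p) (x, x) < d" using px z d by linarith
      then have pos: "g \<xi> \<bullet> D\<rho> p > 0" using near by fastforce
      \<comment> \<open>Moving from p against g enters the domain, so z - p, an outer normal there, makes an acute angle with g.\<close>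
      define k where "k s = \<rho> (p + s *\<^sub>R (- g \<xi>))" for s
      have "(\<rho> has_derivative (\<lambda>v. D\<rho> p \<bullet> v)) (at (p + 0 *\<^sub>R (- g \<xi>)))"
        using C\<rho> by (auto simp: C2_space_def)
      then have "(k has_derivative (\<lambda>s. D\<rho> p \<bullet> (s *\<^sub>R (- g \<xi>)))) (at 0)"
        unfolding k_def by (rule has_derivative_compose[rotated]) (auto intro!: derivative_eq_intros)
      then have "(k has_real_derivative - (g \<xi> \<bullet> D\<rho> p)) (at 0)"
        unfolding has_field_derivative_def
        by (rule back_subst[of "\<lambda>f. (k has_derivative f) (at 0)"]) (auto simp: inner_commute)
      from DERIV_neg_dec_right[OF this] pos obtain \<delta> where "\<delta> > 0" "\<forall>s>0. s < \<delta> \<longrightarrow> k (0 + s) < k 0" by auto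
      then have "k (\<delta> / 2) < k 0" by auto
      moreover have "k 0 \<le> 0" using S(1) pS by (auto simp: k_def)
      ultimately have "p + (\<delta> / 2) *\<^sub>R (- g \<xi>) \<in> S"
        using closure_subset[of \<Omega>] by (auto simp: k_def \<Omega> S_def)
      from closest_point_dot[OF S(2) closed this, of z]
      have "(z - p) \<bullet> ((\<delta> / 2) *\<^sub>R (- g \<xi>)) \<le> 0" by (simp add: p_def)
      then have "g \<xi> \<bullet> (z - p) \<ge> 0" using \<open>\<delta> > 0\<close> by (simp add: inner_commute zero_le_mult_iff)
      then show ?thesis using t(3) by (simp add: f_def \<xi>_def p_def)
    qed
    then show ?thesis using d by (intro exI[of _ "d / 3"]) (auto simp: S_def)
  qed
qed

section \<open>Equicontinuity of the reduced scheme\<close>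

lemma nat_floor_diff:
  assumes "a \<ge> 0" "b \<ge> 0"
  shows "\<bar>real (nat \<lfloor>a\<rfloor>) - real (nat \<lfloor>b\<rfloor>)\<bar> \<le> \<bar>a - b\<bar> + 1"
proof -
  have "real (nat \<lfloor>a\<rfloor>) = of_int \<lfloor>a\<rfloor>" "real (nat \<lfloor>b\<rfloor>) = of_int \<lfloor>b\<rfloor>" using assms by auto
  moreover have "of_int \<lfloor>a\<rfloor> \<le> a" "a < of_int \<lfloor>a\<rfloor> + 1" "of_int \<lfloor>b\<rfloor> \<le> b" "b < of_int \<lfloor>b\<rfloor> + 1" by linarith+
  ultimately show ?thesis by arith
qed

locale affine_scheme = consistent_scheme +
  fixes dt :: "nat \<Rightarrow> real" and \<Omega> :: "(real^2) set" and \<rho> :: "real^2 \<Rightarrow> real" and D\<rho> :: "real^2 \<Rightarrow> real^2"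
  assumes dom: "C2_domain \<Omega> \<rho> D\<rho>"
    and KL_ge: "\<And>j. K j * sqrt (L j) \<ge> 1"
    and dts_pos: "\<And>j. dt j > 0"
    and cfl: "\<And>j. dt j * (K j / h j + 2 * L j / (R j)\<^sup>2) \<le> 1"
    and dt_lim: "dt \<longlonglongrightarrow> 0"
begin

abbreviation "S \<equiv> closure \<Omega>"
abbreviation "FR j \<equiv> FS j (K j / sqrt 2)"
abbreviation "W u0 j \<equiv> time_iter u0 (FR j) (dt j) S"
abbreviation "WS u0 j p \<equiv> disc_sol u0 (FR j) (dt j) S (fst p) (snd p)"

lemmas S_props = C2_domain_closure(2-)[OF dom]

lemma K_reduced_pos: "K j / sqrt 2 > 0" using KL_pos[of j] by simp

lemma step: "monotone_step (FR j) (dt j) S"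
proof -
  interpret stencil "h j" "n j" "nS j" "off j" by (rule st)
  show ?thesis
    by (unfold_locales;
        (rule S_props dts_pos step_mono KL_pos cfl FKL_shift FKL_translate FKL_uminus K_reduced_pos | simp)+)
qed

lemma WS_eq: "WS u0 j (x, t) = W u0 j (nat \<lfloor>t / dt j\<rfloor>) x"
  by (simp add: disc_sol_def)

lemma W_at_grid: "WS u0 j (x, real k * dt j) = W u0 j k x"
  using dts_pos[of j] by (simp add: disc_sol_def)

lemma barrier_bound: "\<exists>B>0. \<forall>\<^sub>F j in sequentially. \<forall>x\<in>S. \<forall>y\<in>S. FR j (\<lambda>z. c * (z \<bullet> z)) (y - x) \<le> B"
proof -
  define f where "f = (\<lambda>w. Fop ((2 * c) *\<^sub>R w) ((2 * c) *\<^sub>R mat 1))"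
  define C where "C = (\<lambda>(x, y). y - x) ` (S \<times> S)"
  have C: "compact C" unfolding C_def case_prod_beta
    using S_props by (intro compact_continuous_image compact_Times continuous_intros)
  have "continuous_on C f"
    unfolding f_def continuous_on_def by (intro ballI tendsto_Fop tendsto_intros)
  then have "bounded (f ` C)" using C compact_continuous_image compact_imp_bounded by blast
  then obtain B where B: "\<And>w. w \<in> C \<Longrightarrow> \<bar>f w\<bar> \<le> B" by (auto simp: bounded_iff)
  have "\<forall>\<^sub>F j in sequentially. \<forall>y\<in>C. \<bar>FR j (\<lambda>z. c * (z \<bullet> z)) y - f y\<bar> < 1"
    unfolding f_def using uniform_consistency[OF consistent_reduced C2_quad C, of 1 c] by simp
  then have "\<forall>\<^sub>F j in sequentially. \<forall>x\<in>S. \<forall>y\<in>S. FR j (\<lambda>z. c * (z \<bullet> z)) (y - x) \<le> \<bar>B\<bar> + 1"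
  proof eventually_elim
    case (elim j)
    show ?case
    proof (intro ballI)
      fix x y assume "x \<in> S" "y \<in> S"
      then have "y - x \<in> C" by (force simp: C_def)
      from elim[rule_format, OF this] B[OF this] show "FR j (\<lambda>z. c * (z \<bullet> z)) (y - x) \<le> \<bar>B\<bar> + 1" by linarith
    qed
  qed
  then show ?thesis by (intro exI[of _ "\<bar>B\<bar> + 1"]) auto
qed

context
  fixes u0 :: "real^2 \<Rightarrow> real"
  assumes u0_cont: "continuous_on S u0"
begin

lemma u0_bounded: obtains M where "M > 0" "\<And>x. x \<in> S \<Longrightarrow> \<bar>u0 x\<bar> \<le> M"
proof -
  have "bounded (u0 ` S)" using u0_cont S_props compact_continuous_image compact_imp_bounded by blast
  then obtain M where "\<And>x. x \<in> S \<Longrightarrow> \<bar>u0 x\<bar> \<le> M" by (auto simp: bounded_iff)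
  then show thesis by (intro that[of "\<bar>M\<bar> + 1"]) (force simp: abs_le_iff)+
qed

lemma u0_modulus:
  assumes "\<eta> > 0"
  obtains \<delta> where "\<delta> > 0" "\<And>x y. x \<in> S \<Longrightarrow> y \<in> S \<Longrightarrow> dist x y < \<delta> \<Longrightarrow> \<bar>u0 x - u0 y\<bar> < \<eta>"
  using compact_uniformly_continuous[OF u0_cont S_props(2)] assms
  unfolding uniformly_continuous_on_def dist_real_def by metis

lemma u0_quadratic_modulus:
  assumes "\<eta> > 0"
  obtains c where "c > 0" "\<And>x y. x \<in> S \<Longrightarrow> y \<in> S \<Longrightarrow> \<bar>u0 y - u0 x\<bar> \<le> \<eta> + c * ((y - x) \<bullet> (y - x))"
proof -
  obtain M where M: "M > 0" "\<And>x. x \<in> S \<Longrightarrow> \<bar>u0 x\<bar> \<le> M" using u0_bounded by blast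
  obtain \<delta> where \<delta>: "\<delta> > 0" "\<And>x y. x \<in> S \<Longrightarrow> y \<in> S \<Longrightarrow> dist x y < \<delta> \<Longrightarrow> \<bar>u0 x - u0 y\<bar> < \<eta>"
    using u0_modulus[OF assms] by blast
  show thesis
  \<comment> \<open>At distance \<delta> and beyond, this coefficient makes the quadratic term
    exceed the full oscillation 2 * M.\<close>
  proof (rule that[of "2 * M / \<delta>\<^sup>2"])
    show "2 * M / \<delta>\<^sup>2 > 0" using M \<delta> by simp
    fix x y assume xy: "x \<in> S" "y \<in> S"
    have q: "(y - x) \<bullet> (y - x) = (dist y x)\<^sup>2" by (simp add: dist_norm power2_norm_eq_inner)
    show "\<bar>u0 y - u0 x\<bar> \<le> \<eta> + 2 * M / \<delta>\<^sup>2 * ((y - x) \<bullet> (y - x))"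
    proof (cases "dist y x < \<delta>")
      case True
      then have "\<bar>u0 y - u0 x\<bar> \<le> \<eta>" using \<delta>(2)[OF xy(2,1)] by simp
      moreover have "2 * M / \<delta>\<^sup>2 * ((y - x) \<bullet> (y - x)) \<ge> 0" using M by simp
      ultimately show ?thesis by linarith
    next
      case False
      then have "\<delta>\<^sup>2 \<le> (dist y x)\<^sup>2" using \<delta> by (intro power_mono) auto
      then have "2 * M / \<delta>\<^sup>2 * \<delta>\<^sup>2 \<le> 2 * M / \<delta>\<^sup>2 * (dist y x)\<^sup>2" using M by (intro mult_left_mono) auto
      then have "2 * M \<le> 2 * M / \<delta>\<^sup>2 * (dist y x)\<^sup>2" using \<delta> by simp
      then show ?thesis using M(2)[OF xy(1)] M(2)[OF xy(2)] assms unfolding q by linarith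
    qed
  qed
qed

text \<open>Space costs e / 8 by \<open>iter_modulus\<close>. Time costs e / 8 from the quadratic
  modulus of the initial data, e / 8 for the elapsed time and e / 8 for rounding to the time
  grid.\<close>

lemma WS_equicontinuous:
  assumes e: "e > 0"
  shows "\<exists>d>0. \<forall>\<^sub>F j in sequentially. \<forall>p\<in>S \<times> {0..}. \<forall>q\<in>S \<times> {0..}. dist p q < d \<longrightarrow> \<bar>WS u0 j p - WS u0 j q\<bar> < e"
proof -
  have e8: "e / 8 > 0" using e by simp
  obtain \<delta> where \<delta>: "\<delta> > 0" "\<And>x y. x \<in> S \<Longrightarrow> y \<in> S \<Longrightarrow> dist x y < \<delta> \<Longrightarrow> \<bar>u0 x - u0 y\<bar> < e / 8"
    using u0_modulus[OF e8] by blast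
  obtain c where c: "c > 0" "\<And>x y. x \<in> S \<Longrightarrow> y \<in> S \<Longrightarrow> \<bar>u0 y - u0 x\<bar> \<le> e / 8 + c * ((y - x) \<bullet> (y - x))"
    using u0_quadratic_modulus[OF e8] by blast
  obtain B where B: "B > 0" "\<forall>\<^sub>F j in sequentially. \<forall>x\<in>S. \<forall>y\<in>S. FR j (\<lambda>z. c * (z \<bullet> z)) (y - x) \<le> B"
    using barrier_bound[of c] by blast
  define d where "d = min (\<delta> / 2) (e / (8 * B))"
  have d: "d > 0" "d < \<delta>" "d * B \<le> e / 8" using \<delta> e B by (auto simp: d_def min_def field_simps)
  have "\<forall>\<^sub>F j in sequentially. dt j < e / (8 * B)"
    using order_tendstoD(2)[OF dt_lim, of "e / (8 * B)"] e B by simp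
  with B(2) have "\<forall>\<^sub>F j in sequentially. \<forall>p\<in>S \<times> {0..}. \<forall>q\<in>S \<times> {0..}. dist p q < d \<longrightarrow> \<bar>WS u0 j p - WS u0 j q\<bar> < e"
  proof eventually_elim
    case (elim j)
    interpret monotone_step "FR j" "dt j" S by (rule step)
    have time: "\<bar>W u0 j k x - W u0 j m x\<bar> \<le> e / 8 + \<bar>real k - real m\<bar> * dt j * B" if x: "x \<in> S" for x k m
    proof -
      have *: "\<bar>W u0 j (k + m) x - W u0 j m x\<bar> \<le> e / 8 + real k * dt j * B" for k m
        using elim(1) c x by (intro iter_time[of c]) auto
      show ?thesis
      proof (cases "m \<le> k")
        case True
        then show ?thesis using *[of "k - m" m] by (simp add: of_nat_diff)
      next
        case False
        then show ?thesis using *[of "m - k" k] by (simp add: of_nat_diff abs_minus_commute)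
      qed
    qed
    have space: "\<bar>W u0 j k x - W u0 j k y\<bar> \<le> e / 8" if "x \<in> S" "y \<in> S" "dist x y \<le> d" for x y k
    proof -
      have m: "u0 x \<le> u0 y + e / 8" if "x \<in> S" "y \<in> S" "dist x y \<le> d" for x y
      proof -
        have "\<bar>u0 x - u0 y\<bar> < e / 8" using that d by (intro \<delta>(2)) auto
        then show ?thesis by arith
      qed
      have "W u0 j k x \<le> W u0 j k y + e / 8" "W u0 j k y \<le> W u0 j k x + e / 8"
        using that by (auto intro!: iter_modulus[OF m] simp: dist_commute)
      then show ?thesis by arith
    qed
    show ?case
    proof (intro ballI impI)
      fix p q :: "(real^2) \<times> real"
      assume pq: "p \<in> S \<times> {0..}" "q \<in> S \<times> {0..}" "dist p q < d"
      obtain x t y s where p: "p = (x, t)" and q: "q = (y, s)" by fastforce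
      have xy: "x \<in> S" "y \<in> S" "t \<ge> 0" "s \<ge> 0" using pq by (auto simp: p q)
      have dd: "dist x y < d" "\<bar>t - s\<bar> < d"
        using dist_fst_le[of p q] dist_snd_le[of p q] pq(3) by (auto simp: p q dist_real_def)
      define k m where "k = nat \<lfloor>t / dt j\<rfloor>" and "m = nat \<lfloor>s / dt j\<rfloor>"
      have "\<bar>real k - real m\<bar> \<le> \<bar>t / dt j - s / dt j\<bar> + 1"
        unfolding k_def m_def using xy dt_pos by (intro nat_floor_diff) auto
      then have "\<bar>real k - real m\<bar> * (dt j * B) \<le> (\<bar>t / dt j - s / dt j\<bar> + 1) * (dt j * B)"
        using dt_pos B by (intro mult_right_mono) auto
      also have "\<bar>t / dt j - s / dt j\<bar> = \<bar>t - s\<bar> / dt j"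
        using dt_pos by (simp flip: diff_divide_distrib)
      also have "(\<bar>t - s\<bar> / dt j + 1) * (dt j * B) = \<bar>t - s\<bar> * B + dt j * B"
        using dt_pos by (simp add: field_simps)
      also have "\<bar>t - s\<bar> * B \<le> d * B" using dd B by (intro mult_right_mono) auto
      also have "dt j * B \<le> e / (8 * B) * B" using elim(2) B by (intro mult_right_mono) auto
      also have "e / (8 * B) * B = e / 8" using B by simp
      finally have 1: "\<bar>real k - real m\<bar> * (dt j * B) \<le> e / 8 + e / 8" using d(3) by simp
      have "\<bar>W u0 j k x - W u0 j k y\<bar> \<le> e / 8" using space[OF xy(1,2)] dd by simp
      moreover have "\<bar>W u0 j k y - W u0 j m y\<bar> \<le> e / 8 + \<bar>real k - real m\<bar> * (dt j * B)"
        using time[OF xy(2)] by (simp add: mult.assoc)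
      ultimately have "\<bar>W u0 j k x - W u0 j m y\<bar> \<le> e / 2" using 1 by arith
      then show "\<bar>WS u0 j p - WS u0 j q\<bar> < e"
        using e unfolding p q WS_eq k_def[symmetric] m_def[symmetric] by simp
    qed
  qed
  with d(1) show ?thesis by blast
qed

end

end

section \<open>Limits of the reduced scheme\<close>

context affine_scheme
begin

text \<open>The time derivative of a test function is only continuous, so the test function is replaced near
  the contact point by its time slice at t0 plus terms in s - t0; the absolute value term is not
  differentiable, but the scheme only sees its increments, which are at most one time step.\<close>

lemma limit_subsolution_approx:
  assumes r: "strict_mono (r :: nat \<Rightarrow> nat)"
    and conv: "\<And>C e. compact C \<Longrightarrow> C \<subseteq> S \<times> {0..} \<Longrightarrow> e > 0 \<Longrightarrow>
      \<forall>\<^sub>F j in sequentially. \<forall>p\<in>C. \<bar>WS u0 (r j) p - v (fst p) (snd p)\<bar> < e"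
    and tf: "test_fn \<phi> G H T" and x0: "x0 \<in> S" and t0: "t0 > 0"
    and lmax: "loc_max_rel \<Omega> (\<lambda>y s. v y s - \<phi> y s) x0 t0"
    and out: "x0 \<in> \<Omega> \<or> G x0 t0 \<bullet> D\<rho> x0 > 0" and e: "e > 0"
  shows "T x0 t0 \<le> Fop (G x0 t0) (H x0 t0 + (2 * e) *\<^sub>R mat 1) + 5 * e"
proof -
  \<comment> \<open>The added paraboloid makes the contact strict in space; its Hessian is the extra
    term in the conclusion.\<close>
  define q where "q = (\<lambda>z. \<phi> z t0 + e * ((z - x0) \<bullet> (z - x0)))"
  define g where "g = (\<lambda>z. G z t0 + (2 * e) *\<^sub>R (z - x0))"
  define Hs where "Hs = (\<lambda>z. H z t0 + (2 * e) *\<^sub>R mat 1)"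
  define T0 where "T0 = T x0 t0"
  define m0 where "m0 = v x0 t0 - \<phi> x0 t0"
  define F0 where "F0 = Fop (g x0) (Hs x0)"
  have C2: "C2_space q g Hs"
    unfolding q_def g_def Hs_def by (rule C2_space_add_quadratic[OF test_fn_C2_space[OF tf]])
  obtain r1 where r1: "r1 > 0" "\<And>y s. y \<in> S \<Longrightarrow> s > 0 \<Longrightarrow> dist (y, s) (x0, t0) < r1 \<Longrightarrow> v y s - \<phi> y s \<le> m0"
    using lmax unfolding loc_max_rel_def m0_def by blast
  obtain r2 where r2: "r2 > 0" "\<And>y s. norm (y - x0) < r2 \<Longrightarrow> \<bar>s - t0\<bar> < r2 \<Longrightarrow>
      \<phi> y s \<le> \<phi> y t0 + T0 * (s - t0) + e * \<bar>s - t0\<bar>"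
    using test_fn_time_bound[OF tf e, of x0 t0] unfolding T0_def by blast
  have "g x0 = G x0 t0" by (simp add: g_def)
  then obtain r3 where r3: "r3 > 0" "\<And>z. dist z x0 \<le> r3 \<Longrightarrow> q (closest_point S z) \<le> q z"
    using projection_decreases[OF dom C2 x0] out by metis
  have "isCont (\<lambda>z. Fop (g z) (Hs z)) x0"
    using C2_space_continuous[OF C2] unfolding isCont_def
    by (intro tendsto_Fop) (auto simp: continuous_on_eq_continuous_at isCont_def)
  then obtain r4 where r4: "r4 > 0" "\<And>y. dist y x0 < r4 \<Longrightarrow> \<bar>Fop (g y) (Hs y) - F0\<bar> < e"
    using e unfolding continuous_at_eps_delta F0_def dist_real_def by metis
  define d where "d = min (min (r1 / 3) (r2 / 2)) (min (min r3 (r4 / 2)) (t0 / 2))"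
  have d: "d > 0" "2 * d < r1" "d < r2" "d \<le> r3" "d < r4" "d < t0"
    using r1(1) r2(1) r3(1) r4(1) t0 by (auto simp: d_def min_def)
  \<comment> \<open>Of the coefficient 2 * e, one e absorbs the error of the time expansion and the
    other makes the contact strict in time.\<close>
  define \<psi> where "\<psi> y s = q y + (T0 * (s - t0) + 2 * e * \<bar>s - t0\<bar>)" for y s
  have strict: "v y s - \<psi> y s \<le> m0 - e * ((dist y x0)\<^sup>2 + \<bar>s - t0\<bar>)"
    if y: "y \<in> S" "dist y x0 \<le> d" "\<bar>s - t0\<bar> \<le> d" for y s
  proof -
    have "dist (y, s) (x0, t0) \<le> dist y x0 + \<bar>s - t0\<bar>"
      using sqrt_sum_squares_le_sum[of "dist y x0" "dist s t0"] by (simp add: dist_Pair_Pair dist_real_def)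
    then have "v y s - \<phi> y s \<le> m0" using y d by (intro r1(2)) auto
    moreover have "\<phi> y s \<le> \<phi> y t0 + T0 * (s - t0) + e * \<bar>s - t0\<bar>"
      using y d by (intro r2(2)) (auto simp: dist_norm)
    moreover have "q y = \<phi> y t0 + e * (dist y x0)\<^sup>2"
      by (simp add: q_def dist_norm power2_norm_eq_inner)
    ultimately show ?thesis by (simp add: \<psi>_def algebra_simps)
  qed
  \<comment> \<open>A deficit below \<beta> in \<open>strict\<close> confines a point to within d /
    2 of the contact point in space and in time. It is spent as \<beta> / 3 + \<beta> / 2 + \<beta>
    / 6 below.\<close>
  define \<beta> where "\<beta> = e * min ((d / 2)\<^sup>2) (d / 2)"
  have \<beta>: "\<beta> > 0" using e d by (simp add: \<beta>_def)
  define Z where "Z = (S \<inter> cball x0 d) \<times> {t0 - d..t0 + d}"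
  have Z: "compact Z" "Z \<subseteq> S \<times> {0..}"
    unfolding Z_def using S_props d(6) by (auto intro!: compact_Times compact_Int_closed)
  have "\<forall>\<^sub>F j in sequentially. \<forall>p\<in>Z. \<bar>WS u0 (r j) p - v (fst p) (snd p)\<bar> < \<beta> / 3"
    using \<beta> by (intro conv Z) auto
  moreover have "\<forall>\<^sub>F j in sequentially. \<forall>y\<in>cball x0 d. \<bar>FR (r j) q y - Fop (g y) (Hs y)\<bar> < e"
    using eventually_subseq[OF r uniform_consistency[OF consistent_reduced C2 compact_cball e]] .
  moreover have "\<forall>\<^sub>F j in sequentially. R (r j) < d / 6"
    by (rule eventually_subseq[OF r order_tendstoD(2)[OF width_lim]]) (use d in simp)
  moreover have "\<forall>\<^sub>F j in sequentially. dt (r j) < d / 2"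
    by (rule eventually_subseq[OF r order_tendstoD(2)[OF dt_lim]]) (use d in simp)
  moreover have "\<forall>\<^sub>F j in sequentially. dt (r j) < \<beta> / 6 / (\<bar>T0\<bar> + 2 * e)"
    by (rule eventually_subseq[OF r order_tendstoD(2)[OF dt_lim]]) (use e \<beta> in simp)
  moreover have "\<forall>\<^sub>F j in sequentially. dt (r j) < \<beta> / 6 / e"
    by (rule eventually_subseq[OF r order_tendstoD(2)[OF dt_lim]]) (use e \<beta> in simp)
  ultimately have "\<forall>\<^sub>F j in sequentially. T0 \<le> F0 + 5 * e"
  proof eventually_elim
    case (elim j)
    define \<tau> where "\<tau> = dt (r j)"
    define w where "w = W u0 (r j)"
    have \<tau>: "\<tau> > 0" "\<tau> < d / 2" "(\<bar>T0\<bar> + 2 * e) * \<tau> \<le> \<beta> / 6" "e * \<tau> \<le> \<beta> / 6"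
      using elim(4-6) e dts_pos[of "r j"] by (simp_all add: \<tau>_def pos_less_divide_eq algebra_simps)
    interpret monotone_step "FR (r j)" "dt (r j)" S by (rule step)
    define A where "A = {(y, k). y \<in> S \<and> dist y x0 \<le> d \<and> \<bar>real k * \<tau> - t0\<bar> \<le> d}"
    define f where "f = (\<lambda>(y, k). w k y - \<psi> y (real k * \<tau>))"
    have f_le: "f (y, k) \<le> m0 - e * ((dist y x0)\<^sup>2 + \<bar>real k * \<tau> - t0\<bar>) + \<beta> / 3" if "(y, k) \<in> A" for y k
    proof -
      have A: "y \<in> S" "dist y x0 \<le> d" "\<bar>real k * \<tau> - t0\<bar> \<le> d" using that by (auto simp: A_def)
      then have "(y, real k * \<tau>) \<in> Z" by (auto simp: Z_def dist_commute abs_le_iff)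
      from elim(1)[rule_format, OF this] have "\<bar>w k y - v y (real k * \<tau>)\<bar> < \<beta> / 3"
        unfolding \<tau>_def W_at_grid by (simp add: w_def)
      then have "w k y \<le> v y (real k * \<tau>) + \<beta> / 3" by arith
      then show ?thesis using strict[OF A] unfolding f_def by simp
    qed
    have "f p \<le> m0 + \<beta> / 3" if "p \<in> A" for p
    proof (cases p)
      case (Pair y k)
      have "e * ((dist y x0)\<^sup>2 + \<bar>real k * \<tau> - t0\<bar>) \<ge> 0" using e by simp
      then show ?thesis using f_le[of y k] that Pair by simp
    qed
    then have bdd: "bdd_above (f ` A)" by (intro bdd_aboveI2)
    define M where "M = Sup (f ` A)"
    have f_M: "f p \<le> M" if "p \<in> A" for p unfolding M_def using bdd that by (intro cSup_upper) auto
    have floor: "\<bar>real (nat \<lfloor>t0 / \<tau>\<rfloor>) * \<tau> - t0\<bar> \<le> \<tau>"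
    proof -
      have "real (nat \<lfloor>t0 / \<tau>\<rfloor>) = of_int \<lfloor>t0 / \<tau>\<rfloor>" using t0 \<tau> by simp
      moreover have "of_int \<lfloor>t0 / \<tau>\<rfloor> * \<tau> \<le> t0"
        using of_int_floor_le[of "t0 / \<tau>"] unfolding pos_le_divide_eq[OF \<tau>(1)] .
      moreover have "t0 < (of_int \<lfloor>t0 / \<tau>\<rfloor> + 1) * \<tau>"
        using real_of_int_floor_add_one_gt[of "t0 / \<tau>"] unfolding pos_divide_less_eq[OF \<tau>(1)] .
      ultimately show ?thesis by (simp add: abs_le_iff distrib_right)
    qed
    define k0 where "k0 = nat \<lfloor>t0 / \<tau>\<rfloor>"
    have A0: "(x0, k0) \<in> A" using floor \<tau> d x0 by (auto simp: A_def k0_def)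
    have "M \<ge> m0 - \<beta> / 2"
    proof -
      have "(x0, t0) \<in> Z" using x0 d by (auto simp: Z_def)
      from elim(1)[rule_format, OF this] have "\<bar>w k0 x0 - v x0 t0\<bar> < \<beta> / 3"
        unfolding WS_eq by (simp add: w_def k0_def \<tau>_def)
      then have 1: "v x0 t0 - \<beta> / 3 < w k0 x0" by arith
      have "T0 * (real k0 * \<tau> - t0) \<le> \<bar>T0\<bar> * \<bar>real k0 * \<tau> - t0\<bar>" by (metis abs_ge_self abs_mult)
      then have "T0 * (real k0 * \<tau> - t0) + 2 * e * \<bar>real k0 * \<tau> - t0\<bar> \<le> (\<bar>T0\<bar> + 2 * e) * \<bar>real k0 * \<tau> - t0\<bar>"
        by (simp add: algebra_simps)
      also have "\<dots> \<le> (\<bar>T0\<bar> + 2 * e) * \<tau>" using floor e by (intro mult_left_mono) (auto simp: k0_def)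
      finally have "\<psi> x0 (real k0 * \<tau>) \<le> \<phi> x0 t0 + \<beta> / 6" using \<tau>(3) by (simp add: \<psi>_def q_def)
      then have "m0 - \<beta> / 2 \<le> f (x0, k0)" using 1 by (simp add: f_def m0_def)
      then show ?thesis using f_M[OF A0] by linarith
    qed
    \<comment> \<open>An approximate maximiser suffices: its error e * \<tau> costs a single e after
      division by the time step.\<close>
    obtain y k where yk: "(y, k) \<in> A" "f (y, k) > M - e * \<tau>"
    proof -
      have "f ` A \<noteq> {}" using A0 by blast
      moreover have "M - e * \<tau> < Sup (f ` A)" using e \<tau> by (simp add: M_def)
      ultimately obtain z where "z \<in> f ` A" "M - e * \<tau> < z" using less_cSupD[of "f ` A" "M - e * \<tau>"] by blast
      then obtain p where "p \<in> A" "M - e * \<tau> < f p" by blast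
      then show thesis using that[of "fst p" "snd p"] by simp
    qed
    have A: "y \<in> S" "dist y x0 \<le> d" "\<bar>real k * \<tau> - t0\<bar> \<le> d" using yk(1) by (auto simp: A_def)
    have "e * ((dist y x0)\<^sup>2 + \<bar>real k * \<tau> - t0\<bar>) < \<beta>"
    proof -
      have "M - e * \<tau> < m0 - e * ((dist y x0)\<^sup>2 + \<bar>real k * \<tau> - t0\<bar>) + \<beta> / 3"
        using yk(2) f_le[OF yk(1)] by (rule less_le_trans)
      then show ?thesis using \<open>M \<ge> m0 - \<beta> / 2\<close> \<tau>(4) by linarith
    qed
    then have small: "(dist y x0)\<^sup>2 + \<bar>real k * \<tau> - t0\<bar> < min ((d / 2)\<^sup>2) (d / 2)"
      using e by (simp add: \<beta>_def)
    then have "(dist y x0)\<^sup>2 < (d / 2)\<^sup>2" by (auto intro: le_less_trans[rotated])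
    then have y_near: "dist y x0 < d / 2" by (rule power2_less_imp_less) (use d in simp)
    have k_near: "\<bar>real k * \<tau> - t0\<bar> < d / 2" using small by (auto intro: le_less_trans[rotated])
    have "k \<noteq> 0" using k_near d by (cases k) auto
    then obtain k' where k: "k = Suc k'" using not0_implies_Suc by blast
    have kk: "real k * \<tau> = real k' * \<tau> + \<tau>" by (simp add: k algebra_simps)
    have k'_near: "\<bar>real k' * \<tau> - t0\<bar> \<le> d"
      using k_near \<tau>(1,2) unfolding kk by arith
    \<comment> \<open>The part of \<open>\<psi>\<close> independent of space at the previous time
      level, plus M: then q + c lies above the projected previous iterate on the whole stencil of
      y.\<close>
    define c where "c = T0 * (real k' * \<tau> - t0) + 2 * e * \<bar>real k' * \<tau> - t0\<bar> + M"
    interpret st: stencil "h (r j)" "n (r j)" "nS (r j)" "off (r j)" by (rule st)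
    have "w k' (pr y) + \<tau> * FR (r j) (\<lambda>z. w k' (pr z)) y \<le> (q y + c) + \<tau> * FR (r j) (\<lambda>z. q z + c) y"
      unfolding \<tau>_def
    proof (rule st.step_mono[OF KL_pos dts_pos cfl])
      fix z assume "dist z y \<le> 3 * R (r j)"
      then have zx: "dist z x0 \<le> d" using y_near elim(3) dist_triangle[of z x0 y] by linarith
      have "(pr z, k') \<in> A"
        using pr_in[of z] pr_dist_le[OF x0, of z] zx k'_near by (simp add: A_def)
      from f_M[OF this] have "w k' (pr z) \<le> q (pr z) + c" by (simp add: f_def \<psi>_def c_def)
      also have "q (pr z) \<le> q z" using zx d by (intro r3(2)) simp
      finally show "w k' (pr z) \<le> q z + c" by simp
    qed
    then have "w k y \<le> q y + c + \<tau> * FR (r j) q y"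
      using A(1) by (simp add: k w_def \<tau>_def pr_self st.FKL_shift K_reduced_pos)
    moreover have "\<psi> y (real k * \<tau>) + M - e * \<tau> < w k y" using yk(2) by (simp add: f_def)
    moreover have "\<psi> y (real k * \<tau>) + M - (q y + c) \<ge> (T0 - 2 * e) * \<tau>"
    proof -
      have "2 * e * (\<bar>real k' * \<tau> - t0\<bar> - \<bar>real k * \<tau> - t0\<bar>) \<le> 2 * e * \<tau>"
        using e \<tau>(1) unfolding kk by (intro mult_left_mono) auto
      moreover have "\<psi> y (real k * \<tau>) + M - (q y + c)
          = T0 * \<tau> - 2 * e * (\<bar>real k' * \<tau> - t0\<bar> - \<bar>real k * \<tau> - t0\<bar>)"
        unfolding \<psi>_def c_def kk by (simp add: algebra_simps)
      ultimately show ?thesis by (simp add: algebra_simps)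
    qed
    \<comment> \<open>Here 2 * e stems from the absolute value term over one time step and e from
      the approximate maximum; consistency and continuity of F add one e each, for a total of 5 *
      e.\<close>
    ultimately have "(T0 - 3 * e) * \<tau> < FR (r j) q y * \<tau>" by (simp add: algebra_simps)
    then have "T0 - 3 * e < FR (r j) q y" using \<tau>(1) by simp
    moreover have "\<bar>FR (r j) q y - Fop (g y) (Hs y)\<bar> < e" using elim(2) A(2) by (simp add: dist_commute)
    moreover have "\<bar>Fop (g y) (Hs y) - F0\<bar> < e" using A(2) d by (intro r4(2)) simp
    ultimately show ?case by linarith
  qed
  then have "T0 \<le> F0 + 5 * e" by simp
  then show ?thesis by (simp add: T0_def F0_def g_def Hs_def)
qed

lemma limit_subsolution:
  assumes "strict_mono (r :: nat \<Rightarrow> nat)"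
    and "\<And>C e. compact C \<Longrightarrow> C \<subseteq> S \<times> {0..} \<Longrightarrow> e > 0 \<Longrightarrow>
      \<forall>\<^sub>F j in sequentially. \<forall>p\<in>C. \<bar>WS u0 (r j) p - v (fst p) (snd p)\<bar> < e"
    and "test_fn \<phi> G H T" and "x0 \<in> S" and "t0 > 0"
    and "loc_max_rel \<Omega> (\<lambda>y s. v y s - \<phi> y s) x0 t0"
    and "x0 \<in> \<Omega> \<or> G x0 t0 \<bullet> D\<rho> x0 > 0"
  shows "T x0 t0 \<le> Fop (G x0 t0) (H x0 t0)"
proof (rule tendsto_lowerbound[where F = "at_right (0::real)"])
  have "((\<lambda>e. Fop (G x0 t0) (H x0 t0 + (2 * e) *\<^sub>R mat 1) + 5 * e) \<longlongrightarrow>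
      Fop (G x0 t0) (H x0 t0 + (2 * 0) *\<^sub>R mat 1) + 5 * 0) (at_right 0)"
    by (intro tendsto_Fop tendsto_intros)
  then show "((\<lambda>e. Fop (G x0 t0) (H x0 t0 + (2 * e) *\<^sub>R mat 1) + 5 * e) \<longlongrightarrow> Fop (G x0 t0) (H x0 t0)) (at_right 0)"
    by simp
  show "\<forall>\<^sub>F e in at_right 0. T x0 t0 \<le> Fop (G x0 t0) (H x0 t0 + (2 * e) *\<^sub>R mat 1) + 5 * e"
    unfolding eventually_at_right_field by (intro exI[of _ 1]) (auto intro!: limit_subsolution_approx[OF assms])
qed simp

text \<open>At a boundary point where the normal derivative of the test function already has the
  right sign there is nothing to show; otherwise \<open>limit_subsolution\<close> applies. The
  supersolution part follows by oddness of F and of the scheme, applied to -v and the initial data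
  -u0.\<close>

lemma limit_visc_sol:
  assumes r: "strict_mono (r :: nat \<Rightarrow> nat)" and vc: "continuous_on (S \<times> {0..}) (\<lambda>p. v (fst p) (snd p))"
    and conv: "\<And>C e. compact C \<Longrightarrow> C \<subseteq> S \<times> {0..} \<Longrightarrow> e > 0 \<Longrightarrow>
      \<forall>\<^sub>F j in sequentially. \<forall>p\<in>C. \<bar>WS u0 (r j) p - v (fst p) (snd p)\<bar> < e"
  shows "visc_sol \<Omega> D\<rho> u0 v"
  unfolding visc_sol_def
proof (intro conjI allI impI ballI)
  show "continuous_on (S \<times> {0..}) (\<lambda>(x, t). v x t)" using vc by (simp add: case_prod_beta)
next
  fix x assume x: "x \<in> S"
  have "\<bar>u0 x - v x 0\<bar> < e" if "e > 0" for e
  proof -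
    have "\<forall>\<^sub>F j in sequentially. \<forall>p\<in>{(x, 0)}. \<bar>WS u0 (r j) p - v (fst p) (snd p)\<bar> < e"
      using x that by (intro conv) auto
    then show ?thesis by (simp add: disc_sol_def)
  qed
  from this[of "\<bar>u0 x - v x 0\<bar>"] show "v x 0 = u0 x" by fastforce
next
  fix \<phi> G H T x t
  assume tf: "test_fn \<phi> G H T" and x: "x \<in> S" and t: "t > 0" and mx: "loc_max_rel \<Omega> (\<lambda>y s. v y s - \<phi> y s) x t"
  have *: "T x t \<le> Fop (G x t) (H x t)" if "x \<in> \<Omega> \<or> G x t \<bullet> D\<rho> x > 0"
    by (rule limit_subsolution[OF r conv tf x t mx that])
  then show "x \<in> \<Omega> \<Longrightarrow> T x t - Fop (G x t) (H x t) \<le> 0" by simp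
  show "min (T x t - Fop (G x t) (H x t)) (G x t \<bullet> outer_normal D\<rho> x) \<le> 0" 
  proof (cases "G x t \<bullet> D\<rho> x > 0")
    case False
    then have "G x t \<bullet> outer_normal D\<rho> x \<le> 0" by (simp add: outer_normal_def mult_nonneg_nonpos)
    then show ?thesis by simp
  qed (use * in simp)
next
  fix \<phi> G H T x t
  assume tf: "test_fn \<phi> G H T" and x: "x \<in> S" and t: "t > 0" and mn: "loc_min_rel \<Omega> (\<lambda>y s. v y s - \<phi> y s) x t"
  have uminus: "WS (\<lambda>x. - u0 x) j p = - WS u0 j p" for j p
    by (simp add: disc_sol_def monotone_step.iter_uminus[OF step])
  have conv': "\<forall>\<^sub>F j in sequentially. \<forall>p\<in>C. \<bar>WS (\<lambda>x. - u0 x) (r j) p - (- v (fst p) (snd p))\<bar> < e"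
    if "compact C" "C \<subseteq> S \<times> {0..}" "e > 0" for C e
  proof -
    have "\<bar>- a - (- b)\<bar> = \<bar>a - b\<bar>" for a b :: real by simp
    then show ?thesis unfolding uminus using conv[OF that] by simp
  qed
  have mx: "loc_max_rel \<Omega> (\<lambda>y s. - v y s - (- \<phi> y s)) x t"
    using mn unfolding loc_max_rel_def loc_min_rel_def by (simp add: le_diff_eq algebra_simps)
  have *: "T x t \<ge> Fop (G x t) (H x t)" if "x \<in> \<Omega> \<or> (- G x t) \<bullet> D\<rho> x > 0"
    using limit_subsolution[OF r conv' test_fn_uminus[OF tf] x t mx that] by (simp add: Fop_uminus)
  then show "x \<in> \<Omega> \<Longrightarrow> T x t - Fop (G x t) (H x t) \<ge> 0" by simp
  show "max (T x t - Fop (G x t) (H x t)) (G x t \<bullet> outer_normal D\<rho> x) \<ge> 0" 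
  proof (cases "G x t \<bullet> D\<rho> x < 0")
    case False
    then have "G x t \<bullet> outer_normal D\<rho> x \<ge> 0" by (simp add: outer_normal_def)
    then show ?thesis by simp
  qed (use * in simp)
qed

lemma reduced_scheme_converges:
  assumes u0: "continuous_on S u0"
    and uniq: "\<And>v. visc_sol \<Omega> D\<rho> u0 v \<Longrightarrow> \<forall>x\<in>S. \<forall>t\<ge>0. v x t = u x t"
    and C: "compact C" "C \<subseteq> S \<times> {0..}" and e: "e > 0"
  shows "\<forall>\<^sub>F j in sequentially. \<forall>(x, t)\<in>C. \<bar>disc_sol u0 (FR j) (dt j) S x t - u x t\<bar> < e"
proof (rule ccontr)
  define bad where "bad = {j. \<exists>p\<in>C. \<not> \<bar>WS u0 j p - u (fst p) (snd p)\<bar> < e}"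
  assume "\<not> ?thesis"
  then have "infinite bad"
    unfolding infinite_nat_iff_unbounded_le bad_def eventually_sequentially by (auto simp: case_prod_beta)
  define r0 where "r0 = enumerate bad"
  have r0: "strict_mono r0" "\<And>n. r0 n \<in> bad"
    using \<open>infinite bad\<close> by (auto simp: r0_def strict_mono_enumerate enumerate_in_set)
  obtain M where M: "\<And>x. x \<in> S \<Longrightarrow> \<bar>u0 x\<bar> \<le> M" using u0_bounded[OF u0] by blast
  have bdd: "\<bar>WS u0 (r0 j) p\<bar> \<le> M" if "p \<in> S \<times> {0..}" for j p
    using that monotone_step.iter_bound[OF step M] by (auto simp: disc_sol_def)
  have equi: "\<exists>d>0. \<forall>\<^sub>F j in sequentially. \<forall>p\<in>S \<times> {0..}. \<forall>q\<in>S \<times> {0..}. dist p q < d \<longrightarrow>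
      \<bar>WS u0 (r0 j) p - WS u0 (r0 j) q\<bar> < e" if "e > 0" for e
    using WS_equicontinuous[OF u0 that] eventually_subseq[OF r0(1)] by blast
  obtain r1 v where r1: "strict_mono (r1 :: nat \<Rightarrow> nat)" and v: "continuous_on (S \<times> {0..}) v"
    and conv: "\<And>C e. compact C \<Longrightarrow> C \<subseteq> S \<times> {0..} \<Longrightarrow> e > 0 \<Longrightarrow>
      \<forall>\<^sub>F j in sequentially. \<forall>p\<in>C. \<bar>WS u0 (r0 (r1 j)) p - v p\<bar> < e"
    using asymptotic_Arzela_Ascoli[of "S \<times> {0..}" "\<lambda>j. WS u0 (r0 j)" M, OF bdd equi] by blast
  define r where "r = r0 \<circ> r1"
  have r: "strict_mono r" unfolding r_def by (rule strict_mono_o[OF r0(1) r1])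
  have "visc_sol \<Omega> D\<rho> u0 (\<lambda>x t. v (x, t))"
    using conv by (intro limit_visc_sol[OF r]) (simp_all add: r_def v)
  from uniq[OF this] have eq: "v p = u (fst p) (snd p)" if "p \<in> S \<times> {0..}" for p using that by auto
  from conv[OF C e] obtain j where j: "\<forall>p\<in>C. \<bar>WS u0 (r0 (r1 j)) p - v p\<bar> < e"
    by (auto simp: eventually_sequentially)
  from r0(2)[of "r1 j"] obtain p where "p \<in> C" "\<not> \<bar>WS u0 (r0 (r1 j)) p - u (fst p) (snd p)\<bar> < e"
    by (auto simp: bad_def)
  then show False using j eq C(2) by (metis subsetD)
qed

text \<open>This ensures that the minimum in the inf-convolution below is attained.\<close>

lemma W_continuous:
  assumes "continuous_on S u0"
  shows "continuous_on S (W u0 j k)"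
  unfolding continuous_on_iff
proof (intro ballI allI impI)
  interpret monotone_step "FR j" "dt j" S by (rule step)
  fix x e assume x: "x \<in> S" and e: "(e::real) > 0"
  obtain d where d: "d > 0" "\<And>x y. x \<in> S \<Longrightarrow> y \<in> S \<Longrightarrow> dist x y < d \<Longrightarrow> \<bar>u0 x - u0 y\<bar> < e / 2"
    using u0_modulus[OF assms, of "e / 2"] e by auto
  have m: "u0 x \<le> u0 y + e / 2" if "x \<in> S" "y \<in> S" "dist x y \<le> d / 2" for x y
  proof -
    have "\<bar>u0 x - u0 y\<bar> < e / 2" using that d by (intro d(2)) auto
    then show ?thesis by arith
  qed
  have "dist (W u0 j k y) (W u0 j k x) < e" if y: "y \<in> S" "dist y x < d / 2" for y
  proof -
    have "W u0 j k x \<le> W u0 j k y + e / 2" "W u0 j k y \<le> W u0 j k x + e / 2"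
      using x y by (auto intro!: iter_modulus[OF m] simp: dist_commute)
    then show ?thesis using e by (simp add: dist_real_def)
  qed
  then show "\<exists>d>0. \<forall>y\<in>S. dist y x < d \<longrightarrow> dist (W u0 j k y) (W u0 j k x) < e"
    using d(1) by (intro exI[of _ "d / 2"]) auto
qed

section \<open>Comparison with the reduced scheme\<close>

text \<open>The inf-convolution of the reduced (monotone) iterates is again a supersolution of the reduced
  scheme, and it is semiconcave. Semiconcavity bounds its discrete curvature by a constant
  independent of the grid, which makes the monotonicity defect of the original scheme harmless.\<close>

lemma perturbed_scheme_le:
  assumes u0: "continuous_on S u0"
    and Op: "\<And>j w x. Op j w x \<le> FS j (K j) w x + \<kappa> j" and \<kappa>: "\<kappa> \<longlonglongrightarrow> 0" "\<And>j. \<kappa> j \<ge> 0"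
    and e: "e > 0" and Tm: "Tm > 0"
  shows "\<forall>\<^sub>F j in sequentially. \<forall>x\<in>S. \<forall>k. real k * dt j \<le> Tm \<longrightarrow>
    time_iter u0 (Op j) (dt j) S k x \<le> W u0 j k x + e"
proof -
  \<comment> \<open>The weight c of the inf-convolution is fixed before j: it keeps the initial
    inf-convolution within e / 2 below u0.\<close>
  obtain c where c: "c > 0" "\<And>x y. x \<in> S \<Longrightarrow> y \<in> S \<Longrightarrow> \<bar>u0 y - u0 x\<bar> \<le> e / 2 + c * ((y - x) \<bullet> (y - x))"
    using u0_quadratic_modulus[OF u0, of "e / 2"] e by auto
  obtain D where D: "\<And>x. x \<in> S \<Longrightarrow> norm x \<le> D" 
    using S_props(2) compact_imp_bounded bounded_iff by metis
  \<comment> \<open>Differences of points of S have norm at most 2 * |D|, so this is c times the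
    bound from \<open>DS_quad_bound\<close>.\<close>
  define Q where "Q = c * (108 * (2 * \<bar>D\<bar>) + 18)"
  have Q: "Q > 0" using c by (simp add: Q_def)
  have "(\<lambda>j. 2 / (K j)\<^sup>2 * Q + \<kappa> j) \<longlonglongrightarrow> 0 * Q + 0"
    by (intro tendsto_intros \<kappa>(1) tendsto_divide_0[OF tendsto_const] filterlim_at_top_imp_at_infinity
        filterlim_pow_at_top K_at_top) simp
  then have "\<forall>\<^sub>F j in sequentially. 2 / (K j)\<^sup>2 * Q + \<kappa> j < e / (2 * Tm)"
    using order_tendstoD(2)[of _ 0 sequentially "e / (2 * Tm)"] e Tm by simp
  then show ?thesis using DS_quad_bound
  proof eventually_elim
    case (elim j)
    define err where "err = 2 / (K j)\<^sup>2 * Q + \<kappa> j"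
    have err0: "err \<ge> 0" using Q \<kappa>(2)[of j] by (simp add: err_def)
    interpret monotone_step "FR j" "dt j" S by (rule step)
    interpret st: stencil "h j" "n j" "nS j" "off j" by (rule st)
    define f where "f k x y = W u0 j k y + c * ((x - y) \<bullet> (x - y))" for k x y
    have "\<exists>y\<in>S. \<forall>y'\<in>S. f k x y \<le> f k x y'" for k x
      unfolding f_def
      by (intro continuous_attains_inf S_props continuous_intros W_continuous[OF u0])
    then obtain Y where Y: "\<And>k x. Y k x \<in> S" "\<And>k x y. y \<in> S \<Longrightarrow> f k x (Y k x) \<le> f k x y" by metis
    define v where "v k x = f k x (Y k x)" for k x
    have v_le: "v k x \<le> W u0 j k y + c * ((x - y) \<bullet> (x - y))" if "y \<in> S" for k x y
      using Y(2)[OF that, of k x] by (simp add: v_def f_def)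
    have quad_mono: "c * (a \<bullet> a) \<le> c * (b \<bullet> b)" if "norm a \<le> norm b" for a b :: "real^2"
      using that c by (intro mult_left_mono) (auto simp: norm_le)
    have super: "v k (pr x) + dt j * FR j (\<lambda>z. v k (pr z)) x \<le> v (Suc k) x" if x: "x \<in> S" for k x
    proof -
      define y where "y = Y (Suc k) x"
      \<comment> \<open>Translation by s carries x to its optimal point y for the next time level.
        The penalty c * (s \<bullet> s) is then a constant, and the projection, being nonexpansive,
        does not raise the penalty between the shifted points.\<close>
      define s where "s = y - x"
      have "v k (pr x) + dt j * FR j (\<lambda>z. v k (pr z)) x
        \<le> (W u0 j k (pr (x + s)) + c * (s \<bullet> s)) + dt j * FR j (\<lambda>z. W u0 j k (pr (z + s)) + c * (s \<bullet> s)) x"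
      proof (rule mono)
        fix z
        have "dist (pr z) (pr (z + s)) \<le> dist z (z + s)" by (rule pr_lipschitz)
        then have "c * ((pr z - pr (z + s)) \<bullet> (pr z - pr (z + s))) \<le> c * (s \<bullet> s)"
          by (intro quad_mono) (simp add: dist_norm)
        then show "v k (pr z) \<le> W u0 j k (pr (z + s)) + c * (s \<bullet> s)"
          using v_le[OF pr_in[of "z + s"], of k "pr z"] by linarith
      qed
      also have "FR j (\<lambda>z. W u0 j k (pr (z + s)) + c * (s \<bullet> s)) x = FR j (\<lambda>z. W u0 j k (pr z)) y"
        using translate[of "\<lambda>z. W u0 j k (pr z)" s x] by (simp add: shift s_def)
      also have "W u0 j k (pr (x + s)) + c * (s \<bullet> s) + dt j * FR j (\<lambda>z. W u0 j k (pr z)) y = v (Suc k) x"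
        using pr_self[OF Y(1)[of "Suc k" x]]
        by (simp add: v_def f_def y_def s_def inner_diff_left inner_diff_right inner_commute)
      finally show ?thesis .
    qed
    have curv: "DS j (\<lambda>z. v k (pr z)) x \<le> Q" if x: "x \<in> S" for k x
    proof -
      \<comment> \<open>The paraboloid centred at the optimal point y touches the inf-convolution
        from above at x, so its discrete curvature is an upper bound.\<close>
      define y where "y = Y k x"
      have y: "y \<in> S" using Y by (simp add: y_def)
      have "DS j (\<lambda>z. v k (pr z)) x \<le> DS j (\<lambda>z. c * ((z + (- y)) \<bullet> (z + (- y))) + W u0 j k y) x"
      proof (rule st.D1_mono)
        fix z
        have "c * ((pr z - y) \<bullet> (pr z - y)) \<le> c * ((z - y) \<bullet> (z - y))"
          using pr_dist_le[OF y, of z] by (intro quad_mono) (simp add: dist_norm)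
        then show "v k (pr z) \<le> c * ((z + (- y)) \<bullet> (z + (- y))) + W u0 j k y"
          using v_le[OF y, of k "pr z"] by simp
        show "v k (pr x) = c * ((x + (- y)) \<bullet> (x + (- y))) + W u0 j k y"
          using x by (simp add: pr_self v_def f_def y_def)
      qed
      also have "\<dots> = c * DS j (\<lambda>z. (z + (- y)) \<bullet> (z + (- y))) x"
        using c st.D1_scale_shift[of c "\<lambda>z. (z + (- y)) \<bullet> (z + (- y))"] by simp
      also have "DS j (\<lambda>z. (z + (- y)) \<bullet> (z + (- y))) x = DS j (\<lambda>z. z \<bullet> z) (x + (- y))"
        by (rule st.D1_translate)
      also have "c * \<dots> \<le> Q"
      proof -
        have "norm (x + (- y)) \<le> 2 * \<bar>D\<bar>"
          using norm_triangle_ineq4[of x y] D[OF x] D[OF y] by simp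
        then have "DS j (\<lambda>z. z \<bullet> z) (x + (- y)) \<le> 108 * (2 * \<bar>D\<bar>) + 18"
          using elim(2)[rule_format, of "x + (- y)"] by linarith
        then show ?thesis unfolding Q_def using c by (intro mult_left_mono) auto
      qed
      finally show ?thesis .
    qed
    \<comment> \<open>The initial gap is e / 2; every step adds dt times the monotonicity defect, at
      most 2 / K^2 * Q, and the perturbation \<open>\<kappa>\<close>.\<close>
    have main: "time_iter u0 (Op j) (dt j) S k x \<le> v k x + (e / 2 + real k * dt j * err)" if "x \<in> S" for k x
      using that
    proof (induction k arbitrary: x)
      case 0
      have "Y 0 x \<in> S" by (rule Y)
      from c(2)[OF this 0] show ?case by (simp add: v_def f_def)
    next
      case (Suc k)
      define w where "w = (\<lambda>z. time_iter u0 (Op j) (dt j) S k (pr z))"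
      define b where "b = e / 2 + real k * dt j * err"
      have "time_iter u0 (Op j) (dt j) S (Suc k) x = w x + dt j * Op j w x"
        using Suc.prems by (simp add: w_def pr_self)
      also have "\<dots> \<le> w x + dt j * FS j (K j) w x + dt j * \<kappa> j"
        using mult_left_mono[OF Op[of j w x], of "dt j"] dt_pos by (simp add: distrib_left)
      also have "w x + dt j * FS j (K j) w x \<le> (v k (pr x) + b) + dt j * FR j (\<lambda>z. v k (pr z) + b) x
          + dt j * (2 / (K j)\<^sup>2 * max (DS j (\<lambda>z. v k (pr z) + b) x) 0)"
        by (rule st.step_defect[OF KL_pos KL_ge dts_pos cfl]) (simp add: w_def b_def Suc.IH[OF pr_in])
      also have "FR j (\<lambda>z. v k (pr z) + b) x = FR j (\<lambda>z. v k (pr z)) x" by (rule shift)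
      also have "DS j (\<lambda>z. v k (pr z) + b) x = DS j (\<lambda>z. v k (pr z)) x" by (rule st.D1_shift)
      also have "dt j * (2 / (K j)\<^sup>2 * max (DS j (\<lambda>z. v k (pr z)) x) 0) \<le> dt j * (2 / (K j)\<^sup>2 * Q)"
        using curv[OF Suc.prems, of k] Q dt_pos by (intro mult_left_mono) auto
      finally have "time_iter u0 (Op j) (dt j) S (Suc k) x \<le> v (Suc k) x + b + dt j * err"
        using super[OF Suc.prems, of k] by (simp add: err_def distrib_left)
      then show ?case by (simp add: b_def algebra_simps)
    qed
    show ?case
    proof (intro ballI allI impI)
      fix x k assume x: "x \<in> S" and k: "real k * dt j \<le> Tm"
      have "real k * dt j * err \<le> Tm * err" using k err0 by (intro mult_right_mono)
      also have "\<dots> \<le> Tm * (e / (2 * Tm))" using elim(1) Tm by (intro mult_left_mono) (auto simp: err_def)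
      also have "\<dots> = e / 2" using Tm by simp
      finally have "real k * dt j * err \<le> e / 2" .
      then show "time_iter u0 (Op j) (dt j) S k x \<le> W u0 j k x + e"
        using main[OF x, of k] v_le[OF x, of k x] by simp
    qed
  qed
qed

text \<open>The lower bound is the upper bound for -u0 and the conjugate operator
  \<open>Op'\<close>. Oddness is used only for the elliptic and reduced schemes; \<open>Op'\<close>
  inherits the error bound.\<close>

lemma perturbed_scheme_close:
  assumes u0: "continuous_on S u0"
    and Op: "\<And>j w x. \<bar>Op j w x - FS j (K j) w x\<bar> \<le> \<kappa> j" and \<kappa>: "\<kappa> \<longlonglongrightarrow> 0"
    and e: "e > 0" and Tm: "Tm > 0"
  shows "\<forall>\<^sub>F j in sequentially. \<forall>x\<in>S. \<forall>k. real k * dt j \<le> Tm \<longrightarrow>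
    \<bar>time_iter u0 (Op j) (dt j) S k x - W u0 j k x\<bar> \<le> e"
proof -
  define Op' where "Op' = (\<lambda>j w x. - Op j (\<lambda>z. - w z) x)"
  have \<kappa>0: "\<kappa> j \<ge> 0" for j using Op[of j undefined undefined] by (rule order_trans[rotated]) simp
  have "Op j w x \<le> FS j (K j) w x + \<kappa> j" for j w x using Op[of j w x] by (simp add: abs_le_iff)
  from perturbed_scheme_le[OF u0 this \<kappa> \<kappa>0 e Tm]
  have 1: "\<forall>\<^sub>F j in sequentially. \<forall>x\<in>S. \<forall>k. real k * dt j \<le> Tm \<longrightarrow>
    time_iter u0 (Op j) (dt j) S k x \<le> W u0 j k x + e" .
  have "Op' j w x \<le> FS j (K j) w x + \<kappa> j" for j w x
    using Op[of j "\<lambda>z. - w z" x] stencil.FKL_uminus[OF st[of j] KL_pos(1)[of j], of "L j" w x]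
    by (simp add: Op'_def abs_le_iff)
  from perturbed_scheme_le[OF continuous_on_minus[OF u0] this \<kappa> \<kappa>0 e Tm]
  have 2: "\<forall>\<^sub>F j in sequentially. \<forall>x\<in>S. \<forall>k. real k * dt j \<le> Tm \<longrightarrow>
    time_iter (\<lambda>x. - u0 x) (Op' j) (dt j) S k x \<le> W (\<lambda>x. - u0 x) j k x + e" .
  have 3: "time_iter (\<lambda>x. - u0 x) (Op' j) (dt j) S k = (\<lambda>x. - time_iter u0 (Op j) (dt j) S k x)" for j k
    by (induction k) (auto simp: Op'_def)
  from 1 2 show ?thesis
    unfolding 3 monotone_step.iter_uminus[OF step]
    by eventually_elim (simp add: abs_le_iff algebra_simps)
qed

lemma perturbed_scheme_converges:
  assumes u0: "continuous_on S u0"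
    and uniq: "\<And>v. visc_sol \<Omega> D\<rho> u0 v \<Longrightarrow> \<forall>x\<in>S. \<forall>t\<ge>0. v x t = u x t"
    and Op: "\<And>j w x. \<bar>Op j w x - FS j (K j) w x\<bar> \<le> \<kappa> j" and \<kappa>: "\<kappa> \<longlonglongrightarrow> 0"
  shows "loc_unif_conv \<Omega> (\<lambda>j. disc_sol u0 (Op j) (dt j) S) u"
  unfolding loc_unif_conv_def
proof (intro allI impI)
  fix C :: "((real^2) \<times> real) set" and e :: real
  assume C: "compact C" "C \<subseteq> S \<times> {0..}" and "e > 0"
  then have e: "e / 2 > 0" by simp
  obtain B where B: "\<And>p. p \<in> C \<Longrightarrow> norm p \<le> B" using C(1) compact_imp_bounded bounded_iff by metis
  have "\<bar>B\<bar> + 1 > 0" by simp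
  have "\<forall>\<^sub>F j in sequentially. \<forall>(x, t)\<in>C. \<bar>disc_sol u0 (FR j) (dt j) S x t - u x t\<bar> < e / 2"
    by (rule reduced_scheme_converges[OF u0 _ C e]) (rule uniq)
  with perturbed_scheme_close[OF u0 Op \<kappa> e \<open>\<bar>B\<bar> + 1 > 0\<close>]
  show "\<forall>\<^sub>F j in sequentially. \<forall>(x, t)\<in>C. \<bar>disc_sol u0 (Op j) (dt j) S x t - u x t\<bar> < e"
  proof eventually_elim
    case (elim j)
    show ?case
    proof (clarify)
      fix x t assume xt: "(x, t) \<in> C"
      then have x: "x \<in> S" "t \<ge> 0" using C by auto
      define k where "k = nat \<lfloor>t / dt j\<rfloor>"
      have "real k \<le> t / dt j" using x dts_pos[of j] by (simp add: k_def)
      then have "real k * dt j \<le> t" using dts_pos[of j] by (simp add: pos_le_divide_eq)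
      also have "t \<le> \<bar>B\<bar> + 1" using B[OF xt] norm_snd_le[where x = x and y = t] by simp
      finally have "\<bar>time_iter u0 (Op j) (dt j) S k x - W u0 j k x\<bar> \<le> e / 2" using elim(1) x by blast
      moreover have "\<bar>W u0 j k x - u x t\<bar> < e / 2" using elim(2) xt by (auto simp: disc_sol_def k_def)
      ultimately show "\<bar>disc_sol u0 (Op j) (dt j) S x t - u x t\<bar> < e"
        unfolding disc_sol_def k_def[symmetric] by arith
    qed
  qed
qed

end

theorem mainTheorem17:
  fixes \<Omega> :: "(real^2) set" and \<rho> :: "real^2 \<Rightarrow> real" and D\<rho> :: "real^2 \<Rightarrow> real^2"
    and u0 :: "real^2 \<Rightarrow> real" and u :: "real^2 \<Rightarrow> real \<Rightarrow> real"
    and h :: "nat \<Rightarrow> real" and n\<theta> :: "nat \<Rightarrow> nat" and nS :: "nat \<Rightarrow> nat"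
    and off :: "nat \<Rightarrow> nat \<Rightarrow> int \<times> int"
    and K :: "nat \<Rightarrow> real" and L :: "nat \<Rightarrow> real" and \<epsilon> :: "nat \<Rightarrow> real" and dt :: "nat \<Rightarrow> real"
  assumes dom: "C2_domain \<Omega> \<rho> D\<rho>"
    and sol: "visc_sol \<Omega> D\<rho> u0 u"
    and uniq: "\<And>v. visc_sol \<Omega> D\<rho> u0 v \<Longrightarrow> \<forall>x\<in>closure \<Omega>. \<forall>t\<ge>0. v x t = u x t"
    and h_pos: "\<And>j. h j > 0"
    and n\<theta>_pos: "\<And>j. n\<theta> j \<ge> 1"
    and nS_pos: "\<And>j. nS j \<ge> 1"
    and stencil: "\<And>j. valid_stencil (n\<theta> j) (nS j) (off j)"
    and KL: "\<And>j. K j > 0 \<and> L j > 0 \<and> K j * sqrt (L j) \<ge> 1"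
    and eps_pos: "\<And>j. \<epsilon> j > 0"
    and dt_pos: "\<And>j. dt j > 0"
    and dt_cfl: "\<And>j. dt j \<le> 1 / (K j / h j + 2 * L j / (h j * real (n\<theta> j))^2)"
    and h_lim: "h \<longlonglongrightarrow> 0"
    and d\<theta>_lim: "(\<lambda>j. 2 * pi / real (nS j)) \<longlonglongrightarrow> 0"
    and dt_lim: "dt \<longlonglongrightarrow> 0"
    and eps_lim: "\<epsilon> \<longlonglongrightarrow> 0"
    and consistent: "consistent_seq (\<lambda>j. Fe (h j) (n\<theta> j) (nS j) (off j) (K j) (L j))"
    and bdd_e: "\<exists>M. \<forall>j k x. x \<in> closure \<Omega> \<longrightarrow>
      \<bar>time_iter u0 (Fe (h j) (n\<theta> j) (nS j) (off j) (K j) (L j)) (dt j) (closure \<Omega>) k x\<bar> \<le> M"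
    and bdd_f: "\<exists>M. \<forall>j k x. x \<in> closure \<Omega> \<longrightarrow>
      \<bar>time_iter u0 (Ff (h j) (n\<theta> j) (nS j) (off j) (K j) (L j) (\<epsilon> j)) (dt j) (closure \<Omega>) k x\<bar> \<le> M"
  shows "loc_unif_conv \<Omega>
           (\<lambda>j. disc_sol u0 (Fe (h j) (n\<theta> j) (nS j) (off j) (K j) (L j)) (dt j) (closure \<Omega>)) u
       \<and> loc_unif_conv \<Omega>
           (\<lambda>j. disc_sol u0 (Ff (h j) (n\<theta> j) (nS j) (off j) (K j) (L j) (\<epsilon> j)) (dt j) (closure \<Omega>)) u"
proof -
  have pos: "K j / h j + 2 * L j / (h j * real (n\<theta> j))\<^sup>2 > 0" for j
    using KL[of j] h_pos[of j] by (intro add_pos_nonneg) auto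
  interpret affine_scheme h n\<theta> nS off K L dt \<Omega> \<rho> D\<rho>
  proof unfold_locales
    fix j
    show "dt j * (K j / h j + 2 * L j / (h j * real (n\<theta> j))\<^sup>2) \<le> 1"
      using dt_cfl[of j] pos[of j] by (simp add: pos_le_divide_eq)
  qed (use assms in \<open>simp_all add: dom h_lim consistent dt_lim\<close>)
  have "continuous_on (closure \<Omega> \<times> {0..}) (\<lambda>(x, t). u x t)" using sol by (simp add: visc_sol_def)
  moreover have "continuous_on (closure \<Omega>) (\<lambda>x. (x, 0::real))" by (intro continuous_intros)
  ultimately have "continuous_on (closure \<Omega>) (\<lambda>x. (\<lambda>(x, t). u x t) (x, 0))"
    by (rule continuous_on_compose2) auto
  then have u0: "continuous_on (closure \<Omega>) u0"
    by (rule continuous_on_eq) (use sol in \<open>auto simp: visc_sol_def\<close>)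
  show ?thesis
  proof
    show "loc_unif_conv \<Omega>
           (\<lambda>j. disc_sol u0 (Fe (h j) (n\<theta> j) (nS j) (off j) (K j) (L j)) (dt j) (closure \<Omega>)) u"
      by (rule perturbed_scheme_converges[OF u0 uniq, where \<kappa> = "\<lambda>_. 0"]) auto
    \<comment> \<open>The perturbation size for the filtered scheme is the constant from
      \<open>Sfilter_close\<close>; for the elliptic scheme it is 0.\<close>
    have "(\<lambda>j. 21 * \<epsilon> j) \<longlonglongrightarrow> 21 * 0" by (intro tendsto_intros eps_lim)
    then show "loc_unif_conv \<Omega>
           (\<lambda>j. disc_sol u0 (Ff (h j) (n\<theta> j) (nS j) (off j) (K j) (L j) (\<epsilon> j)) (dt j) (closure \<Omega>)) u"
      by (intro perturbed_scheme_converges[OF u0 uniq, where \<kappa> = "\<lambda>j. 21 * \<epsilon> j"])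
        (auto simp: Ff_def intro!: Sfilter_close eps_pos)
  qed
qed

end
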